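(* Let $\mathfrak G$ be the group defined in the context, with the subgroups $N_m$, the modules $V_n$, their subspaces $V_n^r$, and the isomorphisms $\alpha\oplus\beta: N_m/N_{m+1}\to V_m\oplus V_{m-1}$. Let $\gamma_n(\mathfrak G)$ denote the lower central series of $\mathfrak G$ (with $\gamma_1(\mathfrak G)=\mathfrak G$). For all $m\ge 1$: 1. $\gamma_{2^m+1}(\mathfrak G)=N_m$. 2. $\gamma_{2^m+1+r}(\mathfrak G)=N_{m+1}\,\alpha^{-1}(V_m^r)\,\beta^{-1}(V_{m-1}^r)$ for $r=0,\dots,2^m$. 3. $$\operatorname{rank}(\gamma_n(\mathfrak G)/\gamma_{n+1}(\mathfrak G))=\begin{cases}3&\text{if }n=1,\\ 2&\text{if }n=2,\\ 2&\text{if }n=2^m+1+r\text{ with }0\le r<2^{m-1},\\ 1&\text{if }n=2^m+1+r\text{ with }2^{m-1}\le r<2^m.\end{cases}$$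
   Context: Let $\Sigma=\mathbb F_2=\{0,1\}$ and let $\Sigma^*$ be the set of finite words over $\Sigma$, viewed as a rooted binary tree. For $x\in\Sigma$ write $\overline x=1-x$. Define tree automorphisms $a,b,c,d$ of $\Sigma^*$ (acting on the left; words too short for a rule to apply are fixed) by $a(x\sigma)=\overline x\sigma$; $b(0x\sigma)=0\overline x\sigma$, $b(1\sigma)=1c(\sigma)$; $c(0x\sigma)=0\overline x\sigma$, $c(1\sigma)=1d(\sigma)$; $d(0x\sigma)=0x\sigma$, $d(1\sigma)=1b(\sigma)$. Put $\mathfrak G=\langle a,b,c,d\rangle$. An automorphism fixing all words of length $m$ is identified with the $2^m$-tuple $(g_\sigma)_{\sigma\in\Sigma^m}$ (lexicographic order) of its actions on the subtrees below the words of length $m$: $g(\sigma\tau)=\sigma g_\sigma(\tau)$. Conventions: $[g,h]=ghg^{-1}h^{-1}$. Let $x=[a,b]$, let $K$ be the normal closure of $x$ in $\mathfrak G$, and let $T$ be the normal closure of $x^2$ in $\mathfrak G$. One has $K\times K\le K$. For $Q\le K$ let $Q_m=Q\times\dots\times Q$ ($2^m$ copies), a subgroup of $\mathfrak G$ acting on each subtree starting on level $m$ by the corresponding factor ($Q_0=Q$). For $m\ge1$ let $N_m=K_m\cdot T_{m-1}$. For $n\ge0$ let $V_n=\mathbb F_2[X_1,\dots,X_n]/(X_1^2-1,\dots,X_n^2-1)$ (so $V_0=\mathbb F_2$); the word $\sigma_1\cdots\sigma_n\in\Sigma^n$ corresponds to the monomial $X_1^{\sigma_1}\cdots X_n^{\sigma_n}$.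 For $0\le r\le 2^n-1$ with binary expansion $r=\sum_{i=1}^n r_i2^{i-1}$, $r_i\in\{0,1\}$, put $v_n^r=(1-X_1)^{r_1}\cdots(1-X_n)^{r_n}$ and let $V_n^r$ be the span of $v_n^r,v_n^{r+1},\dots,v_n^{2^n-1}$; put $V_n^r=0$ for $r\ge2^n$. For $m\ge1$ there is an isomorphism $\alpha\oplus\beta:N_m/N_{m+1}\to V_m\oplus V_{m-1}$ in which $\alpha$ sends the class of $(1,\dots,1,x,1,\dots,1)\in K_m$ to the monomial of $V_m$ corresponding to the vertex at which $x$ stands, and $\beta$ sends the class of $(1,\dots,1,x^2,1,\dots,1)\in T_{m-1}$ to the corresponding monomial of $V_{m-1}$. For subspaces $V\subseteq V_m$, $W\subseteq V_{m-1}$, $N_{m+1}\alpha^{-1}(V)\beta^{-1}(W)$ denotes the full preimage of $V\oplus W$ in $N_m$ under $N_m\to N_m/N_{m+1}\cong V_m\oplus V_{m-1}$. The rank of an abelian group $M$ here means $\dim_{\mathbb F_2}(M\otimes\mathbb F_2)$. *)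

theory Defs
  imports
    Complex_Main
    "HOL-Algebra.Free_Abelian_Groups"
    "HOL-Algebra.Generated_Groups"
    "HOL-Algebra.Bij"
    "HOL-Library.Z2"
begin

section \<open>Group-theoretic notions\<close>

definition commutator :: "('a, 'b) monoid_scheme \<Rightarrow> 'a \<Rightarrow> 'a \<Rightarrow> 'a" where
  "commutator G g h = g \<otimes>\<^bsub>G\<^esub> h \<otimes>\<^bsub>G\<^esub> inv\<^bsub>G\<^esub> g \<otimes>\<^bsub>G\<^esub> inv\<^bsub>G\<^esub> h"

definition commutator_subgroup :: "('a, 'b) monoid_scheme \<Rightarrow> 'a set \<Rightarrow> 'a set \<Rightarrow> 'a set" where
  "commutator_subgroup G H L = generate G {commutator G h l | h l. h \<in> H \<and> l \<in> L}"

definition normal_closure :: "('a, 'b) monoid_scheme \<Rightarrow> 'a set \<Rightarrow> 'a set" where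
  "normal_closure G S = generate G {g \<otimes>\<^bsub>G\<^esub> s \<otimes>\<^bsub>G\<^esub> inv\<^bsub>G\<^esub> g | g s. g \<in> carrier G \<and> s \<in> S}"

text \<open>The series starts at index 1; the value at index 0 is a dummy.\<close>

fun lower_central :: "('a, 'b) monoid_scheme \<Rightarrow> nat \<Rightarrow> 'a set" where
  "lower_central G 0 = carrier G"
| "lower_central G (Suc 0) = carrier G"
| "lower_central G (Suc (Suc n)) =
     commutator_subgroup G (lower_central G (Suc n)) (carrier G)"

definition additive_group :: "'a::monoid_add set \<Rightarrow> 'a monoid" where
  "additive_group A = \<lparr>carrier = A, monoid.mult = (+), one = 0\<rparr>"

text \<open>The tensor product over the integers of two abelian groups: the free abelian group on
  the pairs, modulo biadditivity (\<open>frag_of\<close> denotes a free generator).\<close>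

definition tensor_relations ::
    "('a, 'c) monoid_scheme \<Rightarrow> ('b, 'd) monoid_scheme \<Rightarrow> ('a \<times> 'b \<Rightarrow>\<^sub>0 int) set" where
  "tensor_relations M A =
     {frag_of (x \<otimes>\<^bsub>M\<^esub> y, c) - frag_of (x, c) - frag_of (y, c) | x y c.
        x \<in> carrier M \<and> y \<in> carrier M \<and> c \<in> carrier A} \<union>
     {frag_of (x, c \<otimes>\<^bsub>A\<^esub> d) - frag_of (x, c) - frag_of (x, d) | x c d.
        x \<in> carrier M \<and> c \<in> carrier A \<and> d \<in> carrier A}"

definition tensor_group ::
    "('a, 'c) monoid_scheme \<Rightarrow> ('b, 'd) monoid_scheme \<Rightarrow> ('a \<times> 'b \<Rightarrow>\<^sub>0 int) set monoid" where
  "tensor_group M A =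
     (let F = free_Abelian_group (carrier M \<times> carrier A)
      in F Mod generate F (tensor_relations M A))"

text \<open>\<open>has_rank M k\<close> says that \<open>M \<otimes> \<bbbF>\<^sub>2\<close> has dimension \<open>k\<close> over the field \<open>\<bbbF>\<^sub>2\<close>, i.e. is
  isomorphic to \<open>\<bbbF>\<^sub>2\<^sup>k\<close>. Since the only scalars are 0 and 1, every isomorphism of groups here is
  linear.\<close>

definition has_rank :: "('a, 'b) monoid_scheme \<Rightarrow> nat \<Rightarrow> bool" where
  "has_rank M k \<longleftrightarrow>
     tensor_group M (additive_group (UNIV :: bit set))
       \<cong> product_group {..<k} (\<lambda>_. additive_group (UNIV :: bit set))"


section \<open>The group\<close>

text \<open>The letters 0 and 1 are \<^const>\<open>False\<close> and \<^const>\<open>True\<close>.\<close>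

type_synonym word = "bool list"

fun grig_a :: "word \<Rightarrow> word" where
  "grig_a (x # w) = (\<not> x) # w"
| "grig_a w = w"

fun grig_b :: "word \<Rightarrow> word" and grig_c :: "word \<Rightarrow> word" and grig_d :: "word \<Rightarrow> word" where
  "grig_b (False # x # w) = False # (\<not> x) # w"
| "grig_b (True # w) = True # grig_c w"
| "grig_b w = w"
| "grig_c (False # x # w) = False # (\<not> x) # w"
| "grig_c (True # w) = True # grig_d w"
| "grig_c w = w"
| "grig_d (False # x # w) = False # x # w"
| "grig_d (True # w) = True # grig_b w"
| "grig_d w = w"

lemma grig_involutions:
  "grig_a (grig_a w) = w" "grig_b (grig_b w) = w" "grig_c (grig_c w) = w" "grig_d (grig_d w) = w"
proof -
  show "grig_a (grig_a w) = w"
    by (cases w) auto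
  show "grig_b (grig_b w) = w" "grig_c (grig_c w) = w" "grig_d (grig_d w) = w"
    by (induction w and w and w rule: grig_b_grig_c_grig_d.induct) auto
qed

lemma grig_in_BijGroup: "{grig_a, grig_b, grig_c, grig_d} \<subseteq> carrier (BijGroup UNIV)"
proof -
  have "bij f" if "\<And>w. f (f w) = w" for f :: "word \<Rightarrow> word"
    using that by (metis bijI')
  then show ?thesis
    by (simp add: BijGroup_def Bij_def grig_involutions)
qed

definition Grig :: "(word \<Rightarrow> word) monoid" where
  "Grig = subgroup_generated (BijGroup UNIV) {grig_a, grig_b, grig_c, grig_d}"

lemma group_Grig: "group Grig"
  unfolding Grig_def by (simp add: group.group_subgroup_generated group_BijGroup)

text \<open>\<open>tuple_act m q\<close> is the automorphism \<open>(q \<sigma>)\<^sub>\<sigma>\<close>, indexed by the words of length \<open>m\<close>, and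
  \<open>at_vertex \<sigma> g\<close> is the tuple \<open>(1, \<dots>, 1, g, 1, \<dots>, 1)\<close> with \<open>g\<close> at \<open>\<sigma>\<close>.\<close>

definition tuple_act :: "nat \<Rightarrow> (word \<Rightarrow> word \<Rightarrow> word) \<Rightarrow> word \<Rightarrow> word" where
  "tuple_act m q w = (if length w < m then w else take m w @ q (take m w) (drop m w))"

definition at_vertex :: "word \<Rightarrow> (word \<Rightarrow> word) \<Rightarrow> word \<Rightarrow> word" where
  "at_vertex \<sigma> g = tuple_act (length \<sigma>) (\<lambda>\<tau>. if \<tau> = \<sigma> then g else id)"

definition level_power :: "(word \<Rightarrow> word) set \<Rightarrow> nat \<Rightarrow> (word \<Rightarrow> word) set" where
  "level_power Q m = {tuple_act m q | q. \<forall>\<sigma>. length \<sigma> = m \<longrightarrow> q \<sigma> \<in> Q}"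

definition x_elt :: "word \<Rightarrow> word" where
  "x_elt = commutator Grig grig_a grig_b"

definition x2_elt :: "word \<Rightarrow> word" where
  "x2_elt = x_elt \<otimes>\<^bsub>Grig\<^esub> x_elt"

definition K_grp :: "(word \<Rightarrow> word) set" where
  "K_grp = normal_closure Grig {x_elt}"

definition T_grp :: "(word \<Rightarrow> word) set" where
  "T_grp = normal_closure Grig {x2_elt}"

text \<open>Only used for \<open>m \<ge> 1\<close>.\<close>

definition N_grp :: "nat \<Rightarrow> (word \<Rightarrow> word) set" where
  "N_grp m = level_power K_grp m <#>\<^bsub>Grig\<^esub> level_power T_grp (m - 1)"

definition N_quot :: "nat \<Rightarrow> (word \<Rightarrow> word) set monoid" where
  "N_quot m = (Grig\<lparr>carrier := N_grp m\<rparr>) Mod N_grp (Suc m)"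

definition gamma_quot :: "nat \<Rightarrow> (word \<Rightarrow> word) set monoid" where
  "gamma_quot n = (Grig\<lparr>carrier := lower_central Grig n\<rparr>) Mod lower_central Grig (Suc n)"


section \<open>The modules\<close>

text \<open>A polynomial is a finitely supported function from exponent vectors to coefficients.
  Taking the exponents modulo 2 imposes exactly the relations \<open>X\<^sub>i\<^sup>2 = 1\<close>, so \<open>V_mod n\<close> is
  \<open>\<bbbF>\<^sub>2[X\<^sub>1, \<dots>, X\<^sub>n]/(X\<^sub>1\<^sup>2 - 1, \<dots>, X\<^sub>n\<^sup>2 - 1)\<close>.\<close>

type_synonym qpoly = "(nat \<Rightarrow>\<^sub>0 bit) \<Rightarrow>\<^sub>0 bit"

definition qvar :: "nat \<Rightarrow> qpoly" where
  "qvar i = Poly_Mapping.single (Poly_Mapping.single i 1) 1"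

lemma qvar_square: "qvar i ^ 2 = 1"
  by (simp add: qvar_def power2_eq_square mult_single flip: single_add)

definition qscale :: "bit \<Rightarrow> qpoly \<Rightarrow> qpoly" where
  "qscale c p = Poly_Mapping.single 0 c * p"

lemma vector_space_qscale: "vector_space qscale"
proof
  fix c d :: bit and p q :: qpoly
  show "qscale c (p + q) = qscale c p + qscale c q"
    by (simp add: qscale_def distrib_left)
  show "qscale (c + d) p = qscale c p + qscale d p"
    unfolding qscale_def single_add by (rule distrib_right)
  show "qscale c (qscale d p) = qscale (c * d) p"
    by (simp only: qscale_def mult_single add_0_left flip: mult.assoc)
  show "qscale 1 p = p"
    by (simp add: qscale_def)
qed

definition V_mod :: "nat \<Rightarrow> qpoly set" where
  "V_mod n = {p. \<forall>e \<in> Poly_Mapping.keys p. Poly_Mapping.keys e \<subseteq> {1..n}}"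

definition word_monomial :: "word \<Rightarrow> qpoly" where
  "word_monomial \<sigma> = (\<Prod>i = 1..length \<sigma>. qvar i ^ of_bool (\<sigma> ! (i - 1)))"

definition v_elt :: "nat \<Rightarrow> nat \<Rightarrow> qpoly" where
  "v_elt n r = (\<Prod>i = 1..n. (1 - qvar i) ^ (r div 2 ^ (i - 1) mod 2))"

text \<open>For \<open>r \<ge> 2 ^ n\<close> this is the span of the empty set, i.e. the zero subspace.\<close>

definition V_sub :: "nat \<Rightarrow> nat \<Rightarrow> qpoly set" where
  "V_sub n r = module.span qscale (v_elt n ` {r..<2 ^ n})"

text \<open>\<open>alpha_beta_iso m \<phi>\<close>: \<open>\<phi>\<close> is the isomorphism \<open>\<alpha> \<oplus> \<beta>\<close>. The prescribed values determine
  \<open>\<phi>\<close> on \<open>N\<^sub>m / N\<^sub>m\<^sub>+\<^sub>1\<close>, because they form a basis of the target.\<close>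

definition alpha_beta_iso :: "nat \<Rightarrow> ((word \<Rightarrow> word) set \<Rightarrow> qpoly \<times> qpoly) \<Rightarrow> bool" where
  "alpha_beta_iso m \<phi> \<longleftrightarrow>
     \<phi> \<in> iso (N_quot m) (additive_group (V_mod m) \<times>\<times> additive_group (V_mod (m - 1))) \<and>
     (\<forall>\<sigma>. length \<sigma> = m \<longrightarrow>
        \<phi> (N_grp (Suc m) #>\<^bsub>Grig\<^esub> at_vertex \<sigma> x_elt) = (word_monomial \<sigma>, 0)) \<and>
     (\<forall>\<tau>. length \<tau> = m - 1 \<longrightarrow>
        \<phi> (N_grp (Suc m) #>\<^bsub>Grig\<^esub> at_vertex \<tau> x2_elt) = (0, word_monomial \<tau>))"

text \<open>The subgroup \<open>N\<^sub>m\<^sub>+\<^sub>1 \<alpha>\<^sup>-\<^sup>1(V) \<beta>\<^sup>-\<^sup>1(W)\<close>.\<close>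

definition full_preimage ::
    "nat \<Rightarrow> ((word \<Rightarrow> word) set \<Rightarrow> qpoly \<times> qpoly) \<Rightarrow> qpoly set \<Rightarrow> qpoly set \<Rightarrow> (word \<Rightarrow> word) set" where
  "full_preimage m \<phi> V W = {g \<in> N_grp m. \<phi> (N_grp (Suc m) #>\<^bsub>Grig\<^esub> g) \<in> V \<times> W}"

end

theory Submission
  imports Defs "HOL-Library.Product_Plus"
begin

text \<open>Write \<open>(g, h)\<close> for the automorphism acting as \<open>g\<close> and \<open>h\<close> on the two subtrees below the root.
Then \<open>b = (a, c)\<close>, \<open>c = (a, d)\<close>, \<open>d = (1, b)\<close>, hence \<open>x = [a, b] = (ca, ac)\<close>. Everything rests on
three commutators of \<open>x\<close>: \<open>[x, a] = [x, b] = x\<^sup>2\<close> and \<open>[x, d] = (1, x)\<close>.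

The last one gives \<open>K \<times> K \<le> K\<close>. Together they say that \<open>x\<close> is central of order two modulo \<open>N\<^sub>1\<close>,
and that \<open>N\<^sub>1\<close> is normally generated by the two elements \<open>(1, x)\<close> and \<open>x\<^sup>2\<close>; with the
element \<open>z = [a, d] = (b, b)\<close> this yields \<open>\<gamma>\<^sub>2 = K \<union> zK\<close> and \<open>\<gamma>\<^sub>3 = N\<^sub>1\<close>. As \<open>N\<^sub>m\<^sub>+\<^sub>1 = N\<^sub>m \<times> N\<^sub>m\<close>, all
quotients \<open>N\<^sub>m / N\<^sub>m\<^sub>+\<^sub>1\<close> are direct powers of \<open>N\<^sub>1 / N\<^sub>2\<close>. The basis elements \<open>(1, \<dots>, x, \<dots>, 1)\<close> and
\<open>(1, \<dots>, x\<^sup>2, \<dots>, 1)\<close> of \<open>N\<^sub>m / N\<^sub>m\<^sub>+\<^sub>1\<close> are told apart by parities: the number of vertices of a fixed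
level at which an element permutes the two subtrees is a homomorphism to \<open>\<bbbF>\<^sub>2\<close>, and the parities on
levels 1 and 2 of suitable sections are the coordinates \<open>\<alpha>\<close> and \<open>\<beta>\<close>. Conjugation permutes these
coordinates, so \<open>N\<^sub>m / N\<^sub>m\<^sub>+\<^sub>1\<close> is the sum of two permutation modules (\<open>alpha_conj\<close>).

The permutation module \<open>V\<^sub>n\<close> is uniserial. The action of the group on it respects the recursive
description of the coordinates with respect to the basis \<open>v\<^sub>n\<^sup>r\<close>; it is trivial on every quotient
\<open>V\<^sub>n\<^sup>r / V\<^sub>n\<^sup>r\<^sup>+\<^sup>1\<close>, and for every \<open>r < 2\<^sup>n - 1\<close> some generator \<open>s\<close> satisfies
\<open>(1 - s) v\<^sub>n\<^sup>r \<in> v\<^sub>n\<^sup>r\<^sup>+\<^sup>1 + V\<^sub>n\<^sup>r\<^sup>+\<^sup>2\<close> (\<open>uniserial\<close>). Consequently taking the commutator with the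
whole group moves the subgroup \<open>N\<^sub>m\<^sub>+\<^sub>1 \<alpha>\<^sup>-\<^sup>1(V\<^sub>m\<^sup>r) \<beta>\<^sup>-\<^sup>1(V\<^sub>m\<^sub>-\<^sub>1\<^sup>r)\<close> to the next one, at least modulo \<open>N\<^sub>m\<^sub>+\<^sub>1\<close>.

What remains is that these commutators contain all of \<open>N\<^sub>m\<^sub>+\<^sub>1\<close>. They contain the commutators of the
diagonal element \<open>(x, \<dots>, x)\<close> of level \<open>m\<close>, which spans \<open>V\<^sub>m\<^sup>r\<close> for the last index \<open>r = 2\<^sup>m - 1\<close>. Its
commutators with \<open>b\<close>, \<open>c\<close>, \<open>d\<close> act only below the rightmost vertex of level \<open>m - 1\<close>, and two of them
act there as \<open>(1, x\<^sup>2)\<close> and as \<open>(x\<^sup>2, (1, x))\<close>. So they supply \<open>x\<^sup>2\<close> at one vertex of level \<open>m\<close> and,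
after cancelling a translate of it, \<open>x\<close> at one vertex of level \<open>m + 1\<close>. The group is
transitive on levels, and every group element occurs as a section at every vertex; so these two elements
normally generate \<open>N\<^sub>m\<^sub>+\<^sub>1\<close> (\<open>N_subset_diag_commutators\<close>). The ranks are then the
dimensions of the successive quotients, all of which are elementary abelian.\<close>

section \<open>The group as a group of maps, and its normal subgroups\<close>

abbreviation iv :: "(word \<Rightarrow> word) \<Rightarrow> word \<Rightarrow> word" where
  "iv \<equiv> inv_into UNIV"

abbreviation GG :: "(word \<Rightarrow> word) set" where
  "GG \<equiv> carrier Grig"

abbreviation comm :: "(word \<Rightarrow> word) \<Rightarrow> (word \<Rightarrow> word) \<Rightarrow> word \<Rightarrow> word" where
  "comm g h \<equiv> g \<circ> h \<circ> iv g \<circ> iv h"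

interpretation Grig: group Grig by (rule group_Grig)

lemma bij_Grig: "g \<in> GG \<Longrightarrow> bij g"
  using group.carrier_subgroup_generated_subset[OF group_BijGroup, of "UNIV :: word set"
      "{grig_a, grig_b, grig_c, grig_d}"]
  by (auto simp: Grig_def BijGroup_def Bij_def)

lemma Bij_UNIV_iff: "g \<in> Bij UNIV \<longleftrightarrow> bij g"
  by (simp add: Bij_def extensional_def)

lemma mult_Grig [simp]: "g \<in> GG \<Longrightarrow> h \<in> GG \<Longrightarrow> g \<otimes>\<^bsub>Grig\<^esub> h = g \<circ> h"
  using bij_Grig[of g] bij_Grig[of h]
  by (simp add: Grig_def BijGroup_def Bij_UNIV_iff compose_def fun_eq_iff)

lemma one_Grig [simp]: "\<one>\<^bsub>Grig\<^esub> = id"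
  by (auto simp: Grig_def BijGroup_def)

lemma id_Grig [simp, intro]: "id \<in> GG"
  using Grig.one_closed by simp

lemma comp_Grig [simp, intro]: "g \<in> GG \<Longrightarrow> h \<in> GG \<Longrightarrow> g \<circ> h \<in> GG"
  using Grig.m_closed[of g h] by simp

lemma iv_left [simp]: "g \<in> GG \<Longrightarrow> iv g \<circ> g = id"
  by (simp add: bij_Grig bij_is_inj)

lemma iv_right [simp]: "g \<in> GG \<Longrightarrow> g \<circ> iv g = id"
  by (meson bij_Grig bij_is_surj surj_iff)

lemma inv_Grig [simp]: 
  assumes "g \<in> GG" shows "inv\<^bsub>Grig\<^esub> g = iv g"
proof -
  have "g \<circ> inv\<^bsub>Grig\<^esub> g = id"
    using Grig.r_inv[OF assms] assms by simp
  then show ?thesis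
    using assms by (metis comp_assoc comp_id id_comp iv_left)
qed

lemma iv_Grig [simp, intro]: "g \<in> GG \<Longrightarrow> iv g \<in> GG"
  using Grig.inv_closed inv_Grig by metis

lemma iv_left2 [simp]: "g \<in> GG \<Longrightarrow> iv g \<circ> (g \<circ> h) = h"
  by (metis comp_assoc id_comp iv_left)

lemma iv_right2 [simp]: "g \<in> GG \<Longrightarrow> g \<circ> (iv g \<circ> h) = h"
  by (metis comp_assoc id_comp iv_right)

lemma iv_iv [simp]: "g \<in> GG \<Longrightarrow> iv (iv g) = g"
  by (simp add: bij_Grig inv_inv_eq)

lemma iv_comp: "g \<in> GG \<Longrightarrow> h \<in> GG \<Longrightarrow> iv (g \<circ> h) = iv h \<circ> iv g"
  by (simp add: bij_Grig o_inv_distrib)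

lemma iv_eqI: "g \<circ> h = id \<Longrightarrow> h \<circ> g = id \<Longrightarrow> iv g = h"
  by (rule inv_unique_comp)

lemma commutator_Grig: "g \<in> GG \<Longrightarrow> h \<in> GG \<Longrightarrow> commutator Grig g h = comm g h"
  by (simp add: commutator_def)

lemma gens_Grig [simp, intro]: "grig_a \<in> GG" "grig_b \<in> GG" "grig_c \<in> GG" "grig_d \<in> GG"
  using grig_in_BijGroup by (auto simp: Grig_def carrier_subgroup_generated intro!: generate.incl)

lemma gens_square:
  "grig_a \<circ> grig_a = id" "grig_b \<circ> grig_b = id" "grig_c \<circ> grig_c = id" "grig_d \<circ> grig_d = id"
  by (auto simp: fun_eq_iff grig_involutions)

lemma klein_relations:
  "grig_b \<circ> grig_c = grig_d" "grig_c \<circ> grig_b = grig_d" "grig_c \<circ> grig_d = grig_b"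
  "grig_d \<circ> grig_c = grig_b" "grig_d \<circ> grig_b = grig_c" "grig_b \<circ> grig_d = grig_c"
proof -
  have "grig_b (grig_c w) = grig_d w \<and> grig_c (grig_b w) = grig_d w \<and>
      grig_c (grig_d w) = grig_b w \<and> grig_d (grig_c w) = grig_b w \<and>
      grig_d (grig_b w) = grig_c w \<and> grig_b (grig_d w) = grig_c w" for w
  proof (induction w)
    case (Cons x w)
    then show ?case by (cases x; cases w) auto
  qed auto
  then show "grig_b \<circ> grig_c = grig_d" "grig_c \<circ> grig_b = grig_d" "grig_c \<circ> grig_d = grig_b"
    "grig_d \<circ> grig_c = grig_b" "grig_d \<circ> grig_b = grig_c" "grig_b \<circ> grig_d = grig_c"
    by (auto simp: fun_eq_iff)
qed

lemma iv_gens: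
  "iv grig_a = grig_a" "iv grig_b = grig_b" "iv grig_c = grig_c" "iv grig_d = grig_d"
  by (rule iv_eqI; simp add: gens_square)+

lemma Grig_gens_subset_subgroup:
  assumes H: "subgroup H Grig" and "{grig_a, grig_b, grig_c, grig_d} \<subseteq> H"
  shows "GG \<subseteq> H"
proof -
  have "GG = generate Grig {grig_a, grig_b, grig_c, grig_d}"
  proof -
    have 1: "subgroup GG (BijGroup UNIV)"
      unfolding Grig_def carrier_subgroup_generated
      by (rule group.generate_is_subgroup[OF group_BijGroup]) auto
    have "generate (BijGroup UNIV \<lparr>carrier := GG\<rparr>) {grig_a, grig_b, grig_c, grig_d}
        = generate (BijGroup UNIV) {grig_a, grig_b, grig_c, grig_d}"
      using 1 by (intro group.generate_consistent[OF group_BijGroup])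
        (auto simp: gens_Grig)
    moreover have "BijGroup UNIV \<lparr>carrier := GG\<rparr> = Grig"
      unfolding Grig_def subgroup_generated_def
      by (simp add: BijGroup_def)
    moreover have "GG = generate (BijGroup UNIV) {grig_a, grig_b, grig_c, grig_d}"
      unfolding Grig_def carrier_subgroup_generated using grig_in_BijGroup by (simp add: Int_absorb1)
    ultimately show ?thesis by simp
  qed
  then show ?thesis
    using Grig.generate_subgroup_incl[OF assms(2) H] by simp
qed

lemma Grig_subgroupD:
  assumes "subgroup H Grig"
  shows "H \<subseteq> GG" "id \<in> H" "\<And>g h. g \<in> H \<Longrightarrow> h \<in> H \<Longrightarrow> g \<circ> h \<in> H" "\<And>g. g \<in> H \<Longrightarrow> iv g \<in> H"
proof -
  show s: "H \<subseteq> GG" using assms by (rule subgroup.subset)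
  show "id \<in> H" using subgroup.one_closed[OF assms] by simp
  show "g \<circ> h \<in> H" if "g \<in> H" "h \<in> H" for g h
    using subgroup.m_closed[OF assms that] s that by (simp add: subset_iff)
  show "iv g \<in> H" if "g \<in> H" for g
    using subgroup.m_inv_closed[OF assms that] s that by (simp add: subset_iff)
qed

lemma Grig_subgroupI:
  assumes "H \<subseteq> GG" "id \<in> H" "\<And>g h. g \<in> H \<Longrightarrow> h \<in> H \<Longrightarrow> g \<circ> h \<in> H" "\<And>g. g \<in> H \<Longrightarrow> iv g \<in> H"
  shows "subgroup H Grig"
  by (rule subgroup.intro) (use assms in \<open>auto simp: subset_iff\<close>)

lemma Grig_normalD:
  assumes "H \<lhd> Grig"
  shows "subgroup H Grig" "H \<subseteq> GG" "id \<in> H" "\<And>g h. g \<in> H \<Longrightarrow> h \<in> H \<Longrightarrow> g \<circ> h \<in> H"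
    "\<And>g. g \<in> H \<Longrightarrow> iv g \<in> H" "\<And>g h. g \<in> GG \<Longrightarrow> h \<in> H \<Longrightarrow> g \<circ> h \<circ> iv g \<in> H"
proof -
  show s: "subgroup H Grig" using assms by (simp add: normal_imp_subgroup)
  note sd = Grig_subgroupD[OF s]
  show "H \<subseteq> GG" "id \<in> H" "\<And>g h. g \<in> H \<Longrightarrow> h \<in> H \<Longrightarrow> g \<circ> h \<in> H"
    "\<And>g. g \<in> H \<Longrightarrow> iv g \<in> H" using sd by auto
  show "g \<circ> h \<circ> iv g \<in> H" if "g \<in> GG" "h \<in> H" for g h
    using normal.inv_op_closed2[OF assms that] that sd by (simp add: subset_iff)
qed

lemma conj_comp: "g \<in> GG \<Longrightarrow> h \<in> GG \<Longrightarrow> (g \<circ> h) \<circ> k \<circ> iv (g \<circ> h) = g \<circ> (h \<circ> k \<circ> iv h) \<circ> iv g"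
  by (simp add: iv_comp comp_assoc)

text \<open>The elements that, together with their inverses, conjugate a subgroup into itself form a subgroup;
  so only the four generating involutions have to be tested.\<close>

lemma Grig_normalI_gens:
  assumes H: "subgroup H Grig"
    and "\<And>s h. s \<in> {grig_a, grig_b, grig_c, grig_d} \<Longrightarrow> h \<in> H \<Longrightarrow> s \<circ> h \<circ> s \<in> H"
  shows "H \<lhd> Grig"
proof -
  note HD = Grig_subgroupD[OF H]
  let ?N = "{g \<in> GG. \<forall>h\<in>H. g \<circ> h \<circ> iv g \<in> H \<and> iv g \<circ> h \<circ> g \<in> H}"
  have "subgroup ?N Grig"
  proof (rule Grig_subgroupI)
    fix g g' assume g: "g \<in> ?N" and g': "g' \<in> ?N"
    have "(g \<circ> g') \<circ> h \<circ> iv (g \<circ> g') \<in> H \<and> iv (g \<circ> g') \<circ> h \<circ> (g \<circ> g') \<in> H" if "h \<in> H" for h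
    proof -
      have "g \<circ> (g' \<circ> h \<circ> iv g') \<circ> iv g \<in> H" "iv g' \<circ> (iv g \<circ> h \<circ> g) \<circ> g' \<in> H" 
        using g g' that by auto
      then show ?thesis using g g' by (simp add: iv_comp comp_assoc)
    qed
    then show "g \<circ> g' \<in> ?N" using g g' by auto
  qed (use HD in auto)
  moreover have "{grig_a, grig_b, grig_c, grig_d} \<subseteq> ?N"
    using assms(2) by (auto simp: iv_gens)
  ultimately have "GG \<subseteq> ?N" by (rule Grig_gens_subset_subgroup)
  then show ?thesis
    using H HD(1) by (auto simp: Grig.normal_inv_iff subset_iff)
qed

lemma Grig_normalI:
  assumes H: "subgroup H Grig" and "\<And>g h. g \<in> GG \<Longrightarrow> h \<in> H \<Longrightarrow> g \<circ> h \<circ> iv g \<in> H"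
  shows "H \<lhd> Grig"
  by (rule Grig_normalI_gens[OF H]) (metis assms(2) gens_Grig iv_gens insert_iff empty_iff)

lemma generate_conj_normal:
  assumes S: "S \<subseteq> GG" and c: "\<And>g s. g \<in> GG \<Longrightarrow> s \<in> S \<Longrightarrow> g \<circ> s \<circ> iv g \<in> S"
  shows "generate Grig S \<lhd> Grig"
proof (rule Grig_normalI)
  show sub: "subgroup (generate Grig S) Grig"
    using S by (rule Grig.generate_is_subgroup)
  note HD = Grig_subgroupD[OF sub]
  fix g h assume g: "g \<in> GG" and h: "h \<in> generate Grig S"
  from h show "g \<circ> h \<circ> iv g \<in> generate Grig S"
  proof (induction h rule: generate.induct)
    case one
    then show ?case using g HD(2) by (metis comp_id iv_right one_Grig)
  next
    case (incl h)
    then show ?case by (intro generate.incl c g)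
  next
    case (inv h)
    have "iv (g \<circ> h \<circ> iv g) \<in> generate Grig S"
      using c[OF g] inv by (intro HD(4) generate.incl)
    moreover have "h \<in> GG" using inv S by auto
    moreover from this have "iv (g \<circ> h \<circ> iv g) = g \<circ> iv h \<circ> iv g"
      using g by (simp add: iv_comp comp_assoc)
    ultimately show ?case by (metis inv_Grig)
  next
    case (eng h1 h2)
    have "h1 \<in> GG" "h2 \<in> GG" using eng HD(1) by auto
    moreover have "(g \<circ> h1 \<circ> iv g) \<circ> (g \<circ> h2 \<circ> iv g) \<in> generate Grig S"
      using eng HD(3) by blast
    moreover have "(g \<circ> h1 \<circ> iv g) \<circ> (g \<circ> h2 \<circ> iv g) = g \<circ> (h1 \<circ> h2) \<circ> iv g"
      using g by (simp add: comp_assoc)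
    ultimately show ?case by (metis mult_Grig)
  qed
qed

lemma normal_closure_eq:
  assumes "S \<subseteq> GG"
  shows "normal_closure Grig S = generate Grig {g \<circ> s \<circ> iv g | g s. g \<in> GG \<and> s \<in> S}"
proof -
  have "{g \<otimes>\<^bsub>Grig\<^esub> s \<otimes>\<^bsub>Grig\<^esub> inv\<^bsub>Grig\<^esub> g | g s. g \<in> GG \<and> s \<in> S} = 
      {g \<circ> s \<circ> iv g | g s. g \<in> GG \<and> s \<in> S}"
    using assms by (intro Collect_cong ex_cong1) (auto simp: subset_iff)
  then show ?thesis by (simp add: normal_closure_def)
qed

lemma normal_closure_normal:
  assumes "S \<subseteq> GG" shows "normal_closure Grig S \<lhd> Grig"
  unfolding normal_closure_eq[OF assms]
proof (rule generate_conj_normal)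
  show "{g \<circ> s \<circ> iv g | g s. g \<in> GG \<and> s \<in> S} \<subseteq> GG" using assms by auto
  fix g s assume g: "g \<in> GG" and "s \<in> {g \<circ> s \<circ> iv g | g s. g \<in> GG \<and> s \<in> S}"
  then obtain h t where h: "h \<in> GG" "t \<in> S" "s = h \<circ> t \<circ> iv h" by auto
  then show "g \<circ> s \<circ> iv g \<in> {g \<circ> s \<circ> iv g | g s. g \<in> GG \<and> s \<in> S}"
    using g conj_comp[of g h t] by (intro CollectI exI[of _ "g \<circ> h"] exI[of _ t]) simp
qed

lemma normal_closure_incl:
  assumes "S \<subseteq> GG" "s \<in> S" shows "s \<in> normal_closure Grig S"
  unfolding normal_closure_eq[OF assms(1)]
  by (rule generate.incl, rule CollectI, rule exI[of _ id], rule exI[of _ s]) (use assms in \<open>auto simp: iv_eqI\<close>)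

lemma normal_closure_least:
  assumes "H \<lhd> Grig" "S \<subseteq> H" shows "normal_closure Grig S \<subseteq> H"
proof -
  note HD = Grig_normalD[OF assms(1)]
  have "S \<subseteq> GG" using HD assms by auto
  then show ?thesis
    unfolding normal_closure_eq[OF \<open>S \<subseteq> GG\<close>]
    by (intro Grig.generate_subgroup_incl HD(1)) (use assms HD in auto)
qed

lemma commutator_subgroup_eq:
  assumes "H \<subseteq> GG"
  shows "commutator_subgroup Grig H GG = generate Grig {comm h g | h g. h \<in> H \<and> g \<in> GG}"
proof -
  have "{commutator Grig h g | h g. h \<in> H \<and> g \<in> GG} = {comm h g | h g. h \<in> H \<and> g \<in> GG}"
    using assms by (intro Collect_cong ex_cong1) (auto simp: subset_iff commutator_Grig)
  then show ?thesis by (simp add: commutator_subgroup_def)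
qed

lemma commutator_subgroup_normal:
  assumes "H \<lhd> Grig" shows "commutator_subgroup Grig H GG \<lhd> Grig"
proof -
  note HD = Grig_normalD[OF assms]
  show ?thesis
    unfolding commutator_subgroup_eq[OF HD(2)]
  proof (rule generate_conj_normal)
    let ?S = "{comm h g |h g. h \<in> H \<and> g \<in> GG}"
    show "?S \<subseteq> GG" using HD(2) by (auto simp: subset_iff)
    fix k s assume k: "k \<in> GG" and "s \<in> ?S"
    then obtain h g where h: "h \<in> H" "g \<in> GG" "s = comm h g" by auto
    then have hg: "h \<in> GG" using HD(2) by auto
    have "k \<circ> s \<circ> iv k = comm (k \<circ> h \<circ> iv k) (k \<circ> g \<circ> iv k)"
      using h k hg by (simp add: iv_comp comp_assoc)
    moreover have "k \<circ> h \<circ> iv k \<in> H" "k \<circ> g \<circ> iv k \<in> GG" using HD(6) h k by auto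
    ultimately show "k \<circ> s \<circ> iv k \<in> ?S" by blast
  qed
qed

lemma commutator_subgroup_incl:
  assumes "H \<subseteq> GG" "h \<in> H" "g \<in> GG" 
  shows "comm h g \<in> commutator_subgroup Grig H GG"
  unfolding commutator_subgroup_eq[OF assms(1)] using assms by (intro generate.incl) auto

lemma commutator_subgroup_least:
  assumes "subgroup M Grig" "H \<subseteq> GG" "\<And>h g. h \<in> H \<Longrightarrow> g \<in> GG \<Longrightarrow> comm h g \<in> M"
  shows "commutator_subgroup Grig H GG \<subseteq> M"
  unfolding commutator_subgroup_eq[OF assms(2)]
  by (intro Grig.generate_subgroup_incl assms(1)) (use assms(3) in auto)

text \<open>The full preimage of the centre of the quotient by a normal subgroup \<open>M\<close>.\<close>

definition central_mod :: "(word \<Rightarrow> word) set \<Rightarrow> (word \<Rightarrow> word) set" where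
  "central_mod M = {h \<in> GG. \<forall>g\<in>GG. comm h g \<in> M}"

text \<open>By \<open>[u, gh] = [u, g] \<cdot> g[u, h]g\<^sup>-\<^sup>1\<close>, commuting with \<open>u\<close> modulo \<open>M\<close> is inherited by products; this
  reduces centrality to the generators.\<close>

lemma commuting_mod_subgroup:
  assumes M: "M \<lhd> Grig" and u: "u \<in> GG"
  shows "subgroup {g \<in> GG. comm u g \<in> M} Grig"
proof -
  note MD = Grig_normalD[OF M]
  show ?thesis
  proof (rule Grig_subgroupI)
    fix g h assume g: "g \<in> {g \<in> GG. comm u g \<in> M}" and h: "h \<in> {g \<in> GG. comm u g \<in> M}"
    have "(comm u g) \<circ> (g \<circ> (comm u h) \<circ> iv g) \<in> M" 
      by (rule MD(4), use g in simp, rule MD(6)) (use g h in auto)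
    then show "g \<circ> h \<in> {g \<in> GG. comm u g \<in> M}"
      using g h u by (simp add: iv_comp comp_assoc)
  next
    fix g assume g: "g \<in> {g \<in> GG. comm u g \<in> M}"
    then have "iv g \<circ> iv (comm u g) \<circ> iv (iv g) \<in> M"
      by (intro MD(6) MD(5)) auto
    then show "iv g \<in> {g \<in> GG. comm u g \<in> M}"
      using g u by (simp add: iv_comp comp_assoc)
  qed (use MD u in auto)
qed

lemma central_modI:
  assumes M: "M \<lhd> Grig" and u: "u \<in> GG"
    and c: "\<And>s. s \<in> {grig_a, grig_b, grig_d} \<Longrightarrow> u \<circ> s \<circ> iv u \<circ> s \<in> M"
  shows "u \<in> central_mod M"
proof -
  have sg: "subgroup {g \<in> GG. comm u g \<in> M} Grig" (is "subgroup ?C Grig")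
    by (rule commuting_mod_subgroup[OF M u])
  have abd: "grig_a \<in> ?C" "grig_b \<in> ?C" "grig_d \<in> ?C" using c by (auto simp: iv_gens)
  moreover have "grig_b \<circ> grig_d \<in> ?C" by (rule Grig_subgroupD(3)[OF sg abd(2,3)])
  ultimately have "grig_c \<in> ?C" by (simp only: klein_relations)
  then have "GG \<subseteq> ?C" using abd by (intro Grig_gens_subset_subgroup[OF sg]) auto
  then show ?thesis using u by (auto simp: central_mod_def)
qed

lemma central_mod_normal:
  assumes M: "M \<lhd> Grig"
  shows "central_mod M \<lhd> Grig" "M \<subseteq> central_mod M"
proof -
  note MD = Grig_normalD[OF M]
  have eq: "h \<in> central_mod M \<longleftrightarrow> h \<in> GG \<and> (\<forall>g\<in>GG. comm g h \<in> M)" for h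
  proof -
    have "iv (comm h g) = comm g h" 
      "iv (comm g h) = comm h g" if "h \<in> GG" "g \<in> GG" for g
      using that by (simp_all add: iv_comp comp_assoc)
    then have "comm h g \<in> M \<longleftrightarrow> comm g h \<in> M" if "h \<in> GG" "g \<in> GG" for g
      using MD(5) that by metis
    then show ?thesis
      unfolding central_mod_def by auto
  qed
  have eq2: "central_mod M = GG \<inter> (\<Inter>g\<in>GG. {h \<in> GG. comm g h \<in> M})"
    using eq by blast
  have cs: "subgroup {h \<in> GG. comm g h \<in> M} Grig" if "g \<in> GG" for g
    using commuting_mod_subgroup[OF M that] .
  have sub: "subgroup (central_mod M) Grig"
    unfolding eq2
  proof (rule Grig_subgroupI)
    show "g \<circ> h \<in> GG \<inter> (\<Inter>g\<in>GG. {h \<in> GG. comm g h \<in> M})"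
      if "g \<in> GG \<inter> (\<Inter>g\<in>GG. {h \<in> GG. comm g h \<in> M})" 
         "h \<in> GG \<inter> (\<Inter>g\<in>GG. {h \<in> GG. comm g h \<in> M})" for g h
      using that by (intro IntI INT_I Grig_subgroupD(3)[OF cs] comp_Grig) auto
    show "iv g \<in> GG \<inter> (\<Inter>g\<in>GG. {h \<in> GG. comm g h \<in> M})"
      if "g \<in> GG \<inter> (\<Inter>g\<in>GG. {h \<in> GG. comm g h \<in> M})" for g
      using that by (intro IntI INT_I Grig_subgroupD(4)[OF cs] iv_Grig) auto
  qed (use Grig_subgroupD(2)[OF cs] in auto)
  show MZ: "M \<subseteq> central_mod M"
  proof
    fix h assume h: "h \<in> M"
    then have hG: "h \<in> GG" using MD by auto
    have "h \<circ> (g \<circ> iv h \<circ> iv g) \<in> M" if "g \<in> GG" for g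
      by (intro MD(4) h MD(6) MD(5) that)
    then show "h \<in> central_mod M" using hG by (auto simp: central_mod_def comp_assoc)
  qed
  show "central_mod M \<lhd> Grig"
  proof (rule Grig_normalI[OF sub])
    fix g h assume g: "g \<in> GG" and h: "h \<in> central_mod M"
    then have hG: "h \<in> GG" and "comm g h \<in> M" by (auto simp: eq)
    then have "comm g h \<in> central_mod M" using MZ by auto
    then have "(comm g h) \<circ> h \<in> central_mod M" using Grig_subgroupD(3)[OF sub] h by blast
    then show "g \<circ> h \<circ> iv g \<in> central_mod M" using hG by (simp add: comp_assoc)
  qed
qed

text \<open>If \<open>u\<close> is central of order at most two modulo \<open>M\<close>, then \<open>M \<union> uM\<close> is a normal subgroup. This bounds a
  normal closure from above: the indices of \<open>N\<^sub>1\<close> in \<open>K\<close>, of \<open>N\<^sub>2\<close> in \<open>T N\<^sub>2\<close>, of \<open>K\<close> in \<open>\<gamma>\<^sub>2\<close> and of \<open>\<gamma>\<^sub>2\<close> in the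
  whole group are all bounded by adjoining such elements.\<close>

lemma adjoin_normal:
  assumes M: "M \<lhd> Grig" and u: "u \<in> central_mod M" "u \<circ> u \<in> M"
  shows "{g \<in> GG. g \<in> M \<or> u \<circ> g \<in> M} \<lhd> Grig" (is "?A \<lhd> Grig")
proof -
  note MD = Grig_normalD[OF M]
  have uG: "u \<in> GG" and uc: "\<And>g. g \<in> GG \<Longrightarrow> comm u g \<in> M"
    using u by (auto simp: central_mod_def)
  have conjG: "u \<circ> (g \<circ> h \<circ> iv g) \<in> M" if "g \<in> GG" "h \<in> GG" "u \<circ> h \<in> M" for g h
  proof -
    have "(comm u g) \<circ> (g \<circ> (u \<circ> h) \<circ> iv g) \<in> M"
      by (rule MD(4)[OF uc MD(6)]) (use that in auto)
    then show ?thesis using that uG by (simp add: comp_assoc)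
  qed
  \<comment> \<open>\<open>gh = u\<^sup>-\<^sup>2 \<cdot> u(ug)u\<^sup>-\<^sup>1 \<cdot> uh\<close>\<close>
  have prod: "g \<circ> h \<in> M" if "g \<in> GG" "h \<in> GG" "u \<circ> g \<in> M" "u \<circ> h \<in> M" for g h
  proof -
    have "iv (u \<circ> u) \<circ> (u \<circ> ((u \<circ> g)) \<circ> iv u) \<circ> (u \<circ> h) \<in> M"
      by (rule MD(4)[OF MD(4)[OF MD(5) MD(6)]]) (use u that uG in auto)
    then show ?thesis using that uG by (simp add: comp_assoc iv_comp)
  qed
  have sub: "subgroup ?A Grig"
  proof (rule Grig_subgroupI)
    show "?A \<subseteq> GG" by auto
    show "id \<in> ?A" using MD by auto
    fix g assume g: "g \<in> ?A"
    show "iv g \<in> ?A"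
    proof (cases "g \<in> M")
      case True
      then show ?thesis using MD(2,5) by auto
    next
      case False
      then have ug: "u \<circ> g \<in> M" "g \<in> GG" using g by auto
      then have "iv (u \<circ> g) \<circ> (u \<circ> u) \<in> M" using MD(4)[OF MD(5) u(2)] by blast
      then have "iv g \<circ> u \<in> M" using ug uG by (simp add: comp_assoc iv_comp)
      then have "u \<circ> (iv g \<circ> u) \<circ> iv u \<in> M" by (intro MD(6) uG)
      then have "u \<circ> iv g \<in> M" using ug uG by (simp add: comp_assoc)
      then show ?thesis using ug by auto
    qed
  next
    fix g h assume "g \<in> ?A" "h \<in> ?A"
    moreover have "u \<circ> (g \<circ> h) \<in> M" if "u \<circ> g \<in> M" "h \<in> M" 
      using MD(4)[OF that] by (simp add: comp_assoc)
    moreover have "u \<circ> (g \<circ> h) \<in> M" if "g \<in> M" "u \<circ> h \<in> M" "g \<in> GG" "h \<in> GG"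
    proof -
      have "(u \<circ> g \<circ> iv u) \<circ> (u \<circ> h) \<in> M" by (intro MD(4)[OF MD(6)] that uG)
      then show ?thesis using that uG by (simp add: comp_assoc)
    qed
    moreover have "g \<circ> h \<in> M" if "g \<in> M" "h \<in> M" by (intro MD(4) that)
    moreover have "g \<circ> h \<in> M" if "u \<circ> g \<in> M" "u \<circ> h \<in> M" "g \<in> GG" "h \<in> GG"
      by (rule prod) (use that in auto)
    moreover have "g \<circ> h \<in> GG" if "g \<in> GG" "h \<in> GG" using that by simp
    ultimately show "g \<circ> h \<in> ?A" by (elim CollectE conjE disjE) (simp_all del: o_apply)
  qed
  show ?thesis
    by (rule Grig_normalI[OF sub]) (use MD(6) conjG in \<open>auto intro: comp_Grig\<close>)
qed

section \<open>Pairs, sections and parities\<close>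

text \<open>Bits are treated as elements of a field of characteristic two; the default rewriting of sums into
  exclusive disjunctions would hide the additive structure.\<close>

declare add_bit_eq_xor [simp del] mult_bit_eq_and [simp del]

lemma bit_add_self [simp]: "x + x = (0 :: bit)" "x + (x + y) = (y :: bit)"
  by (cases x; simp)+

lemma comp_absorb: "p \<circ> q = r \<Longrightarrow> p \<circ> (q \<circ> f) = r \<circ> f"
  by (simp add: comp_assoc[symmetric])

text \<open>Rewriting with these rules brings right-associated words in \<open>a, b, c, d\<close> into the normal form of the free
  product of the group of order two generated by \<open>a\<close> and the Klein four-group \<open>{1, b, c, d}\<close>.\<close>

lemmas word_simps = comp_assoc gens_square klein_relations id_comp comp_id
  gens_square[THEN comp_absorb] klein_relations[THEN comp_absorb]

fun pair :: "(word \<Rightarrow> word) \<Rightarrow> (word \<Rightarrow> word) \<Rightarrow> word \<Rightarrow> word" where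
  "pair g h [] = []"
| "pair g h (False # w) = False # g w"
| "pair g h (True # w) = True # h w"

lemma pair_Cons: "pair g h (x # w) = x # (if x then h w else g w)"
  by (cases x) auto

lemma word_ext: "f [] = g [] \<Longrightarrow> (\<And>x w. f (x # w) = g (x # w)) \<Longrightarrow> f = g"
  by (metis ext neq_Nil_conv)

lemma pair_comp: "pair g h \<circ> pair g' h' = pair (g \<circ> g') (h \<circ> h')"
  by (rule word_ext) (auto simp: pair_Cons)

lemma pair_id: "pair id id = id"
  by (rule word_ext) (auto simp: pair_Cons)

lemma a_pair: "grig_a \<circ> pair g h = pair h g \<circ> grig_a"
  by (rule word_ext) (auto simp: pair_Cons)

lemma a_pair_a: "grig_a \<circ> pair g h \<circ> grig_a = pair h g"
  by (simp add: a_pair word_simps)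

lemma pair_inject [simp]: "pair g h = pair g' h' \<longleftrightarrow> g = g' \<and> h = h'"
proof
  assume eq: "pair g h = pair g' h'"
  have "False # g w = False # g' w" "True # h w = True # h' w" for w
    by (metis eq pair.simps(2)) (metis eq pair.simps(3))
  then show "g = g' \<and> h = h'" by auto
qed auto

lemma iv_pair: "g \<in> GG \<Longrightarrow> h \<in> GG \<Longrightarrow> iv (pair g h) = pair (iv g) (iv h)"
  by (rule iv_eqI) (simp_all add: pair_comp pair_id)

lemma gens_pair:
  "grig_b = pair grig_a grig_c" "grig_c = pair grig_a grig_d" "grig_d = pair id grig_b"
proof -
  have "grig_b (x # w) = pair grig_a grig_c (x # w)" "grig_c (x # w) = pair grig_a grig_d (x # w)"
    "grig_d (x # w) = pair id grig_b (x # w)" for x w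
    by (cases x; cases w; simp)+
  then show "grig_b = pair grig_a grig_c" "grig_c = pair grig_a grig_d" "grig_d = pair id grig_b"
    by (auto intro: word_ext)
qed

text \<open>The wreath recursion: the group embeds into the wreath product of two copies of itself with the swap \<open>a\<close>.\<close>

lemma Grig_decomp:
  assumes "g \<in> GG"
  obtains g0 g1 where "g0 \<in> GG" "g1 \<in> GG" "g = pair g0 g1 \<or> g = pair g0 g1 \<circ> grig_a"
proof -
  let ?D = "{g \<in> GG. \<exists>g0\<in>GG. \<exists>g1\<in>GG. g = pair g0 g1 \<or> g = pair g0 g1 \<circ> grig_a}"
  have "subgroup ?D Grig"
  proof (rule Grig_subgroupI)
    show "id \<in> ?D" using pair_id by (auto intro!: bexI[of _ id])
    fix g h assume "g \<in> ?D" "h \<in> ?D"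
    then obtain g0 g1 h0 h1 where
      gh: "g0 \<in> GG" "g1 \<in> GG" "h0 \<in> GG" "h1 \<in> GG" "g \<in> GG" "h \<in> GG"
      "g = pair g0 g1 \<or> g = pair g0 g1 \<circ> grig_a" "h = pair h0 h1 \<or> h = pair h0 h1 \<circ> grig_a"
      by blast
    have "pair g0 g1 \<circ> grig_a \<circ> pair h0 h1 = pair (g0 \<circ> h1) (g1 \<circ> h0) \<circ> grig_a"
      by (simp add: comp_assoc a_pair) (simp add: pair_comp flip: comp_assoc)
    then have "g \<circ> h = pair (g0 \<circ> h0) (g1 \<circ> h1) \<or> g \<circ> h = pair (g0 \<circ> h0) (g1 \<circ> h1) \<circ> grig_a
       \<or> g \<circ> h = pair (g0 \<circ> h1) (g1 \<circ> h0) \<circ> grig_a \<or> g \<circ> h = pair (g0 \<circ> h1) (g1 \<circ> h0)"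
      using gh(7,8) by (metis comp_assoc comp_id gens_square(1) pair_comp)
    then show "g \<circ> h \<in> ?D" using gh by blast
  next
    fix g assume "g \<in> ?D"
    then obtain g0 g1 where
      gh: "g0 \<in> GG" "g1 \<in> GG" "g \<in> GG" "g = pair g0 g1 \<or> g = pair g0 g1 \<circ> grig_a"
      by blast
    have "iv g = pair (iv g0) (iv g1)" if "g = pair g0 g1"
      using gh that by (simp add: iv_pair)
    moreover have "iv g = pair (iv g1) (iv g0) \<circ> grig_a" if "g = pair g0 g1 \<circ> grig_a"
    proof (rule iv_eqI)
      show "g \<circ> (pair (iv g1) (iv g0) \<circ> grig_a) = id"
      proof -
        have "g \<circ> (pair (iv g1) (iv g0) \<circ> grig_a) = pair g0 g1 \<circ> (grig_a \<circ> pair (iv g1) (iv g0) \<circ> grig_a)"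
          using that by (simp only: comp_assoc)
        then show ?thesis using gh by (simp add: a_pair_a pair_comp pair_id)
      qed
      have "pair (iv g1) (iv g0) \<circ> grig_a \<circ> g = pair (iv g1) (iv g0) \<circ> (grig_a \<circ> pair g0 g1 \<circ> grig_a)"
        using that by (simp only: comp_assoc)
      then show "pair (iv g1) (iv g0) \<circ> grig_a \<circ> g = id" 
        using gh by (simp add: a_pair_a pair_comp pair_id)
    qed
    ultimately show "iv g \<in> ?D" using gh by blast
  qed auto
  moreover have "grig_a \<in> ?D" using pair_id by (metis (mono_tags, lifting) CollectI gens_Grig(1) id_Grig id_comp)
  moreover have "grig_b \<in> ?D" "grig_c \<in> ?D" "grig_d \<in> ?D"
    using gens_pair by blast+
  ultimately have "GG \<subseteq> ?D" by (intro Grig_gens_subset_subgroup) auto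
  then show ?thesis using assms that by blast
qed

text \<open>The section \<open>g\<^sub>\<sigma>\<close>: the action of \<open>g\<close> on the subtree below \<open>\<sigma>\<close>, with the subtree below \<open>g \<sigma>\<close> as target.\<close>

definition sec :: "(word \<Rightarrow> word) \<Rightarrow> word \<Rightarrow> word \<Rightarrow> word" where
  "sec g \<sigma> w = drop (length \<sigma>) (g (\<sigma> @ w))"

lemma sec_Nil [simp]: "sec g [] = g"
  by (simp add: sec_def fun_eq_iff)

lemma sec_pair_Cons: "sec (pair g h) (x # \<sigma>) = sec (if x then h else g) \<sigma>"
  by (auto simp: sec_def fun_eq_iff pair_Cons)

lemma sec_pair [simp]: "sec (pair g h) (False # \<sigma>) = sec g \<sigma>" "sec (pair g h) (True # \<sigma>) = sec h \<sigma>"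
  by (simp_all add: sec_pair_Cons)

lemma sec_id [simp]: "sec id \<sigma> = id"
  by (simp add: sec_def fun_eq_iff)

lemma sec_a_Cons [simp]: "sec grig_a (x # \<sigma>) = id"
  by (simp add: sec_def fun_eq_iff)

lemma act_first:
  assumes "g \<in> GG"
  shows "g [] = []" "g (x # w) = hd (g [x]) # sec g [x] w" "sec g [x] \<in> GG"
    "hd (g [False]) = (\<not> hd (g [True]))" "length (g [x]) = 1"
proof -
  obtain g0 g1 where g: "g0 \<in> GG" "g1 \<in> GG" "g = pair g0 g1 \<or> g = pair g0 g1 \<circ> grig_a"
    using Grig_decomp[OF assms] .
  have nil: "h [] = []" if hG: "h \<in> GG" for h
    using Grig_decomp[OF hG] by (metis comp_apply grig_a.simps(2) pair.simps(1))
  then show "g [] = []" using assms by simp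
  show "g (x # w) = hd (g [x]) # sec g [x] w"
    using g(3) by (auto simp: sec_def pair_Cons)
  have "sec (pair g0 g1 \<circ> grig_a) [x] = (if x then g0 else g1)"
    by (auto simp: sec_def pair_Cons)
  then show "sec g [x] \<in> GG"
    using g by (auto simp: sec_pair_Cons)
  show "hd (g [False]) = (\<not> hd (g [True]))" "length (g [x]) = 1"
    using g nil by (auto simp: pair_Cons)
qed

lemma sec_Cons: "g \<in> GG \<Longrightarrow> sec g (x # \<sigma>) = sec (sec g [x]) \<sigma>"
proof
  fix w
  show "sec g (x # \<sigma>) w = sec (sec g [x]) \<sigma> w" if "g \<in> GG"
    unfolding sec_def[of _ "x # \<sigma>"] sec_def[of _ \<sigma>]
    using act_first(2)[OF that, of x "\<sigma> @ w"] by simp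
qed

lemma sec_Grig [simp]: "g \<in> GG \<Longrightarrow> sec g \<sigma> \<in> GG"
proof (induction \<sigma> arbitrary: g)
  case (Cons x \<sigma>)
  then show ?case using sec_Cons[of g x \<sigma>] act_first(3)[of g x] by simp
qed simp

lemma length_act [simp]: "g \<in> GG \<Longrightarrow> length (g w) = length w"
proof (induction w arbitrary: g)
  case (Cons x w)
  then show ?case using act_first(2)[of g x w] act_first(3)[of g x] by simp
qed (simp add: act_first)

lemma act_append: "g \<in> GG \<Longrightarrow> g (\<sigma> @ w) = g \<sigma> @ sec g \<sigma> w"
proof (induction \<sigma> arbitrary: g)
  case (Cons x \<sigma>)
  then show ?case
    using act_first(2)[of g x "\<sigma> @ w"] act_first(2)[of g x \<sigma>] act_first(3)[of g x]
      sec_Cons[of g x \<sigma>] by simp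
qed (simp add: act_first)

lemma sec_comp:
  assumes "g \<in> GG" "h \<in> GG"
  shows "sec (g \<circ> h) \<sigma> = sec g (h \<sigma>) \<circ> sec h \<sigma>"
  using assms by (auto simp: sec_def[of "g \<circ> h"] fun_eq_iff act_append)

lemma sec_iv:
  assumes "g \<in> GG"
  shows "sec (iv g) \<sigma> = iv (sec g (iv g \<sigma>))"
proof -
  have "sec (g \<circ> iv g) \<sigma> = sec g (iv g \<sigma>) \<circ> sec (iv g) \<sigma>"
    using assms by (intro sec_comp) auto
  then have "iv (sec g (iv g \<sigma>)) \<circ> (sec g (iv g \<sigma>) \<circ> sec (iv g) \<sigma>) = iv (sec g (iv g \<sigma>))"
    using assms by simp
  then show ?thesis using assms by simp
qed

lemma iv_act: "g \<in> GG \<Longrightarrow> iv g (g w) = w" "g \<in> GG \<Longrightarrow> g (iv g w) = w"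
  by (metis comp_apply iv_left id_apply) (metis comp_apply iv_right id_apply)

lemma pair_swap: "pair g h \<in> GG \<Longrightarrow> pair h g \<in> GG"
  by (metis a_pair_a comp_Grig gens_Grig(1))

text \<open>The second components of the generators \<open>aba, b, c, d\<close> are \<open>a, c, d, b\<close>, so every element of the group
  occurs as a second component.\<close>

lemma fractal:
  assumes "g \<in> GG" obtains h where "h \<in> GG" "pair h g \<in> GG"
proof -
  let ?D = "{g \<in> GG. \<exists>h\<in>GG. pair h g \<in> GG}"
  have "subgroup ?D Grig"
  proof (rule Grig_subgroupI)
    show "id \<in> ?D" using pair_id by (auto intro!: bexI[of _ id])
    show "g \<circ> h \<in> ?D" if "g \<in> ?D" "h \<in> ?D" for g h
      using that by (auto simp: pair_comp[symmetric] intro: comp_Grig) (metis comp_Grig pair_comp)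
    show "iv g \<in> ?D" if "g \<in> ?D" for g
      using that by (auto simp: iv_pair[symmetric]) (metis iv_Grig iv_pair)
  qed auto
  moreover have "grig_a \<in> ?D" using gens_pair gens_Grig pair_swap by (metis (mono_tags, lifting) CollectI)
  moreover have "grig_b \<in> ?D" "grig_c \<in> ?D" "grig_d \<in> ?D"
    using gens_pair gens_Grig id_Grig by (metis (mono_tags, lifting) CollectI)+
  ultimately have "GG \<subseteq> ?D" by (intro Grig_gens_subset_subgroup) auto
  then show ?thesis using assms that by blast
qed

text \<open>By self-similarity a vertex can be moved to any other vertex of its level with an arbitrary section there.
  Hence the conjugates of an element supported below a single vertex exhaust those supported below any
  other vertex of the same level.\<close>

lemma level_transitive:
  assumes "length \<sigma> = length \<tau>" "k \<in> GG"
  shows "\<exists>g\<in>GG. g \<sigma> = \<tau> \<and> sec g \<sigma> = k"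
  using assms
proof (induction \<sigma> \<tau> rule: list_induct2)
  case Nil
  then show ?case using act_first(1) by auto
next
  case (Cons x \<sigma> y \<tau>)
  then obtain g where g: "g \<in> GG" "g \<sigma> = \<tau>" "sec g \<sigma> = k" by auto
  obtain h where h: "h \<in> GG" "pair h g \<in> GG" using fractal g by auto
  define q where "q = (if x then pair h g else pair g h)"
  have q: "q \<in> GG" "q (x # \<sigma>) = x # \<tau>" "sec q (x # \<sigma>) = k"
    using h g pair_swap by (auto simp: q_def)
  show ?case
  proof (cases "x = y")
    case False
    have "sec (grig_a \<circ> q) (x # \<sigma>) = k" using q by (simp add: sec_comp)
    moreover have "(grig_a \<circ> q) (x # \<sigma>) = y # \<tau>" using q False by auto
    ultimately show ?thesis using q by blast
  qed (use q in auto)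
qed

lemma at_vertex_Nil [simp]: "at_vertex [] g = g"
  by (simp add: at_vertex_def tuple_act_def fun_eq_iff)

lemma at_vertex_Cons:
  "at_vertex (x # \<sigma>) g = (if x then pair id (at_vertex \<sigma> g) else pair (at_vertex \<sigma> g) id)"
  by (rule word_ext) (auto simp: at_vertex_def tuple_act_def pair_Cons)

lemma at_vertex_append: "at_vertex (\<sigma> @ \<tau>) g = at_vertex \<sigma> (at_vertex \<tau> g)"
  by (induction \<sigma>) (simp_all add: at_vertex_Cons)

lemma at_vertex_comp: "at_vertex \<sigma> g \<circ> at_vertex \<sigma> h = at_vertex \<sigma> (g \<circ> h)"
  by (induction \<sigma>) (simp_all add: at_vertex_Cons pair_comp del: o_apply id_apply)

lemma at_vertex_apply:
  "at_vertex \<sigma> g w = (if take (length \<sigma>) w = \<sigma> then \<sigma> @ g (drop (length \<sigma>) w) else w)"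
proof -
  have "\<not> length w < length \<sigma>" if "take (length \<sigma>) w = \<sigma>"
    using arg_cong[OF that, of length] by simp
  then show ?thesis
    by (simp add: at_vertex_def tuple_act_def)
qed

lemma at_vertex_conj:
  assumes g: "g \<in> GG" and h: "h \<in> GG"
  shows "g \<circ> at_vertex \<sigma> h \<circ> iv g = at_vertex (g \<sigma>) (sec g \<sigma> \<circ> h \<circ> iv (sec g \<sigma>))"
proof -
  have "g (at_vertex \<sigma> h w) = at_vertex (g \<sigma>) (sec g \<sigma> \<circ> h \<circ> iv (sec g \<sigma>)) (g w)" for w
  proof (cases "take (length \<sigma>) w = \<sigma>")
    case True
    then obtain v where v: "w = \<sigma> @ v" by (metis append_take_drop_id)
    show ?thesis using g by (simp add: v at_vertex_apply act_append iv_act)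
  next
    case False
    have "take (length \<sigma>) (g w) \<noteq> g \<sigma>"
    proof
      assume eq: "take (length \<sigma>) (g w) = g \<sigma>"
      have "g w = g (take (length \<sigma>) w) @ sec g (take (length \<sigma>) w) (drop (length \<sigma>) w)"
        using act_append[OF g, of "take (length \<sigma>) w" "drop (length \<sigma>) w"] by simp
      moreover have "length w \<ge> length \<sigma>"
        using g arg_cong[OF eq, of length] by simp
      ultimately have "take (length \<sigma>) (g w) = g (take (length \<sigma>) w)"
        using g by simp
      then show False using eq False bij_Grig[OF g] by (metis bij_pointE)
    qed
    then show ?thesis using g False by (simp add: at_vertex_apply)
  qed
  then have "g \<circ> at_vertex \<sigma> h = at_vertex (g \<sigma>) (sec g \<sigma> \<circ> h \<circ> iv (sec g \<sigma>)) \<circ> g"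
    by (simp add: fun_eq_iff)
  then show ?thesis using g by (simp add: comp_assoc)
qed

lemma level_power_0 [simp]: "level_power Q 0 = Q"
proof -
  have "tuple_act 0 q = q []" for q by (simp add: tuple_act_def fun_eq_iff)
  then show ?thesis by (auto simp: level_power_def)
qed

text \<open>The subgroup \<open>Q \<times> Q\<close>. Iterating it gives all level powers, which replaces tuples indexed by
  words by an induction on the level.\<close>

definition pairs :: "(word \<Rightarrow> word) set \<Rightarrow> (word \<Rightarrow> word) set" where
  "pairs Q = {pair g h | g h. g \<in> Q \<and> h \<in> Q}"

lemma pairs_iff [simp]: "pair g h \<in> pairs Q \<longleftrightarrow> g \<in> Q \<and> h \<in> Q"
  by (auto simp: pairs_def)

lemma pairsE: "k \<in> pairs Q \<Longrightarrow> (\<And>g h. k = pair g h \<Longrightarrow> g \<in> Q \<Longrightarrow> h \<in> Q \<Longrightarrow> P) \<Longrightarrow> P"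
  by (auto simp: pairs_def)

lemma tuple_act_Suc:
  "tuple_act (Suc m) q = pair (tuple_act m (\<lambda>\<sigma>. q (False # \<sigma>))) (tuple_act m (\<lambda>\<sigma>. q (True # \<sigma>)))"
  by (rule word_ext) (auto simp: tuple_act_def pair_Cons)

lemma level_power_Suc [simp]: "level_power Q (Suc m) = pairs (level_power Q m)"
proof (intro equalityI subsetI)
  fix k assume "k \<in> level_power Q (Suc m)"
  then show "k \<in> pairs (level_power Q m)"
    by (fastforce simp: level_power_def tuple_act_Suc)
next
  fix k assume "k \<in> pairs (level_power Q m)"
  then obtain q q' where q: "\<And>\<sigma>. length \<sigma> = m \<Longrightarrow> q \<sigma> \<in> Q" "\<And>\<sigma>. length \<sigma> = m \<Longrightarrow> q' \<sigma> \<in> Q"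
    "k = pair (tuple_act m q) (tuple_act m q')"
    by (auto simp: level_power_def pairs_def)
  define r where "r = (\<lambda>\<sigma>. if hd \<sigma> then q' (tl \<sigma>) else q (tl \<sigma>))"
  have "k = tuple_act (Suc m) r" by (simp add: q(3) tuple_act_Suc r_def)
  moreover have "\<forall>\<sigma>. length \<sigma> = Suc m \<longrightarrow> r \<sigma> \<in> Q"
    using q by (auto simp: r_def)
  ultimately show "k \<in> level_power Q (Suc m)" by (auto simp: level_power_def)
qed

lemma pairs_normal:
  assumes "Q \<lhd> Grig" "pairs Q \<subseteq> GG"
  shows "pairs Q \<lhd> Grig"
proof -
  note QD = Grig_normalD[OF assms(1)]
  have "subgroup (pairs Q) Grig"
  proof (rule Grig_subgroupI)
    show "id \<in> pairs Q" using QD(3) by (metis pair_id pairs_iff)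
    show "g \<circ> h \<in> pairs Q" if "g \<in> pairs Q" "h \<in> pairs Q" for g h
      using that QD(4) by (auto simp: pair_comp elim!: pairsE)
    show "iv g \<in> pairs Q" if "g \<in> pairs Q" for g
      using that QD(5,2) by (auto simp: iv_pair subset_iff elim!: pairsE)
  qed fact
  then show ?thesis
  proof (rule Grig_normalI_gens)
    fix s k assume s: "s \<in> {grig_a, grig_b, grig_c, grig_d}" and "k \<in> pairs Q"
    then obtain g h where k: "k = pair g h" "g \<in> Q" "h \<in> Q" by (auto elim: pairsE)
    show "s \<circ> k \<circ> s \<in> pairs Q"
    proof (cases "s = grig_a")
      case True
      then show ?thesis using k by (simp add: a_pair_a)
    next
      case False
      then have "\<exists>p q. s = pair p q \<and> p \<in> {id, grig_a} \<and> q \<in> {grig_b, grig_c, grig_d}"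
        using s gens_pair by blast
      then obtain p q where pq: "s = pair p q" "p \<in> {id, grig_a}" "q \<in> {grig_b, grig_c, grig_d}"
        by blast
      have "p \<circ> g \<circ> iv p \<in> Q" "q \<circ> h \<circ> iv q \<in> Q"
        using k pq QD(6) gens_Grig id_Grig by blast+
      then have "p \<circ> g \<circ> p \<in> Q" "q \<circ> h \<circ> q \<in> Q"
        using pq by (auto simp: iv_gens)
      then show ?thesis using pq k by (simp add: pair_comp)
    qed
  qed
qed

text \<open>The parity of the number of vertices of level \<open>n\<close> at which \<open>g\<close> permutes the two subtrees.\<close>

fun parity :: "nat \<Rightarrow> (word \<Rightarrow> word) \<Rightarrow> bit" where
  "parity 0 g = of_bool (hd (g [False]))"
| "parity (Suc n) g = parity n (sec g [False]) + parity n (sec g [True])"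

text \<open>The sections of a product are products of sections, and \<open>h\<close> only permutes the vertices at which the sections
  of \<open>g\<close> are taken.\<close>

lemma parity_comp:
  assumes "g \<in> GG" "h \<in> GG"
  shows "parity n (g \<circ> h) = parity n g + parity n h"
  using assms
proof (induction n arbitrary: g h)
  case 0
  have "g (h [False]) = g [hd (h [False])]" using 0 act_first(5)[of h False] 
    by (cases "h [False]") auto
  then show ?case using 0 act_first(4)[of g] by (cases "hd (h [False])") auto
next
  case (Suc n)
  have h: "h [x] = [hd (h [x])]" for x
    using Suc act_first(5)[of h x] by (cases "h [x]") auto
  have "sec (g \<circ> h) [x] = sec g [hd (h [x])] \<circ> sec h [x]" for x
    using sec_comp[of g h "[x]"] h[of x] Suc by simp
  then have "parity (Suc n) (g \<circ> h) = parity n (sec g [False]) + parity n (sec h [False]) +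
      (parity n (sec g [True]) + parity n (sec h [True]))"
    using Suc.prems Suc.IH act_first(3)[OF Suc.prems(1)] act_first(3)[OF Suc.prems(2)]
      act_first(4)[of h] by (cases "hd (h [True])") (simp_all del: o_apply)
  also have "\<dots> = parity (Suc n) g + parity (Suc n) h" by (simp add: algebra_simps)
  finally show ?case .
qed

lemma parity_id [simp]: "parity n id = 0"
  by (induction n) (simp, simp del: id_apply)

lemma parity_iv: "g \<in> GG \<Longrightarrow> parity n (iv g) = parity n g"
  using parity_comp[of g "iv g" n] by (auto simp: add_eq_0_iff)

lemma parity_pair [simp]: "parity 0 (pair g h) = 0" "parity (Suc n) (pair g h) = parity n g + parity n h"
  by simp_all

declare parity.simps(2) [simp del]

lemma parity_gens [simp]:
  "parity 0 grig_a = 1" "parity (Suc n) grig_a = 0"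
  "parity 0 grig_b = 0" "parity (Suc n) grig_b = parity n grig_a + parity n grig_c"
  "parity 0 grig_c = 0" "parity (Suc n) grig_c = parity n grig_a + parity n grig_d"
  "parity 0 grig_d = 0" "parity (Suc n) grig_d = parity n grig_b"
proof -
  show "parity 0 grig_a = 1" "parity (Suc n) grig_a = 0" by (simp_all add: parity.simps)
  have "parity m grig_b = parity m (pair grig_a grig_c)" "parity m grig_c = parity m (pair grig_a grig_d)" 
    "parity m grig_d = parity m (pair id grig_b)" for m
    by (simp_all only: gens_pair[symmetric])
  then show "parity 0 grig_b = 0" "parity (Suc n) grig_b = parity n grig_a + parity n grig_c"
    "parity 0 grig_c = 0" "parity (Suc n) grig_c = parity n grig_a + parity n grig_d"
    "parity 0 grig_d = 0" "parity (Suc n) grig_d = parity n grig_b"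
    by (simp_all only: parity_pair parity_id add_0)
qed

lemma parity_commutator: "g \<in> GG \<Longrightarrow> h \<in> GG \<Longrightarrow> parity n (comm g h) = 0"
  by (simp add: parity_comp parity_iv algebra_simps)

section \<open>The subgroups K, T and N\<close>

lemma x_eq: "x_elt = grig_a \<circ> grig_b \<circ> grig_a \<circ> grig_b"
  by (simp add: x_elt_def commutator_Grig iv_gens)

lemma x_pair: "x_elt = pair (grig_c \<circ> grig_a) (grig_a \<circ> grig_c)"
proof -
  have "x_elt = (grig_a \<circ> pair grig_a grig_c \<circ> grig_a) \<circ> pair grig_a grig_c"
    by (simp add: x_eq comp_assoc gens_pair(1)[symmetric])
  then show ?thesis by (simp only: a_pair_a pair_comp)
qed

lemma x_Grig [simp]: "x_elt \<in> GG"
  by (simp add: x_eq)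

lemma iv_x: "iv x_elt = grig_b \<circ> grig_a \<circ> grig_b \<circ> grig_a"
  by (rule iv_eqI) (simp_all add: x_eq word_simps)

lemma iv_x_pair: "iv x_elt = pair (grig_a \<circ> grig_c) (grig_c \<circ> grig_a)"
  by (rule iv_eqI) (simp_all add: x_pair pair_comp word_simps pair_id)

lemma x2_eq: "x2_elt = x_elt \<circ> x_elt"
  by (simp add: x2_elt_def)

lemma x2_Grig [simp]: "x2_elt \<in> GG"
  by (simp add: x2_eq)

lemma x2_pair: "x2_elt = pair (pair (grig_a \<circ> grig_d) (grig_d \<circ> grig_a)) (pair (grig_d \<circ> grig_a) (grig_a \<circ> grig_d))"
proof -
  have "x2_elt = pair (grig_c \<circ> grig_a \<circ> (grig_c \<circ> grig_a)) (grig_a \<circ> grig_c \<circ> (grig_a \<circ> grig_c))"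
    by (simp add: x2_eq x_pair pair_comp)
  also have "\<dots> = pair (pair grig_a grig_d \<circ> (grig_a \<circ> pair grig_a grig_d \<circ> grig_a)) ((grig_a \<circ> pair grig_a grig_d \<circ> grig_a) \<circ> pair grig_a grig_d)"
    by (simp only: comp_assoc gens_pair(2)[symmetric])
  also have "\<dots> = pair (pair (grig_a \<circ> grig_d) (grig_d \<circ> grig_a)) (pair (grig_d \<circ> grig_a) (grig_a \<circ> grig_d))"
    by (simp only: a_pair_a pair_comp)
  finally show ?thesis .
qed

text \<open>The commutators of \<open>x\<close> with a generating set. The third one is what makes the group a branch group: by
  \<open>x = (ca, ac)\<close> and \<open>d = (1, b)\<close>, its second component is \<open>acbcab = abab\<close>, as \<open>cbc = b\<close>.\<close>

lemma x_comm_gens: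
  "x_elt \<circ> grig_a \<circ> iv x_elt \<circ> grig_a = x2_elt"
  "x_elt \<circ> grig_b \<circ> iv x_elt \<circ> grig_b = x2_elt"
  "x_elt \<circ> grig_d \<circ> iv x_elt \<circ> grig_d = pair id x_elt"
proof -
  show "x_elt \<circ> grig_a \<circ> iv x_elt \<circ> grig_a = x2_elt" "x_elt \<circ> grig_b \<circ> iv x_elt \<circ> grig_b = x2_elt"
    by (simp_all add: iv_x x2_eq) (simp_all add: x_eq word_simps)
  have "x_elt \<circ> pair id grig_b \<circ> iv x_elt \<circ> pair id grig_b = pair id x_elt"
    by (simp add: x_pair iv_x_pair[unfolded x_pair] pair_comp) (simp add: x_eq[unfolded x_pair] word_simps)
  then show "x_elt \<circ> grig_d \<circ> iv x_elt \<circ> grig_d = pair id x_elt"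
    by (simp only: gens_pair[symmetric])
qed

lemma K_normal: "K_grp \<lhd> Grig" and T_normal: "T_grp \<lhd> Grig"
  by (simp_all add: K_grp_def T_grp_def normal_closure_normal)

lemmas KD = Grig_normalD[OF K_normal] and TD = Grig_normalD[OF T_normal]

lemma x_in_K: "x_elt \<in> K_grp" and x2_in_T: "x2_elt \<in> T_grp"
  by (simp_all add: K_grp_def T_grp_def normal_closure_incl)

lemma x2_in_K: "x2_elt \<in> K_grp"
  unfolding x2_eq by (intro KD(4) x_in_K)

lemma K_least: "H \<lhd> Grig \<Longrightarrow> x_elt \<in> H \<Longrightarrow> K_grp \<subseteq> H"
  by (simp add: K_grp_def normal_closure_least)

lemma T_least: "H \<lhd> Grig \<Longrightarrow> x2_elt \<in> H \<Longrightarrow> T_grp \<subseteq> H"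
  by (simp add: T_grp_def normal_closure_least)

lemma T_subset_K: "T_grp \<subseteq> K_grp"
  by (rule T_least[OF K_normal x2_in_K])

lemma commutator_in_normal:
  assumes "H \<lhd> Grig" "h \<in> H" "g \<in> GG"
  shows "comm h g \<in> H"
proof -
  note HD = Grig_normalD[OF assms(1)]
  have "h \<circ> (g \<circ> iv h \<circ> iv g) \<in> H"
    by (intro HD(4) HD(6) HD(5) assms)
  then show ?thesis by (simp add: comp_assoc)
qed

lemma pair_id_x_in_K: "pair id x_elt \<in> K_grp"
  using commutator_in_normal[OF K_normal x_in_K gens_Grig(4)] by (simp add: iv_gens x_comm_gens)

text \<open>The elements \<open>k\<close> with \<open>(1, k) \<in> K\<close> form a normal subgroup, because every group element is the second
  component of one in the group; and \<open>x\<close> is among them as \<open>(1, x) = [x, d]\<close>.\<close>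

lemma pairs_K_subset: "pairs K_grp \<subseteq> K_grp"
proof -
  let ?H = "{k \<in> GG. pair id k \<in> K_grp}"
  have sub: "subgroup ?H Grig"
  proof (rule Grig_subgroupI)
    show "id \<in> ?H" using KD(3) by (simp add: pair_id)
    show "g \<circ> h \<in> ?H" if "g \<in> ?H" "h \<in> ?H" for g h
    proof -
      have "pair id g \<circ> pair id h \<in> K_grp" using that by (intro KD(4)) auto
      then show ?thesis using that by (simp add: pair_comp)
    qed
    show "iv g \<in> ?H" if "g \<in> ?H" for g
    proof -
      have "iv (pair id g) \<in> K_grp" using that by (intro KD(5)) auto
      then show ?thesis using that by (simp add: iv_pair)
    qed
  qed auto
  have "?H \<lhd> Grig"
  proof (rule Grig_normalI[OF sub])
    fix g k assume g: "g \<in> GG" and k: "k \<in> ?H"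
    obtain h where h: "h \<in> GG" "pair h g \<in> GG" using fractal[OF g] .
    have "pair h g \<circ> pair id k \<circ> iv (pair h g) \<in> K_grp" using h k by (intro KD(6)) auto
    then show "g \<circ> k \<circ> iv g \<in> ?H" using g h k by (simp add: iv_pair pair_comp)
  qed
  then have K: "K_grp \<subseteq> ?H" by (rule K_least) (simp add: pair_id_x_in_K)
  have "pair g h \<in> K_grp" if "g \<in> K_grp" "h \<in> K_grp" for g h
  proof -
    have "grig_a \<circ> pair id g \<circ> iv grig_a \<in> K_grp" using K that by (intro KD(6)) auto
    then have "pair g id \<circ> pair id h \<in> K_grp" using K that
      by (intro KD(4)) (auto simp: iv_gens a_pair_a)
    then show ?thesis by (simp add: pair_comp)
  qed
  then show ?thesis by (auto elim: pairsE)
qed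

lemma pairs_K_normal: "pairs K_grp \<lhd> Grig"
  using pairs_K_subset KD(2) by (intro pairs_normal K_normal) auto

lemma level_power_K_subset: "level_power K_grp m \<subseteq> K_grp"
proof (induction m)
  case (Suc m)
  then show ?case using pairs_K_subset by (fastforce elim!: pairsE)
qed simp

lemma level_power_mono: "Q \<subseteq> R \<Longrightarrow> level_power Q m \<subseteq> level_power R m"
  by (induction m) (auto elim!: pairsE)

lemma level_power_T_subset: "level_power T_grp m \<subseteq> K_grp"
  using level_power_mono[OF T_subset_K] level_power_K_subset by blast

lemma set_mult_eq: 
  assumes "A \<subseteq> GG" "B \<subseteq> GG"
  shows "A <#>\<^bsub>Grig\<^esub> B = {g \<circ> h | g h. g \<in> A \<and> h \<in> B}"
  using assms by (force simp: set_mult_def subset_iff)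

lemma N_grp_1: "N_grp (Suc 0) = {k \<circ> t | k t. k \<in> pairs K_grp \<and> t \<in> T_grp}"
  unfolding N_grp_def using pairs_K_subset KD(2) TD(2) by (subst set_mult_eq) auto

lemma N_grp_Suc: "N_grp (Suc (Suc m)) = pairs (N_grp (Suc m))"
proof -
  have K: "level_power K_grp n \<subseteq> GG" and T: "level_power T_grp n \<subseteq> GG" for n
    using level_power_K_subset level_power_T_subset KD(2) by blast+
  have "N_grp (Suc n) = {k \<circ> t | k t. k \<in> level_power K_grp (Suc n) \<and> t \<in> level_power T_grp n}" for n
    unfolding N_grp_def by (subst set_mult_eq) (use K T in \<open>auto simp del: level_power_Suc\<close>)
  note eq = this
  show ?thesis
  proof (intro equalityI subsetI)
    fix g assume "g \<in> N_grp (Suc (Suc m))"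
    then obtain k0 k1 t0 t1 where "g = pair k0 k1 \<circ> pair t0 t1"
      "k0 \<in> level_power K_grp (Suc m)" "k1 \<in> level_power K_grp (Suc m)"
      "t0 \<in> level_power T_grp m" "t1 \<in> level_power T_grp m"
      unfolding eq level_power_Suc[of K_grp "Suc m"] level_power_Suc[of T_grp m] pairs_def by blast
    then show "g \<in> pairs (N_grp (Suc m))" unfolding eq by (simp only: pair_comp pairs_iff) blast
  next
    fix g assume "g \<in> pairs (N_grp (Suc m))"
    then obtain k0 k1 t0 t1 where "g = pair (k0 \<circ> t0) (k1 \<circ> t1)"
      "k0 \<in> level_power K_grp (Suc m)" "k1 \<in> level_power K_grp (Suc m)"
      "t0 \<in> level_power T_grp m" "t1 \<in> level_power T_grp m"
      unfolding eq pairs_def by blast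
    moreover from this have "g = pair k0 k1 \<circ> pair t0 t1" by (simp add: pair_comp)
    ultimately show "g \<in> N_grp (Suc (Suc m))"
      unfolding eq level_power_Suc[of K_grp "Suc m"] level_power_Suc[of T_grp m] pairs_def by blast
  qed
qed

lemma N1_normal: "N_grp (Suc 0) \<lhd> Grig"
proof -
  note PD = Grig_normalD[OF pairs_K_normal]
  have sub: "N_grp (Suc 0) \<subseteq> GG" unfolding N_grp_1 using PD(2) TD(2) by auto
  have "subgroup (N_grp (Suc 0)) Grig"
  proof (rule Grig_subgroupI[OF sub])
    have "id \<circ> id \<in> N_grp (Suc 0)" unfolding N_grp_1 using PD(3) TD(3) by blast
    then show "id \<in> N_grp (Suc 0)" by simp
    fix g assume "g \<in> N_grp (Suc 0)"
    then obtain k t where g: "g = k \<circ> t" "k \<in> pairs K_grp" "t \<in> T_grp" by (auto simp: N_grp_1)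
    then have kt: "k \<in> GG" "t \<in> GG" using PD TD by auto
    have "iv t \<circ> iv k \<circ> iv (iv t) \<in> pairs K_grp" by (intro PD(5,6) iv_Grig g kt)
    moreover have "iv g = (iv t \<circ> iv k \<circ> iv (iv t)) \<circ> iv t" using g kt by (simp add: iv_comp comp_assoc)
    ultimately show "iv g \<in> N_grp (Suc 0)" unfolding N_grp_1 using TD(5) g by blast
    fix h assume "h \<in> N_grp (Suc 0)"
    then obtain k' t' where h: "h = k' \<circ> t'" "k' \<in> pairs K_grp" "t' \<in> T_grp" by (auto simp: N_grp_1)
    have "k \<circ> (t \<circ> k' \<circ> iv t) \<in> pairs K_grp" by (intro PD(4) PD(6) g h kt)
    moreover have "t \<circ> t' \<in> T_grp" by (intro TD(4) g h)
    moreover have "g \<circ> h = (k \<circ> (t \<circ> k' \<circ> iv t)) \<circ> (t \<circ> t')" using g h kt by (simp add: comp_assoc)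
    ultimately show "g \<circ> h \<in> N_grp (Suc 0)" unfolding N_grp_1 by blast
  qed
  then show ?thesis
  proof (rule Grig_normalI)
    fix g h assume g: "g \<in> GG" and "h \<in> N_grp (Suc 0)"
    then obtain k t where kt: "h = k \<circ> t" "k \<in> pairs K_grp" "t \<in> T_grp" by (auto simp: N_grp_1)
    have "g \<circ> h \<circ> iv g = (g \<circ> k \<circ> iv g) \<circ> (g \<circ> t \<circ> iv g)"
      using kt g by (simp add: comp_assoc)
    then show "g \<circ> h \<circ> iv g \<in> N_grp (Suc 0)"
      using kt g Grig_normalD(6)[OF pairs_K_normal] TD(6) unfolding N_grp_1 by blast
  qed
qed

lemma N1_incl: "pairs K_grp \<subseteq> N_grp (Suc 0)" "T_grp \<subseteq> N_grp (Suc 0)" "N_grp (Suc 0) \<subseteq> K_grp"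
proof -
  show "pairs K_grp \<subseteq> N_grp (Suc 0)"
  proof
    fix k assume "k \<in> pairs K_grp"
    then have "k \<circ> id \<in> N_grp (Suc 0)" unfolding N_grp_1 using TD(3) by blast
    then show "k \<in> N_grp (Suc 0)" by simp
  qed
  have "id \<in> pairs K_grp" using KD(3) pairs_iff[of id id] by (simp add: pair_id)
  show "T_grp \<subseteq> N_grp (Suc 0)"
  proof
    fix t assume "t \<in> T_grp"
    then have "id \<circ> t \<in> N_grp (Suc 0)" unfolding N_grp_1 using \<open>id \<in> pairs K_grp\<close> by blast
    then show "t \<in> N_grp (Suc 0)" by simp
  qed
  show "N_grp (Suc 0) \<subseteq> K_grp"
    using pairs_K_subset T_subset_K KD(4) by (auto simp: N_grp_1)
qed

lemma N_normal_antimono: "N_grp (Suc m) \<lhd> Grig \<and> N_grp (Suc (Suc m)) \<subseteq> N_grp (Suc m)"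
proof (induction m)
  case 0
  then show ?case using N1_normal N1_incl by (fastforce simp: N_grp_Suc elim!: pairsE)
next
  case (Suc m)
  then have "pairs (N_grp (Suc m)) \<subseteq> GG" using Grig_normalD(2) by (fastforce simp: N_grp_Suc)
  then have "N_grp (Suc (Suc m)) \<lhd> Grig"
    using Suc by (simp add: N_grp_Suc pairs_normal)
  then show ?case using Suc by (fastforce simp: N_grp_Suc elim!: pairsE)
qed

lemma N_normal: "m \<ge> 1 \<Longrightarrow> N_grp m \<lhd> Grig"
  using N_normal_antimono[of "m - 1"] by simp

lemma N_Suc_subset: "m \<ge> 1 \<Longrightarrow> N_grp (Suc m) \<subseteq> N_grp m"
  using N_normal_antimono[of "m - 1"] by simp

text \<open>If a normal subgroup contains \<open>u\<close> at one vertex, then it contains every conjugate of \<open>u\<close> at every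
  vertex of that level, by transitivity with prescribed sections.\<close>

lemma level_power_subset_normal:
  assumes C: "C \<lhd> Grig" and u: "u \<in> GG" and C0: "at_vertex \<sigma> u \<in> C"
  shows "level_power (normal_closure Grig {u}) (length \<sigma>) \<subseteq> C"
proof -
  note CD = Grig_normalD[OF C]
  have conj: "at_vertex \<tau> (k \<circ> v \<circ> iv k) \<in> C" if v: "v \<in> GG" "at_vertex \<rho> v \<in> C" and k: "k \<in> GG" 
    and len: "length \<rho> = length \<tau>" for k v \<tau> \<rho>
  proof -
    obtain g where g: "g \<in> GG" "g \<rho> = \<tau>" "sec g \<rho> = k"
      using level_transitive[OF len k] by blast
    have "g \<circ> at_vertex \<rho> v \<circ> iv g \<in> C" using CD(6) g v by blast
    then show ?thesis using g v by (simp add: at_vertex_conj)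
  qed
  have at_iv: "at_vertex \<tau> (iv k) = iv (at_vertex \<tau> k)" if "k \<in> GG" for \<tau> k
  proof (rule iv_eqI[symmetric])
    have "at_vertex \<tau> id = id" by (induction \<tau>) (simp_all add: at_vertex_Cons pair_id del: id_apply)
    then show "at_vertex \<tau> k \<circ> at_vertex \<tau> (iv k) = id" "at_vertex \<tau> (iv k) \<circ> at_vertex \<tau> k = id"
      using that by (simp_all add: at_vertex_comp)
  qed
  have at_id: "at_vertex \<tau> id = id" for \<tau> 
    by (induction \<tau>) (simp_all add: at_vertex_Cons pair_id del: id_apply)
  let ?H = "{k \<in> GG. \<forall>\<tau>. length \<tau> = length \<sigma> \<longrightarrow> at_vertex \<tau> k \<in> C}"
  have sub: "subgroup ?H Grig"
  proof (rule Grig_subgroupI)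
    show "id \<in> ?H" using CD(3) by (simp add: at_id)
    show "g \<circ> h \<in> ?H" if "g \<in> ?H" "h \<in> ?H" for g h
      using that CD(4) by (simp add: at_vertex_comp[symmetric])
    show "iv g \<in> ?H" if "g \<in> ?H" for g
      using that CD(5) by (simp add: at_iv)
  qed auto
  have "?H \<lhd> Grig"
    by (rule Grig_normalI[OF sub]) (use conj in auto)
  moreover have "u \<in> ?H"
    using conj[OF u C0 id_Grig] u by (simp add: iv_eqI)
  ultimately have H: "normal_closure Grig {u} \<subseteq> ?H" by (intro normal_closure_least) auto
  have prod: "level_power Q m \<subseteq> D" 
    if "\<And>\<tau> k. length \<tau> = m \<Longrightarrow> k \<in> Q \<Longrightarrow> at_vertex \<tau> k \<in> D" 
       "\<And>g h. g \<in> D \<Longrightarrow> h \<in> D \<Longrightarrow> g \<circ> h \<in> D" for Q D m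
    using that
  proof (induction m arbitrary: D)
    case 0
    then show ?case by (auto dest: 0(1)[of "[]"])
  next
    case (Suc m)
    have "level_power Q m \<subseteq> {g. pair g id \<in> D}"
    proof (rule Suc.IH)
      show "at_vertex \<tau> k \<in> {g. pair g id \<in> D}" if "length \<tau> = m" "k \<in> Q" for \<tau> k
        using Suc.prems(1)[of "False # \<tau>" k] that by (simp add: at_vertex_Cons)
      show "g \<circ> h \<in> {g. pair g id \<in> D}" if "g \<in> {g. pair g id \<in> D}" "h \<in> {g. pair g id \<in> D}" for g h
        using Suc.prems(2)[of "pair g id" "pair h id"] that by (simp add: pair_comp)
    qed
    moreover have "level_power Q m \<subseteq> {g. pair id g \<in> D}"
    proof (rule Suc.IH)
      show "at_vertex \<tau> k \<in> {g. pair id g \<in> D}" if "length \<tau> = m" "k \<in> Q" for \<tau> k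
        using Suc.prems(1)[of "True # \<tau>" k] that by (simp add: at_vertex_Cons)
      show "g \<circ> h \<in> {g. pair id g \<in> D}" if "g \<in> {g. pair id g \<in> D}" "h \<in> {g. pair id g \<in> D}" for g h
        using Suc.prems(2)[of "pair id g" "pair id h"] that by (simp add: pair_comp)
    qed
    ultimately have "pair g id \<circ> pair id h \<in> D" if "g \<in> level_power Q m" "h \<in> level_power Q m" for g h
      using that Suc.prems(2) by blast
    then show ?case by (auto simp: pair_comp elim!: pairsE)
  qed
  show ?thesis by (rule prod) (use H CD in auto)
qed

text \<open>Two elements normally generate \<open>N\<^sub>m\<close>. This turns the lower bounds on commutator subgroups into finite
  computations, without passing to the limit along a descending chain.\<close>

lemma N_subset_normal:
  assumes C: "C \<lhd> Grig" and "at_vertex \<sigma> x_elt \<in> C" "at_vertex \<tau> x2_elt \<in> C"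
    and "length \<sigma> = m" "length \<tau> = m - 1"
  shows "N_grp m \<subseteq> C"
proof -
  have K: "level_power K_grp m \<subseteq> C" 
    using level_power_subset_normal[OF C x_Grig assms(2)] assms(4) by (simp add: K_grp_def)
  have T: "level_power T_grp (m - 1) \<subseteq> C"
    using level_power_subset_normal[OF C x2_Grig assms(3)] assms(5) by (simp add: T_grp_def)
  have "level_power K_grp m \<subseteq> GG" "level_power T_grp (m - 1) \<subseteq> GG"
    using level_power_K_subset level_power_T_subset KD(2) by blast+
  then show ?thesis unfolding N_grp_def
    using K T Grig_normalD(4)[OF C] by (subst set_mult_eq) (assumption, assumption, blast)
qed

lemma N1_subset_normal:
  assumes "C \<lhd> Grig" "pair id x_elt \<in> C" "x2_elt \<in> C"
  shows "N_grp (Suc 0) \<subseteq> C"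
  by (rule N_subset_normal[OF assms(1), of "[True]" "[]"]) (use assms in \<open>auto simp: at_vertex_Cons\<close>)

lemma pair_id_x_N1: "pair id x_elt \<in> N_grp (Suc 0)"
  using N1_incl(1) x_in_K KD(3) by (auto simp: subset_iff)

lemma x2_N1: "x2_elt \<in> N_grp (Suc 0)"
  using N1_incl(2) x2_in_T by auto

lemma x_central: "x_elt \<in> central_mod (N_grp (Suc 0))"
proof (rule central_modI[OF N1_normal x_Grig])
  fix s assume "s \<in> {grig_a, grig_b, grig_d}"
  then show "x_elt \<circ> s \<circ> iv x_elt \<circ> s \<in> N_grp (Suc 0)"
    using x_comm_gens pair_id_x_N1 x2_N1 by auto
qed

text \<open>Since \<open>x\<close> is central of order at most two modulo \<open>N\<^sub>1\<close>, the set \<open>N\<^sub>1 \<union> xN\<^sub>1\<close> is a normal subgroup containing \<open>x\<close>.\<close>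

lemma K_cases:
  assumes "k \<in> K_grp" shows "k \<in> N_grp (Suc 0) \<or> x_elt \<circ> k \<in> N_grp (Suc 0)"
proof -
  have "K_grp \<subseteq> {g \<in> GG. g \<in> N_grp (Suc 0) \<or> x_elt \<circ> g \<in> N_grp (Suc 0)}"
    by (rule K_least[OF adjoin_normal[OF N1_normal x_central]])
       (use x2_N1 in \<open>simp_all add: x2_eq\<close>)
  then show ?thesis using assms by blast
qed

lemma conj_x_x: "g \<in> GG \<Longrightarrow> g \<circ> x_elt \<circ> iv g \<circ> x_elt \<in> N_grp (Suc 0)"
proof -
  note ND = Grig_normalD[OF N1_normal]
  assume g: "g \<in> GG"
  then have "comm x_elt g \<in> N_grp (Suc 0)"
    using x_central by (simp add: central_mod_def)
  then have "iv (comm x_elt g) \<circ> x2_elt \<in> N_grp (Suc 0)"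
    using ND(4)[OF ND(5) x2_N1] by blast
  then show ?thesis using g by (simp add: iv_comp comp_assoc x2_eq)
qed

text \<open>Since \<open>(ac)\<^sup>2 = (da, ad)\<close>, the word \<open>(ac)\<^sup>4\<close> equals \<open>x\<^sup>2\<close> times the pair of the conjugates
  of \<open>x\<close> by \<open>ac\<close> and by \<open>c\<close>.\<close>

lemma ac4_in_N1: "grig_a \<circ> grig_c \<circ> grig_a \<circ> grig_c \<circ> grig_a \<circ> grig_c \<circ> grig_a \<circ> grig_c \<in> N_grp (Suc 0)"
proof -
  let ?k = "pair (grig_a \<circ> grig_c \<circ> x_elt \<circ> grig_c \<circ> grig_a) (grig_c \<circ> x_elt \<circ> grig_c)"
  have "grig_a \<circ> grig_c \<circ> grig_a \<circ> grig_c = grig_a \<circ> pair grig_a grig_d \<circ> grig_a \<circ> pair grig_a grig_d"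
    by (simp only: gens_pair(2)[symmetric])
  also have "\<dots> = pair (grig_d \<circ> grig_a) (grig_a \<circ> grig_d)"
    by (simp only: a_pair_a pair_comp)
  finally have ac2: "grig_a \<circ> grig_c \<circ> grig_a \<circ> grig_c = pair (grig_d \<circ> grig_a) (grig_a \<circ> grig_d)" .
  have "grig_a \<circ> grig_c \<circ> grig_a \<circ> grig_c \<circ> grig_a \<circ> grig_c \<circ> grig_a \<circ> grig_c
     = (grig_a \<circ> grig_c \<circ> grig_a \<circ> grig_c) \<circ> (grig_a \<circ> grig_c \<circ> grig_a \<circ> grig_c)"
    by (simp only: comp_assoc)
  also have "\<dots> = pair (grig_d \<circ> grig_a \<circ> (grig_d \<circ> grig_a)) (grig_a \<circ> grig_d \<circ> (grig_a \<circ> grig_d))"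
    by (simp only: ac2 pair_comp)
  also have "\<dots> = pair (grig_c \<circ> grig_a) (grig_a \<circ> grig_c) \<circ> pair (grig_c \<circ> grig_a) (grig_a \<circ> grig_c) \<circ> ?k"
    unfolding x_eq by (simp add: pair_comp word_simps)
  also have "\<dots> = x2_elt \<circ> ?k" by (simp only: x2_eq x_pair[symmetric])
  finally have eq: "grig_a \<circ> grig_c \<circ> grig_a \<circ> grig_c \<circ> grig_a \<circ> grig_c \<circ> grig_a \<circ> grig_c = x2_elt \<circ> ?k" .
  have cxc: "grig_c \<circ> x_elt \<circ> iv grig_c \<in> K_grp" by (intro KD(6) x_in_K) auto
  then have "grig_a \<circ> (grig_c \<circ> x_elt \<circ> iv grig_c) \<circ> iv grig_a \<in> K_grp" by (intro KD(6)[of grig_a]) auto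
  then have "?k \<in> pairs K_grp" using cxc by (simp add: iv_gens comp_assoc)
  then have "?k \<in> N_grp (Suc 0)" using N1_incl(1) by blast
  then show ?thesis unfolding eq by (intro Grig_normalD(4)[OF N1_normal] x2_N1)
qed

text \<open>The components of \<open>x\<^sup>4\<close> are \<open>(ca)\<^sup>4\<close> and \<open>(ac)\<^sup>4\<close>, which both lie in \<open>N\<^sub>1\<close>.\<close>

lemma x4_in_N2: "x2_elt \<circ> x2_elt \<in> N_grp (Suc (Suc 0))"
proof -
  let ?p = "grig_a \<circ> grig_c \<circ> grig_a \<circ> grig_c \<circ> grig_a \<circ> grig_c \<circ> grig_a \<circ> grig_c"
  have "x2_elt \<circ> x2_elt = pair (grig_a \<circ> ?p \<circ> grig_a) ?p"
    by (simp add: x2_eq x_pair pair_comp) (simp add: word_simps)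
  moreover have "grig_a \<circ> ?p \<circ> iv grig_a \<in> N_grp (Suc 0)"
    by (intro Grig_normalD(6)[OF N1_normal] ac4_in_N1) auto
  ultimately show ?thesis using ac4_in_N1 by (simp add: N_grp_Suc iv_gens)
qed

text \<open>From \<open>[x\<^sup>2, s] = x[x, s]x\<^sup>-\<^sup>1[x, s]\<close>: for \<open>s = a\<close> and \<open>s = b\<close> this is \<open>x\<^sup>4\<close>, and for \<open>s = d\<close> it is a pair
  whose second component is a product of two conjugates of \<open>x\<close>.\<close>

lemma x2_central: "x2_elt \<in> central_mod (N_grp (Suc (Suc 0)))"
proof (rule central_modI)
  fix s assume s: "s \<in> {grig_a, grig_b, grig_d}"
  have eq: "x2_elt \<circ> s \<circ> iv x2_elt \<circ> s = x_elt \<circ> (x_elt \<circ> s \<circ> iv x_elt \<circ> s) \<circ> iv x_elt \<circ> (x_elt \<circ> s \<circ> iv x_elt \<circ> s)"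
  proof -
    have "s \<in> GG" "s \<circ> (s \<circ> f) = f" for f :: "word \<Rightarrow> word" using s by (auto simp: word_simps)
    then show ?thesis by (simp add: x2_eq iv_comp comp_assoc)
  qed
  show "x2_elt \<circ> s \<circ> iv x2_elt \<circ> s \<in> N_grp (Suc (Suc 0))"
  proof (cases "s = grig_d")
    case False
    then have "x_elt \<circ> s \<circ> iv x_elt \<circ> s = x2_elt" using s x_comm_gens by auto
    moreover have "x_elt \<circ> x2_elt \<circ> iv x_elt = x2_elt" by (simp add: x2_eq comp_assoc)
    ultimately show ?thesis using x4_in_N2 eq by simp
  next
    case True
    then have "x2_elt \<circ> s \<circ> iv x2_elt \<circ> s = x_elt \<circ> pair id x_elt \<circ> iv x_elt \<circ> pair id x_elt"
      using eq x_comm_gens by simp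
    also have "\<dots> = pair id ((grig_a \<circ> grig_c) \<circ> x_elt \<circ> iv (grig_a \<circ> grig_c) \<circ> x_elt)"
    proof -
      have "x_elt \<circ> pair g h \<circ> iv x_elt = pair (grig_c \<circ> grig_a \<circ> g \<circ> (grig_a \<circ> grig_c)) (grig_a \<circ> grig_c \<circ> h \<circ> (grig_c \<circ> grig_a))" for g h
        by (simp add: iv_x_pair) (simp add: x_pair pair_comp)
      then show ?thesis by (simp add: pair_comp iv_comp iv_gens) (simp add: word_simps)
    qed
    also have "\<dots> \<in> N_grp (Suc (Suc 0))"
      using conj_x_x[of "grig_a \<circ> grig_c"] Grig_normalD(3)[OF N1_normal] by (simp add: N_grp_Suc)
    finally show ?thesis .
  qed
qed (use N_normal in simp_all)

text \<open>In the same way \<open>N\<^sub>2 \<union> x\<^sup>2N\<^sub>2\<close> is a normal subgroup containing \<open>x\<^sup>2\<close>.\<close>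

lemma T_cases:
  assumes "t \<in> T_grp" shows "t \<in> N_grp (Suc (Suc 0)) \<or> x2_elt \<circ> t \<in> N_grp (Suc (Suc 0))"
proof -
  have "T_grp \<subseteq> {g \<in> GG. g \<in> N_grp (Suc (Suc 0)) \<or> x2_elt \<circ> g \<in> N_grp (Suc (Suc 0))}"
    by (rule T_least[OF adjoin_normal[OF _ x2_central]])
       (use x4_in_N2 N_normal in simp_all)
  then show ?thesis using assms by blast
qed

section \<open>Coordinates on the quotients of the N\<close>

text \<open>The coordinates of an element of \<open>N\<^sub>m\<close> at a vertex \<open>\<sigma>\<close> of level \<open>m\<close> and a vertex \<open>\<tau>\<close> of level
  \<open>m - 1\<close>. The first components of \<open>x = (ca, ac)\<close> and \<open>x\<^sup>2 = ((ad, da), (da, ad))\<close>, one and two levels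
  down, are \<open>ca\<close> and \<open>ad\<close>. The parity on level 1 is 1 on \<open>ca\<close> and 0 on \<open>ad\<close>; on level 2 it is 0 on \<open>ca\<close> and 1 on \<open>ad\<close>.\<close>

definition alpha :: "(word \<Rightarrow> word) \<Rightarrow> word \<Rightarrow> bit" where
  "alpha g \<sigma> = parity 1 (sec g (\<sigma> @ [False]))"

definition beta :: "(word \<Rightarrow> word) \<Rightarrow> word \<Rightarrow> bit" where
  "beta g \<tau> = parity 2 (sec g (\<tau> @ [False, False]))"

lemma parity_sec_comp:
  assumes "g \<in> GG" "h \<in> GG" "h \<rho> = \<rho>"
  shows "parity n (sec (g \<circ> h) \<rho>) = parity n (sec g \<rho>) + parity n (sec h \<rho>)"
  using assms by (simp add: sec_comp parity_comp)

lemma parity_sec_iv: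
  assumes "g \<in> GG" "g \<rho> = \<rho>"
  shows "iv g \<rho> = \<rho>" "parity n (sec (iv g) \<rho>) = parity n (sec g \<rho>)"
proof -
  show "iv g \<rho> = \<rho>" using iv_act(1)[OF assms(1), of \<rho>] assms(2) by simp
  then show "parity n (sec (iv g) \<rho>) = parity n (sec g \<rho>)" using assms by (simp add: sec_iv parity_iv)
qed

lemma parity_sec_conj:
  assumes g: "g \<in> GG" and h: "h \<in> GG" and fx: "g (iv h \<rho>) = iv h \<rho>"
  shows "(h \<circ> g \<circ> iv h) \<rho> = \<rho>" "parity n (sec (h \<circ> g \<circ> iv h) \<rho>) = parity n (sec g (iv h \<rho>))"
proof -
  show "(h \<circ> g \<circ> iv h) \<rho> = \<rho>" using fx h by (simp add: iv_act)
  show "parity n (sec (h \<circ> g \<circ> iv h) \<rho>) = parity n (sec g (iv h \<rho>))"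
    using fx g h by (simp add: sec_comp parity_comp sec_iv parity_iv add.commute)
qed

lemma act_two:
  assumes "h \<in> GG"
  obtains u where "\<And>y. \<exists>v. h [x, y] = [u, v]"
proof (rule that)
  fix y
  have "length (sec h [x] [y]) = 1" using act_first(3)[OF assms, of x] by simp
  then obtain v where "sec h [x] [y] = [v]" by (metis One_nat_def length_0_conv length_Suc_conv)
  then show "\<exists>v. h [x, y] = [hd (h [x]), v]" using act_first(2)[OF assms, of x "[y]"] by simp
qed

text \<open>The choice of the letter 0 below \<open>\<sigma>\<close> and \<open>\<tau>\<close> in the coordinates does not matter on \<open>N\<^sub>1\<close>. These are
  the elements with this property; they form a normal subgroup.\<close>

definition level_two_symmetric :: "(word \<Rightarrow> word) set" where
  "level_two_symmetric = {g \<in> GG. (\<forall>x y. g [x, y] = [x, y]) \<and>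
     (\<forall>x y y'. parity 1 (sec g [x, y]) = parity 1 (sec g [x, y'])) \<and>
     (\<forall>x y x' y'. parity 2 (sec g [x, y]) = parity 2 (sec g [x', y']))}"

lemma N1_symmetric: "N_grp (Suc 0) \<subseteq> level_two_symmetric"
proof (rule N1_subset_normal)
  have sub: "subgroup level_two_symmetric Grig"
  proof (rule Grig_subgroupI)
    show "id \<in> level_two_symmetric" by (simp add: level_two_symmetric_def)
    show "g \<circ> h \<in> level_two_symmetric" if "g \<in> level_two_symmetric" "h \<in> level_two_symmetric" for g h
      using that unfolding level_two_symmetric_def
      by (simp add: parity_sec_comp) metis
    show "iv g \<in> level_two_symmetric" if "g \<in> level_two_symmetric" for g
      using that unfolding level_two_symmetric_def
      by (simp add: parity_sec_iv)
  qed (simp add: level_two_symmetric_def)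
  show "level_two_symmetric \<lhd> Grig"
  proof (rule Grig_normalI[OF sub])
    fix h g assume h: "h \<in> GG" and g: "g \<in> level_two_symmetric"
    have gG: "g \<in> GG" and fx: "\<And>x y. g [x, y] = [x, y]"
      and p1: "\<And>x y y'. parity 1 (sec g [x, y]) = parity 1 (sec g [x, y'])"
      and p2: "\<And>x y x' y'. parity 2 (sec g [x, y]) = parity 2 (sec g [x', y'])"
      using g unfolding level_two_symmetric_def by blast+
    have iv2: "\<exists>u v. iv h [x, y] = [u, v]" for x y using act_two[of "iv h" x] h by blast
    have f: "g (iv h [x, y]) = iv h [x, y]" for x y using iv2[of x y] fx by metis
    note c = parity_sec_conj[OF gG h f]
    have "parity 1 (sec g (iv h [x, y])) = parity 1 (sec g (iv h [x, y']))" for x y y'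
      using act_two[of "iv h" x] h p1 by (metis iv_Grig)
    moreover have "parity 2 (sec g (iv h [x, y])) = parity 2 (sec g (iv h [x', y']))" for x y x' y'
      using iv2 p2 by metis
    ultimately show "h \<circ> g \<circ> iv h \<in> level_two_symmetric"
      unfolding level_two_symmetric_def using c gG h by (simp del: o_apply)
  qed
  show "pair id x_elt \<in> level_two_symmetric"
  proof -
    have "pair id x_elt [x, y] = [x, y]" for x y
      by (cases x) (simp_all add: x_pair pair_Cons)
    moreover have "sec (pair id x_elt) [x, y] = (if x then if y then grig_a \<circ> grig_c else grig_c \<circ> grig_a else id)" for x y
      by (simp add: sec_pair_Cons x_pair)
    moreover have "pair id x_elt \<in> GG" using pair_id_x_in_K KD(2) by auto
    ultimately show ?thesis
      by (simp add: level_two_symmetric_def parity_comp numeral_2_eq_2)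
  qed
  show "x2_elt \<in> level_two_symmetric"
  proof -
    have "x2_elt [x, y] = [x, y]" for x y
      by (cases x; cases y) (simp_all add: x2_pair act_first)
    moreover have "sec x2_elt [x, y] = (if x = y then grig_a \<circ> grig_d else grig_d \<circ> grig_a)" for x y
      by (auto simp: sec_pair_Cons x2_pair)
    ultimately show ?thesis
      by (auto simp: level_two_symmetric_def parity_comp numeral_2_eq_2)
  qed
qed

text \<open>The elements fixing the first level both of whose components have all parities zero, such as pairs of
  commutators. They form a normal subgroup that contains \<open>N\<^sub>1\<close> but not \<open>x = (ca, ac)\<close>; this separates \<open>x\<close> from \<open>N\<^sub>1\<close>.\<close>

definition level_one_even :: "(word \<Rightarrow> word) set" where
  "level_one_even = {g \<in> GG. \<forall>y. g [y] = [y] \<and> (\<forall>n. parity n (sec g [y]) = 0)}"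

lemma N1_even: "N_grp (Suc 0) \<subseteq> level_one_even"
proof (rule N1_subset_normal)
  have sub: "subgroup level_one_even Grig"
  proof (rule Grig_subgroupI)
    show "id \<in> level_one_even" by (simp add: level_one_even_def)
    show "g \<circ> h \<in> level_one_even" if "g \<in> level_one_even" "h \<in> level_one_even" for g h
      using that unfolding level_one_even_def
      by (simp add: parity_sec_comp)
    show "iv g \<in> level_one_even" if "g \<in> level_one_even" for g
      using that unfolding level_one_even_def
      by (simp add: parity_sec_iv)
  qed (simp add: level_one_even_def)
  show "level_one_even \<lhd> Grig"
  proof (rule Grig_normalI[OF sub])
    fix h g assume h: "h \<in> GG" and g: "g \<in> level_one_even"
    have gG: "g \<in> GG" and fx: "\<And>y. g [y] = [y]" and p: "\<And>y n. parity n (sec g [y]) = 0"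
      using g unfolding level_one_even_def by blast+
    have iv1: "\<exists>v. iv h [y] = [v]" for y
      using act_first(5)[of "iv h" y] h by (metis One_nat_def iv_Grig length_0_conv length_Suc_conv)
    have f: "g (iv h [y]) = iv h [y]" for y using iv1[of y] fx by metis
    have "parity n (sec g (iv h [y])) = 0" for n y using iv1[of y] p by metis
    then show "h \<circ> g \<circ> iv h \<in> level_one_even"
      unfolding level_one_even_def using parity_sec_conj[OF gG h f] gG h by (simp del: o_apply)
  qed
  have px: "parity n x_elt = 0" for n by (simp add: x_eq parity_comp algebra_simps)
  have "pair id x_elt \<in> GG" using pair_id_x_in_K KD(2) by auto
  then show "pair id x_elt \<in> level_one_even"
    using act_first(1)[OF x_Grig] by (auto simp: level_one_even_def pair_Cons sec_pair_Cons px)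
  have "sec x2_elt [y] = (if y then grig_a \<circ> grig_c \<circ> (grig_a \<circ> grig_c) else grig_c \<circ> grig_a \<circ> (grig_c \<circ> grig_a))" for y
    by (simp add: x2_eq x_pair pair_comp sec_pair_Cons)
  then have "parity n (sec x2_elt [y]) = 0" for n y
    by (simp add: parity_comp)
  moreover have "x2_elt [y] = [y]" for y
    by (simp add: x2_pair pair_Cons act_first)
  ultimately show "x2_elt \<in> level_one_even"
    by (simp add: level_one_even_def)
qed

lemma alpha_pair [simp]: "alpha (pair g h) (x # \<sigma>) = alpha (if x then h else g) \<sigma>"
  by (simp add: alpha_def sec_pair_Cons)

lemma beta_pair [simp]: "beta (pair g h) (x # \<sigma>) = beta (if x then h else g) \<sigma>"
  by (simp add: beta_def sec_pair_Cons)

lemma N_fix_level: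
  assumes "g \<in> N_grp (Suc m)" "length \<rho> = Suc (Suc m)"
  shows "g \<rho> = \<rho>"
  using assms
proof (induction m arbitrary: g \<rho>)
  case 0
  then obtain x y where "\<rho> = [x, y]" by (auto simp: length_Suc_conv)
  then show ?case using 0 N1_symmetric by (auto simp: level_two_symmetric_def)
next
  case (Suc m)
  then obtain x \<rho>' where \<rho>: "\<rho> = x # \<rho>'" "length \<rho>' = Suc (Suc m)" by (auto simp: length_Suc_conv)
  from Suc.prems obtain g0 g1 where "g = pair g0 g1" "g0 \<in> N_grp (Suc m)" "g1 \<in> N_grp (Suc m)"
    by (auto simp: N_grp_Suc elim: pairsE)
  then show ?case using \<rho> Suc.IH by (simp add: pair_Cons)
qed

lemma N_alpha_beta_sym:
  assumes "g \<in> N_grp (Suc m)"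
  shows "length \<sigma> = Suc m \<Longrightarrow> parity 1 (sec g (\<sigma> @ [y])) = alpha g \<sigma>"
    and "length \<tau> = m \<Longrightarrow> parity 2 (sec g (\<tau> @ [y, y'])) = beta g \<tau>"
proof -
  have "(\<forall>\<sigma>. length \<sigma> = Suc m \<longrightarrow> parity 1 (sec g (\<sigma> @ [y])) = alpha g \<sigma>) \<and> 
      (\<forall>\<tau>. length \<tau> = m \<longrightarrow> parity 2 (sec g (\<tau> @ [y, y'])) = beta g \<tau>)"
    using assms
  proof (induction m arbitrary: g)
    case 0
    then have "g \<in> level_two_symmetric" using N1_symmetric by auto
    then show ?case unfolding alpha_def beta_def level_two_symmetric_def
      by (auto simp: length_Suc_conv)
  next
    case (Suc m)
    then obtain g0 g1 where g: "g = pair g0 g1" "g0 \<in> N_grp (Suc m)" "g1 \<in> N_grp (Suc m)"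
      by (auto simp: N_grp_Suc elim: pairsE)
    note IH = Suc.IH[OF g(2)] Suc.IH[OF g(3)]
    have "parity 1 (sec (pair g0 g1) (\<sigma> @ [y])) = alpha (pair g0 g1) \<sigma>" if "length \<sigma> = Suc (Suc m)" for \<sigma>
      using that IH by (cases \<sigma>) (simp_all add: sec_pair_Cons)
    moreover have "parity 2 (sec (pair g0 g1) (\<tau> @ [y, y'])) = beta (pair g0 g1) \<tau>" if "length \<tau> = Suc m" for \<tau>
      using that IH by (cases \<tau>) (simp_all add: sec_pair_Cons)
    ultimately show ?case unfolding g(1) by blast
  qed
  then show "length \<sigma> = Suc m \<Longrightarrow> parity 1 (sec g (\<sigma> @ [y])) = alpha g \<sigma>"
    and "length \<tau> = m \<Longrightarrow> parity 2 (sec g (\<tau> @ [y, y'])) = beta g \<tau>" by auto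
qed

lemma N_subset_Grig: "N_grp (Suc m) \<subseteq> GG"
  using N_normal Grig_normalD(2) by simp

lemma alpha_comp:
  assumes "g \<in> N_grp (Suc m)" "h \<in> N_grp (Suc m)"
  shows "length \<sigma> = Suc m \<Longrightarrow> alpha (g \<circ> h) \<sigma> = alpha g \<sigma> + alpha h \<sigma>"
    and "length \<tau> = m \<Longrightarrow> beta (g \<circ> h) \<tau> = beta g \<tau> + beta h \<tau>"
  using assms N_fix_level[OF assms(2)] N_subset_Grig[of m]
  by (auto simp: alpha_def beta_def parity_sec_comp subset_iff)

lemma alpha_iv:
  assumes "g \<in> N_grp (Suc m)"
  shows "length \<sigma> = Suc m \<Longrightarrow> alpha (iv g) \<sigma> = alpha g \<sigma>"
    and "length \<tau> = m \<Longrightarrow> beta (iv g) \<tau> = beta g \<tau>"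
  using assms N_fix_level[OF assms(1)] N_subset_Grig[of m]
  by (auto simp: alpha_def beta_def parity_sec_iv subset_iff)

text \<open>Conjugation permutes the coordinates: the parities of a section are invariant under conjugation of that
  section, and the last letters added to \<open>\<sigma>\<close> and \<open>\<tau>\<close> are irrelevant by symmetry.\<close>

lemma alpha_conj:
  assumes g: "g \<in> N_grp (Suc m)" and h: "h \<in> GG"
  shows "length \<sigma> = Suc m \<Longrightarrow> alpha (h \<circ> g \<circ> iv h) \<sigma> = alpha g (iv h \<sigma>)"
    and "length \<tau> = m \<Longrightarrow> beta (h \<circ> g \<circ> iv h) \<tau> = beta g (iv h \<tau>)"
proof -
  have gG: "g \<in> GG" using g N_subset_Grig by auto
  have tail: "\<exists>\<rho>'. iv h (\<sigma> @ \<rho>) = iv h \<sigma> @ \<rho>' \<and> length \<rho>' = length \<rho>" for \<sigma> \<rho>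
    using h act_append[of "iv h" \<sigma> \<rho>] by auto
  show "alpha (h \<circ> g \<circ> iv h) \<sigma> = alpha g (iv h \<sigma>)" if "length \<sigma> = Suc m"
  proof -
    obtain y where y: "iv h (\<sigma> @ [False]) = iv h \<sigma> @ [y]"
      using tail[of \<sigma> "[False]"] by (auto simp: length_Suc_conv)
    have "g (iv h (\<sigma> @ [False])) = iv h (\<sigma> @ [False])"
      using N_fix_level[OF g] that h by simp
    then show ?thesis
      using parity_sec_conj(2)[OF gG h, of "\<sigma> @ [False]" 1] N_alpha_beta_sym(1)[OF g, of "iv h \<sigma>" y] that h y
      by (simp add: alpha_def del: o_apply)
  qed
  show "beta (h \<circ> g \<circ> iv h) \<tau> = beta g (iv h \<tau>)" if "length \<tau> = m"
  proof -
    obtain y y' where y: "iv h (\<tau> @ [False, False]) = iv h \<tau> @ [y, y']"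
      using tail[of \<tau> "[False, False]"] by (auto simp: length_Suc_conv)
    have "g (iv h (\<tau> @ [False, False])) = iv h (\<tau> @ [False, False])"
      using N_fix_level[OF g] that h by simp
    then show ?thesis
      using parity_sec_conj(2)[OF gG h, of "\<tau> @ [False, False]" 2] N_alpha_beta_sym(2)[OF g, of "iv h \<tau>" y y'] that h y
      by (simp add: beta_def del: o_apply)
  qed
qed

lemma N2_kernel:
  assumes "n \<in> N_grp (Suc (Suc 0))"
  shows "alpha n [x] = 0" "beta n [] = 0"
proof -
  obtain n0 n1 where n: "n = pair n0 n1" "n0 \<in> N_grp (Suc 0)" "n1 \<in> N_grp (Suc 0)"
    using assms by (auto simp: N_grp_Suc elim: pairsE)
  then have "n0 \<in> level_one_even" "n1 \<in> level_one_even" using N1_even by auto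
  then show "alpha n [x] = 0" "beta n [] = 0"
    by (simp_all add: n(1) alpha_def beta_def sec_pair_Cons level_one_even_def)
qed

lemma alpha_beta_x2: "alpha x2_elt [x] = 0" "beta x2_elt [] = 1"
  by (simp_all add: alpha_def beta_def x2_pair sec_pair_Cons parity_comp numeral_2_eq_2)

text \<open>On the first level, write \<open>g = (k, k') t\<close> with \<open>k, k' \<in> K\<close> and \<open>t \<in> T\<close>. The coordinate \<open>\<beta>\<close> vanishes on
  \<open>(k, k')\<close>, so \<open>\<beta> g = 0\<close> forces \<open>t \<in> N\<^sub>2\<close>; then \<open>\<alpha> g = 0\<close> forces both \<open>k\<close> and \<open>k'\<close> into \<open>N\<^sub>1\<close>,
  since the elements of \<open>x N\<^sub>1\<close> have odd coordinate. The higher levels are products of the first.\<close>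

lemma alpha_beta_zero_imp_N:
  assumes "g \<in> N_grp (Suc m)"
    "\<And>\<sigma>. length \<sigma> = Suc m \<Longrightarrow> alpha g \<sigma> = 0" "\<And>\<tau>. length \<tau> = m \<Longrightarrow> beta g \<tau> = 0"
  shows "g \<in> N_grp (Suc (Suc m))"
  using assms
proof (induction m arbitrary: g)
  case 0
  note ND = Grig_normalD[OF N1_normal]
  obtain k k' t where g: "g = pair k k' \<circ> t" "k \<in> K_grp" "k' \<in> K_grp" "t \<in> T_grp"
    using 0(1) by (auto simp: N_grp_1 elim: pairsE)
  have kk: "pair k k' \<in> N_grp (Suc 0)" and tN: "t \<in> N_grp (Suc 0)" using g N1_incl by auto
  \<comment> \<open>off \<open>N\<^sub>1\<close>, the coordinate of an element of \<open>K\<close> is that of \<open>x\<^sup>-\<^sup>1\<close>, because \<open>N\<^sub>1\<close> has only even components\<close>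
  have K_even: "parity 1 (sec u [False]) = 1" and K_par2: "x_elt \<circ> u \<in> N_grp (Suc 0)" 
    if "u \<in> K_grp" "u \<notin> N_grp (Suc 0)" for u
  proof -
    show xu: "x_elt \<circ> u \<in> N_grp (Suc 0)" using K_cases that by blast
    then have ev: "parity 1 (sec (x_elt \<circ> u) [False]) = 0" "(x_elt \<circ> u) [False] = [False]"
      using N1_even unfolding level_one_even_def by blast+
    have "x_elt (u [False]) = x_elt [False]" using ev(2) act_first(1) by (simp add: x_pair)
    then have "u [False] = [False]" using bij_Grig[OF x_Grig] by (metis bij_pointE)
    then have "parity 1 (sec (x_elt \<circ> u) [False]) = parity 1 (sec x_elt [False]) + parity 1 (sec u [False])"
      using that KD(2) by (intro parity_sec_comp) auto
    moreover have "parity 1 (sec x_elt [False]) = 1" by (simp add: x_pair parity_comp)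
    ultimately have "1 + parity 1 (sec u [False]) = 0" using ev by simp
    then show "parity 1 (sec u [False]) = 1" by (cases "parity 1 (sec u [False])") auto
  qed
  have tG: "t \<in> GG" using g TD by auto
  have beta_kk: "beta (pair k k') [] = 0"
  proof -
    have "k \<in> N_grp (Suc 0) \<or> x_elt \<circ> k \<in> N_grp (Suc 0)" using K_cases g by blast
    moreover have "parity 2 (sec u [False]) = 0" if "u \<in> N_grp (Suc 0)" for u
      using that N1_even by (auto simp: level_one_even_def)
    moreover have "parity 2 (sec k [False]) = parity 2 (sec (x_elt \<circ> k) [False])" if xk: "x_elt \<circ> k \<in> N_grp (Suc 0)"
    proof -
      have "(x_elt \<circ> k) [False] = [False]" using N1_even xk unfolding level_one_even_def by blast
      then have "x_elt (k [False]) = x_elt [False]" using act_first(1) by (simp add: x_pair)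
      then have "k [False] = [False]" using bij_Grig[OF x_Grig] by (metis bij_pointE)
      then have "parity 2 (sec (x_elt \<circ> k) [False]) = parity 2 (sec x_elt [False]) + parity 2 (sec k [False])"
        using g KD(2) by (intro parity_sec_comp) auto
      then show ?thesis by (simp add: x_pair parity_comp numeral_2_eq_2)
    qed
    ultimately show ?thesis by (auto simp: beta_def)
  qed
  have bg: "beta g [] = 0" and ag: "alpha g [x] = 0" for x
    using 0 by simp_all
  have "beta t [] = 0"
    using bg alpha_comp(2)[OF kk tN, of "[]"] beta_kk unfolding g(1) by simp
  have tN2: "t \<in> N_grp (Suc (Suc 0))"
  proof (rule ccontr)
    assume "t \<notin> N_grp (Suc (Suc 0))"
    then have "x2_elt \<circ> t \<in> N_grp (Suc (Suc 0))" using T_cases g by blast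
    then have "beta (x2_elt \<circ> t) [] = 0" by (rule N2_kernel)
    then show False
      using alpha_comp(2)[OF x2_N1 tN, of "[]"] \<open>beta t [] = 0\<close> by (simp add: alpha_beta_x2)
  qed
  have "alpha (pair k k') [x] = 0" for x
    using ag[of x] alpha_comp(1)[OF kk tN, of "[x]"] N2_kernel(1)[OF tN2, of x] unfolding g(1) 
    by (simp del: alpha_pair)
  from this[of False] this[of True] have "parity 1 (sec k [False]) = 0" "parity 1 (sec k' [False]) = 0"
    by (simp_all add: alpha_def)
  then have "k \<in> N_grp (Suc 0)" "k' \<in> N_grp (Suc 0)"
    using K_even[of k] K_even[of k'] g by auto
  then have "pair k k' \<in> N_grp (Suc (Suc 0))" by (simp add: N_grp_Suc)
  then show ?case unfolding g(1) using tN2 by (intro Grig_normalD(4)[OF N_normal]) auto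
next
  case (Suc m)
  then obtain g0 g1 where g: "g = pair g0 g1" "g0 \<in> N_grp (Suc m)" "g1 \<in> N_grp (Suc m)"
    by (auto simp: N_grp_Suc elim: pairsE)
  have "alpha g0 \<sigma> = 0" "alpha g1 \<sigma> = 0" if "length \<sigma> = Suc m" for \<sigma>
    using Suc.prems(2)[of "False # \<sigma>"] Suc.prems(2)[of "True # \<sigma>"] g that by simp_all
  moreover have "beta g0 \<sigma> = 0" "beta g1 \<sigma> = 0" if "length \<sigma> = m" for \<sigma>
    using Suc.prems(3)[of "False # \<sigma>"] Suc.prems(3)[of "True # \<sigma>"] g that by simp_all
  ultimately have "g0 \<in> N_grp (Suc (Suc m))" "g1 \<in> N_grp (Suc (Suc m))"
    using Suc.IH g by auto
  then show ?case by (simp add: g(1) N_grp_Suc[of "Suc m"])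
qed

lemma N_imp_alpha_beta_zero:
  assumes "g \<in> N_grp (Suc (Suc m))"
  shows "length \<sigma> = Suc m \<Longrightarrow> alpha g \<sigma> = 0" "length \<tau> = m \<Longrightarrow> beta g \<tau> = 0"
proof -
  have "(\<forall>\<sigma>. length \<sigma> = Suc m \<longrightarrow> alpha g \<sigma> = 0) \<and> (\<forall>\<tau>. length \<tau> = m \<longrightarrow> beta g \<tau> = 0)"
    using assms
  proof (induction m arbitrary: g)
    case 0
    then show ?case using N2_kernel by (auto simp: length_Suc_conv)
  next
    case (Suc m)
    then obtain g0 g1 where g: "g = pair g0 g1" "g0 \<in> N_grp (Suc (Suc m))" "g1 \<in> N_grp (Suc (Suc m))"
      using N_grp_Suc[of "Suc m"] by (auto elim: pairsE)
    note IH = Suc.IH[OF g(2)] Suc.IH[OF g(3)]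
    show ?case unfolding g(1) using IH by (auto simp: length_Suc_conv)
  qed
  then show "length \<sigma> = Suc m \<Longrightarrow> alpha g \<sigma> = 0" "length \<tau> = m \<Longrightarrow> beta g \<tau> = 0" by auto
qed

lemma sec_at_vertex:
  assumes "length \<sigma> = length \<tau>"
  shows "sec (at_vertex \<sigma> g) (\<tau> @ \<rho>) = (if \<sigma> = \<tau> then sec g \<rho> else id)"
  using assms by (induction \<sigma> \<tau> rule: list_induct2) (auto simp: at_vertex_Cons sec_pair_Cons simp del: id_apply)

lemma at_vertex_in_N:
  shows "length \<sigma> = Suc m \<Longrightarrow> at_vertex \<sigma> x_elt \<in> N_grp (Suc m)"
    and "length \<tau> = m \<Longrightarrow> at_vertex \<tau> x2_elt \<in> N_grp (Suc m)"
proof -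
  have idN: "id \<in> N_grp (Suc m)" for m using Grig_normalD(3)[OF N_normal] by simp
  show "at_vertex \<sigma> x_elt \<in> N_grp (Suc m)" if "length \<sigma> = Suc m"
    using that
  proof (induction m arbitrary: \<sigma>)
    case 0
    then obtain x where "\<sigma> = [x]" by (auto simp: length_Suc_conv)
    then show ?case using N1_incl(1) x_in_K KD(3) by (auto simp: at_vertex_Cons subset_iff)
  next
    case (Suc m)
    then obtain x \<sigma>' where "\<sigma> = x # \<sigma>'" "length \<sigma>' = Suc m" by (auto simp: length_Suc_conv)
    then show ?case using Suc.IH idN by (simp add: at_vertex_Cons N_grp_Suc)
  qed
  show "at_vertex \<tau> x2_elt \<in> N_grp (Suc m)" if "length \<tau> = m"
    using that
  proof (induction m arbitrary: \<tau>)
    case 0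
    then show ?case by (simp add: x2_N1)
  next
    case (Suc m)
    then obtain x \<sigma>' where "\<tau> = x # \<sigma>'" "length \<sigma>' = m" by (auto simp: length_Suc_conv)
    then show ?case using Suc.IH idN by (simp add: at_vertex_Cons N_grp_Suc)
  qed
qed

lemma alpha_beta_at_vertex:
  shows "length \<sigma> = length \<sigma>' \<Longrightarrow> alpha (at_vertex \<sigma> x_elt) \<sigma>' = of_bool (\<sigma> = \<sigma>')"
    and "length \<sigma> = Suc (length \<tau>) \<Longrightarrow> beta (at_vertex \<sigma> x_elt) \<tau> = 0"
    and "length \<sigma> = Suc (length \<tau>) \<Longrightarrow> alpha (at_vertex \<tau> x2_elt) \<sigma> = 0"
    and "length \<tau> = length \<tau>' \<Longrightarrow> beta (at_vertex \<tau> x2_elt) \<tau>' = of_bool (\<tau> = \<tau>')"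
proof -
  show "length \<sigma> = length \<sigma>' \<Longrightarrow> alpha (at_vertex \<sigma> x_elt) \<sigma>' = of_bool (\<sigma> = \<sigma>')"
    by (simp add: alpha_def sec_at_vertex x_pair parity_comp)
  show "length \<tau> = length \<tau>' \<Longrightarrow> beta (at_vertex \<tau> x2_elt) \<tau>' = of_bool (\<tau> = \<tau>')"
    by (simp add: beta_def sec_at_vertex x2_pair parity_comp numeral_2_eq_2)
  assume len: "length \<sigma> = Suc (length \<tau>)"
  then obtain \<sigma>0 y where \<sigma>: "\<sigma> = \<sigma>0 @ [y]" "length \<sigma>0 = length \<tau>"
    by (cases \<sigma> rule: rev_cases) auto
  show "beta (at_vertex \<sigma> x_elt) \<tau> = 0"
    using \<sigma> by (simp add: at_vertex_append beta_def sec_at_vertex at_vertex_Cons x_pair parity_comp numeral_2_eq_2)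
  show "alpha (at_vertex \<tau> x2_elt) \<sigma> = 0"
    using \<sigma> by (simp add: alpha_def sec_at_vertex x2_pair sec_pair_Cons parity_comp)
qed

text \<open>This subgroup maps onto \<open>N\<^sub>m / N\<^sub>m\<^sub>+\<^sub>1\<close>; so a homomorphism on the quotient is determined by its values on the
  generators, and elements with arbitrary prescribed coordinates can be found in it.\<close>

definition basis_grp :: "nat \<Rightarrow> (word \<Rightarrow> word) set" where
  "basis_grp m = generate Grig ({at_vertex \<sigma> x_elt | \<sigma>. length \<sigma> = m} \<union> {at_vertex \<tau> x2_elt | \<tau>. length \<tau> = m - 1})"

lemma basis_incl:
  "length \<sigma> = Suc m \<Longrightarrow> at_vertex \<sigma> x_elt \<in> basis_grp (Suc m)"
  "length \<tau> = m \<Longrightarrow> at_vertex \<tau> x2_elt \<in> basis_grp (Suc m)"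
  unfolding basis_grp_def by (auto intro!: generate.incl)

lemma basis_gens_subset: 
  "{at_vertex \<sigma> x_elt | \<sigma>. length \<sigma> = Suc m} \<union> {at_vertex \<tau> x2_elt | \<tau>. length \<tau> = Suc m - 1} \<subseteq> N_grp (Suc m)"
  using at_vertex_in_N by auto

lemma basis_subgroup: "subgroup (basis_grp (Suc m)) Grig"
  unfolding basis_grp_def using basis_gens_subset N_subset_Grig
  by (intro Grig.generate_is_subgroup) blast

lemma basis_subset_N: "basis_grp (Suc m) \<subseteq> N_grp (Suc m)"
  unfolding basis_grp_def
  using Grig.generate_subgroup_incl[OF basis_gens_subset Grig_normalD(1)[OF N_normal]] by simp

lemma finite_words: "finite {\<sigma> :: word. length \<sigma> = n}"
  using finite_lists_length_eq[of "UNIV :: bool set" n] by simp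

lemma bit_functions_spanned_by_deltas:
  fixes Q :: "('a \<Rightarrow> bit) \<Rightarrow> bool"
  assumes "finite A" and zero: "Q (\<lambda>_. 0)" and delta: "\<And>\<rho>. \<rho> \<in> A \<Longrightarrow> Q (\<lambda>\<sigma>. of_bool (\<rho> = \<sigma>))"
    and add: "\<And>f g. Q f \<Longrightarrow> Q g \<Longrightarrow> Q (\<lambda>\<sigma>. f \<sigma> + g \<sigma>)"
  shows "Q (\<lambda>\<sigma>. if \<sigma> \<in> A then f \<sigma> else 0)"
  using assms(1) delta
proof (induction A rule: finite_induct)
  case empty
  show ?case using zero by simp
next
  case (insert \<rho> A)
  have IH: "Q (\<lambda>\<sigma>. if \<sigma> \<in> A then f \<sigma> else 0)" using insert by simp
  show ?case
  proof (cases "f \<rho>")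
    case zero
    have "(\<lambda>\<sigma>. if \<sigma> \<in> insert \<rho> A then f \<sigma> else 0) = (\<lambda>\<sigma>. if \<sigma> \<in> A then f \<sigma> else 0)"
      using zero by (auto simp: fun_eq_iff)
    then show ?thesis using IH by (simp only:)
  next
    case one
    have "(\<lambda>\<sigma>. if \<sigma> \<in> insert \<rho> A then f \<sigma> else 0) =
        (\<lambda>\<sigma>. of_bool (\<rho> = \<sigma>) + (if \<sigma> \<in> A then f \<sigma> else 0))"
      using one insert.hyps by (auto simp: fun_eq_iff)
    then show ?thesis using add[OF insert.prems[of \<rho>] IH] by simp
  qed
qed

lemma basis_surjective:
  "\<exists>g\<in>basis_grp (Suc m). (\<forall>\<sigma>. length \<sigma> = Suc m \<longrightarrow> alpha g \<sigma> = f \<sigma>) \<and> (\<forall>\<tau>. length \<tau> = m \<longrightarrow> beta g \<tau> = f' \<tau>)"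
proof -
  note BD = Grig_subgroupD[OF basis_subgroup[of m]]
  \<comment> \<open>the pair \<open>(f, f')\<close> is realized as the coordinates of an element of the basis group\<close>
  let ?real = "\<lambda>f f'. \<exists>g\<in>basis_grp (Suc m). (\<forall>\<sigma>. length \<sigma> = Suc m \<longrightarrow> alpha g \<sigma> = f \<sigma>) \<and>
      (\<forall>\<tau>. length \<tau> = m \<longrightarrow> beta g \<tau> = f' \<tau>)"
  have add: "?real (\<lambda>\<sigma>. f1 \<sigma> + f2 \<sigma>) (\<lambda>\<tau>. f1' \<tau> + f2' \<tau>)" if f1: "?real f1 f1'" and f2: "?real f2 f2'" for f1 f2 f1' f2'
  proof -
    obtain g1 where g1: "g1 \<in> basis_grp (Suc m)" "\<And>\<sigma>. length \<sigma> = Suc m \<Longrightarrow> alpha g1 \<sigma> = f1 \<sigma>"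
      "\<And>\<tau>. length \<tau> = m \<Longrightarrow> beta g1 \<tau> = f1' \<tau>" using f1 by blast
    obtain g2 where g2: "g2 \<in> basis_grp (Suc m)" "\<And>\<sigma>. length \<sigma> = Suc m \<Longrightarrow> alpha g2 \<sigma> = f2 \<sigma>"
      "\<And>\<tau>. length \<tau> = m \<Longrightarrow> beta g2 \<tau> = f2' \<tau>" using f2 by blast
    have N: "g1 \<in> N_grp (Suc m)" "g2 \<in> N_grp (Suc m)" using g1(1) g2(1) basis_subset_N by blast+
    show ?thesis
      using alpha_comp[OF N] g1 g2 by (intro bexI[OF _ BD(3)[OF g1(1) g2(1)]]) (simp del: o_apply)
  qed
  have zero: "?real (\<lambda>_. 0) (\<lambda>_. 0)"
  proof -
    have "alpha id \<sigma> = 0" "beta id \<sigma> = 0" for \<sigma> by (simp_all add: alpha_def beta_def)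
    then show ?thesis using BD(2) by (intro bexI[of _ id]) (simp_all del: id_apply)
  qed
  have "?real (\<lambda>\<sigma>. if \<sigma> \<in> {\<sigma>. length \<sigma> = Suc m} then f \<sigma> else 0) (\<lambda>_. 0)"
  proof (rule bit_functions_spanned_by_deltas[OF finite_words])
    show "?real (\<lambda>\<sigma>. f \<sigma> + g \<sigma>) (\<lambda>_. 0)" if "?real f (\<lambda>_. 0)" "?real g (\<lambda>_. 0)" for f g
      using add[OF that] by simp
    show "?real (\<lambda>\<sigma>. of_bool (\<rho> = \<sigma>)) (\<lambda>_. 0)" if "\<rho> \<in> {\<sigma>. length \<sigma> = Suc m}" for \<rho>
      using that alpha_beta_at_vertex(1)[of \<rho>] alpha_beta_at_vertex(2)[of \<rho>] basis_incl(1)[of \<rho> m]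
      by (intro bexI[of _ "at_vertex \<rho> x_elt"]) auto
  qed (rule zero)
  moreover have "?real (\<lambda>_. 0) (\<lambda>\<tau>. if \<tau> \<in> {\<tau>. length \<tau> = m} then f' \<tau> else 0)"
  proof (rule bit_functions_spanned_by_deltas[OF finite_words])
    show "?real (\<lambda>_. 0) (\<lambda>\<tau>. f \<tau> + g \<tau>)" if "?real (\<lambda>_. 0) f" "?real (\<lambda>_. 0) g" for f g
      using add[OF that] by simp
    show "?real (\<lambda>_. 0) (\<lambda>\<tau>. of_bool (\<rho> = \<tau>))" if "\<rho> \<in> {\<tau>. length \<tau> = m}" for \<rho>
      using that alpha_beta_at_vertex(3)[of _ \<rho>] alpha_beta_at_vertex(4)[of \<rho>] basis_incl(2)[of \<rho> m]
      by (intro bexI[of _ "at_vertex \<rho> x2_elt"]) auto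
  qed (rule zero)
  ultimately show ?thesis
    using add[of "\<lambda>\<sigma>. if \<sigma> \<in> {\<sigma>. length \<sigma> = Suc m} then f \<sigma> else 0" "\<lambda>_. 0" "\<lambda>_. 0"] by simp
qed

section \<open>Uniserial modules of functions on a level\<close>

text \<open>The coordinate of \<open>f\<close> at \<open>v\<^sub>n\<^sup>s\<close>, for a function \<open>f\<close> on the words of length \<open>n\<close>. Splitting
  off the first letter, \<open>v\<^sub>n\<^sub>+\<^sub>1\<^sup>2\<^sup>s\<close> restricts to \<open>(v\<^sub>n\<^sup>s, 0)\<close> and \<open>v\<^sub>n\<^sub>+\<^sub>1\<^sup>2\<^sup>s\<^sup>+\<^sup>1\<close> to \<open>(v\<^sub>n\<^sup>s, v\<^sub>n\<^sup>s)\<close> on the two subtrees. So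
  the even coordinates of \<open>f = (f\<^sub>0, f\<^sub>1)\<close> are those of \<open>f\<^sub>0 + f\<^sub>1\<close>, and the odd ones are those of \<open>f\<^sub>1\<close>.\<close>

fun coord :: "nat \<Rightarrow> nat \<Rightarrow> (word \<Rightarrow> bit) \<Rightarrow> bit" where
  "coord 0 s f = (if s = 0 then f [] else 0)"
| "coord (Suc n) s f = coord n (s div 2) (\<lambda>\<sigma>. f (True # \<sigma>)) +
     (if even s then coord n (s div 2) (\<lambda>\<sigma>. f (False # \<sigma>)) else 0)"

lemma coord_add: "coord n s (\<lambda>\<sigma>. f \<sigma> + g \<sigma>) = coord n s f + coord n s g"
  by (induction n arbitrary: s f g) (simp_all add: algebra_simps)

lemma coord_zero: "coord n s (\<lambda>\<sigma>. 0) = 0"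
  by (induction n arbitrary: s) simp_all

lemma coord_cong: "(\<And>\<sigma>. length \<sigma> = n \<Longrightarrow> f \<sigma> = g \<sigma>) \<Longrightarrow> coord n s f = coord n s g"
proof (induction n arbitrary: s f g)
  case (Suc n)
  have "coord n t (\<lambda>\<sigma>. f (x # \<sigma>)) = coord n t (\<lambda>\<sigma>. g (x # \<sigma>))" for x t
    by (rule Suc.IH) (use Suc.prems in simp)
  then show ?case by simp
qed simp

lemma coord_ge: "s \<ge> 2 ^ n \<Longrightarrow> coord n s f = 0"
  by (induction n arbitrary: s f) auto

text \<open>Membership in \<open>V\<^sub>n\<^sup>r\<close>, expressed by coordinates.\<close>

definition vanish_below :: "nat \<Rightarrow> nat \<Rightarrow> (word \<Rightarrow> bit) \<Rightarrow> bool" where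
  "vanish_below n r f \<longleftrightarrow> (\<forall>s<r. coord n s f = 0)"

lemma vanish_below_mono: "vanish_below n r f \<Longrightarrow> t \<le> r \<Longrightarrow> vanish_below n t f"
  by (auto simp: vanish_below_def)

lemma vanish_below_Suc: "vanish_below n (Suc r) f \<longleftrightarrow> vanish_below n r f \<and> coord n r f = 0"
  by (auto simp: vanish_below_def less_Suc_eq)

lemma vanish_below_add: "vanish_below n r f \<Longrightarrow> vanish_below n r g \<Longrightarrow> vanish_below n r (\<lambda>\<sigma>. f \<sigma> + g \<sigma>)"
  by (simp add: vanish_below_def coord_add)

text \<open>If \<open>f = (f\<^sub>0, f\<^sub>1)\<close> lies in \<open>V\<^sub>n\<^sub>+\<^sub>1\<^sup>r\<close>, then both \<open>f\<^sub>i\<close> lie in \<open>V\<^sub>n\<^sup>q\<close> for \<open>q = \<lfloor>r / 2\<rfloor>\<close>; if \<open>r\<close> is odd, then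
  they agree modulo \<open>V\<^sub>n\<^sup>q\<^sup>+\<^sup>1\<close> in addition.\<close>

lemma vanish_below_halves:
  assumes "vanish_below (Suc n) r f"
  shows "vanish_below n (r div 2) (\<lambda>\<sigma>. f (x # \<sigma>))"
    and "odd r \<Longrightarrow> coord n (r div 2) (\<lambda>\<sigma>. f (False # \<sigma>)) = coord n (r div 2) (\<lambda>\<sigma>. f (True # \<sigma>))"
proof -
  have 1: "coord n s (\<lambda>\<sigma>. f (True # \<sigma>)) = 0 \<and> coord n s (\<lambda>\<sigma>. f (False # \<sigma>)) = 0" if "s < r div 2" for s
  proof -
    have "coord (Suc n) (2 * s) f = 0" "coord (Suc n) (2 * s + 1) f = 0"
      using assms that unfolding vanish_below_def by (auto simp del: coord.simps)
    then show ?thesis by simp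
  qed
  then show "vanish_below n (r div 2) (\<lambda>\<sigma>. f (x # \<sigma>))"
    by (cases x) (auto simp: vanish_below_def)
  show "coord n (r div 2) (\<lambda>\<sigma>. f (False # \<sigma>)) = coord n (r div 2) (\<lambda>\<sigma>. f (True # \<sigma>))" if "odd r"
  proof -
    have "coord (Suc n) (2 * (r div 2)) f = 0"
      using assms odd_pos[OF that] that unfolding vanish_below_def by (metis lessI odd_two_times_div_two_succ Suc_eq_plus1)
    then have "coord n (r div 2) (\<lambda>\<sigma>. f (True # \<sigma>)) + coord n (r div 2) (\<lambda>\<sigma>. f (False # \<sigma>)) = 0" by simp
    then show ?thesis by (metis add.right_neutral bit_add_self(2))
  qed
qed

lemma gens_Cons:
  "grig_b (False # w) = False # grig_a w" "grig_b (True # w) = True # grig_c w"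
  "grig_c (False # w) = False # grig_a w" "grig_c (True # w) = True # grig_d w"
  "grig_d (False # w) = False # w" "grig_d (True # w) = True # grig_b w"
  by (cases w; simp)+

text \<open>Simultaneous induction on the level, along \<open>b = (a, c)\<close>, \<open>c = (a, d)\<close>, \<open>d = (1, b)\<close>; the swap \<open>a\<close> exchanges
  \<open>f\<^sub>0\<close> and \<open>f\<^sub>1\<close>.\<close>

lemma coord_gens_invariant:
  assumes "vanish_below n r f"
  shows "coord n r (\<lambda>\<sigma>. f (grig_a \<sigma>)) = coord n r f \<and> coord n r (\<lambda>\<sigma>. f (grig_b \<sigma>)) = coord n r f \<and>
    coord n r (\<lambda>\<sigma>. f (grig_c \<sigma>)) = coord n r f \<and> coord n r (\<lambda>\<sigma>. f (grig_d \<sigma>)) = coord n r f"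
  using assms
proof (induction n arbitrary: r f)
  case (Suc n)
  note IH = Suc.IH[OF vanish_below_halves(1)[OF Suc.prems, of False]] Suc.IH[OF vanish_below_halves(1)[OF Suc.prems, of True]]
  show ?case
    using IH vanish_below_halves(2)[OF Suc.prems] by (cases "even r") (simp_all add: gens_Cons add.commute)
qed simp

text \<open>The generators act trivially on all quotients \<open>V\<^sub>n\<^sup>r / V\<^sub>n\<^sup>r\<^sup>+\<^sup>1\<close>, hence so do products and inverses; for an inverse,
  one ascends in \<open>r\<close> to know that \<open>f \<circ> h\<^sup>-\<^sup>1\<close> lies in \<open>V\<^sub>n\<^sup>r\<close> again.\<close>

lemma vanish_below_act: 
  assumes "h \<in> GG" "vanish_below n r f"
  shows "coord n r (\<lambda>\<sigma>. f (h \<sigma>)) = coord n r f"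
proof -
  let ?D = "{h \<in> GG. \<forall>n r f. vanish_below n r f \<longrightarrow> coord n r (\<lambda>\<sigma>. f (h \<sigma>)) = coord n r f}"
  have van: "vanish_below n r (\<lambda>\<sigma>. f (h \<sigma>))" if "h \<in> ?D" "vanish_below n r f" for h n r f
    unfolding vanish_below_def
  proof (intro allI impI)
    fix s assume "s < r"
    then have "vanish_below n s f" "coord n s f = 0" using that(2) by (auto simp: vanish_below_def)
    then show "coord n s (\<lambda>\<sigma>. f (h \<sigma>)) = 0" using that(1) by simp
  qed
  have "subgroup ?D Grig"
  proof (rule Grig_subgroupI)
    show "g \<circ> h \<in> ?D" if g: "g \<in> ?D" and h: "h \<in> ?D" for g h
    proof -
      have "coord n r (\<lambda>\<sigma>. f ((g \<circ> h) \<sigma>)) = coord n r f" if "vanish_below n r f" for n r f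
      proof -
        have "coord n r (\<lambda>\<sigma>. f (g (h \<sigma>))) = coord n r (\<lambda>\<sigma>. f (g \<sigma>))"
          using h van[OF g that] by (auto dest!: spec[where x = "\<lambda>\<sigma>. f (g \<sigma>)"])
        then show ?thesis using g that by simp
      qed
      then show ?thesis using g h by blast
    qed
    show "iv h \<in> ?D" if h: "h \<in> ?D" for h
    proof -
      have "coord n r (\<lambda>\<sigma>. f (iv h \<sigma>)) = coord n r f" if "vanish_below n r f" for n r f
        using that
      proof (induction r rule: less_induct)
        case (less r)
        have "vanish_below n r (\<lambda>\<sigma>. f (iv h \<sigma>))"
          unfolding vanish_below_def
        proof (intro allI impI)
          fix s assume "s < r"
          moreover from this have "vanish_below n s f" "coord n s f = 0" using less.prems by (auto simp: vanish_below_def)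
          ultimately show "coord n s (\<lambda>\<sigma>. f (iv h \<sigma>)) = 0" using less.IH by simp
        qed
        then have "coord n r (\<lambda>\<sigma>. f (iv h (h \<sigma>))) = coord n r (\<lambda>\<sigma>. f (iv h \<sigma>))"
          using h by (auto dest!: spec[where x = "\<lambda>\<sigma>. f (iv h \<sigma>)"])
        then show ?case using h by (simp add: iv_act)
      qed
      then show ?thesis using h by blast
    qed
  qed auto
  moreover have "{grig_a, grig_b, grig_c, grig_d} \<subseteq> ?D" using coord_gens_invariant by simp
  ultimately have "GG \<subseteq> ?D" by (rule Grig_gens_subset_subgroup)
  then show ?thesis using assms by blast
qed

lemma vanish_below_diff:
  assumes "h \<in> GG" "vanish_below n r f"
  shows "vanish_below n (Suc r) (\<lambda>\<sigma>. f \<sigma> + f (h \<sigma>))"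
  unfolding vanish_below_def
proof (intro allI impI)
  fix s assume "s < Suc r"
  then have "vanish_below n s f" using assms(2) by (auto intro: vanish_below_mono)
  then show "coord n s (\<lambda>\<sigma>. f \<sigma> + f (h \<sigma>)) = 0"
    using vanish_below_act[OF assms(1)] by (simp add: coord_add)
qed

text \<open>On \<open>V\<^sub>n\<^sup>r / V\<^sub>n\<^sup>r\<^sup>+\<^sup>2\<close> a group element \<open>g\<close> acts by \<open>v\<^sup>r \<mapsto> v\<^sup>r + \<chi>(g) v\<^sup>r\<^sup>+\<^sup>1\<close> for a homomorphism \<open>\<chi>\<close>. For even \<open>r\<close>
  only the swap \<open>a\<close> acts nontrivially. For odd \<open>r\<close> the values of \<open>\<chi>\<close> at \<open>(a, b, c, d)\<close> are obtained from
  those \<open>(p, q, s, t)\<close> for \<open>\<lfloor>r / 2\<rfloor>\<close> as \<open>(0, p + s, p + t, q)\<close>. Starting from \<open>(1, 0, 0, 0)\<close>, this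
  recursion cycles through three further rows, none of which is zero.\<close>

lemma uniserial_table:
  assumes "Suc r < 2 ^ n"
  shows "\<exists>p q s t. (p, q, s, t) \<in> {(1, 0, 0, 0), (0, 1, 1, 0), (0, 1, 0, 1), (0, 0, 1, 1 :: bit)} \<and>
    (\<forall>f. vanish_below n r f \<longrightarrow>
      coord n (Suc r) (\<lambda>\<sigma>. f (grig_a \<sigma>)) = coord n (Suc r) f + p * coord n r f \<and>
      coord n (Suc r) (\<lambda>\<sigma>. f (grig_b \<sigma>)) = coord n (Suc r) f + q * coord n r f \<and>
      coord n (Suc r) (\<lambda>\<sigma>. f (grig_c \<sigma>)) = coord n (Suc r) f + s * coord n r f \<and>
      coord n (Suc r) (\<lambda>\<sigma>. f (grig_d \<sigma>)) = coord n (Suc r) f + t * coord n r f)"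
  using assms
proof (induction n arbitrary: r)
  case (Suc n)
  show ?case
  proof (cases "even r")
    case True
    have *: "coord (Suc n) (Suc r) f = coord n (r div 2) (\<lambda>\<sigma>. f (True # \<sigma>))" for f
      using True by simp
    show ?thesis
    proof (rule exI[of _ 1], rule exI[of _ 0], rule exI[of _ 0], rule exI[of _ 0], intro conjI allI impI)
      fix f assume f: "vanish_below (Suc n) r f"
      note inv = coord_gens_invariant[OF vanish_below_halves(1)[OF f, of True]]
      show "coord (Suc n) (Suc r) (\<lambda>\<sigma>. f (grig_a \<sigma>)) = coord (Suc n) (Suc r) f + 1 * coord (Suc n) r f"
        unfolding * using True by simp
      show "coord (Suc n) (Suc r) (\<lambda>\<sigma>. f (grig_b \<sigma>)) = coord (Suc n) (Suc r) f + 0 * coord (Suc n) r f"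
        "coord (Suc n) (Suc r) (\<lambda>\<sigma>. f (grig_c \<sigma>)) = coord (Suc n) (Suc r) f + 0 * coord (Suc n) r f"
        "coord (Suc n) (Suc r) (\<lambda>\<sigma>. f (grig_d \<sigma>)) = coord (Suc n) (Suc r) f + 0 * coord (Suc n) r f"
        unfolding * using inv by (simp_all add: gens_Cons)
    qed simp
  next
    case False
    then obtain r' where r: "r = Suc (2 * r')" by (metis oddE Suc_eq_plus1)
    have *: "coord (Suc n) (Suc r) f = coord n (Suc r') (\<lambda>\<sigma>. f (True # \<sigma>)) + coord n (Suc r') (\<lambda>\<sigma>. f (False # \<sigma>))" 
      "coord (Suc n) r f = coord n r' (\<lambda>\<sigma>. f (True # \<sigma>))" for f
      using r by simp_all
    have "Suc r' < 2 ^ n" using Suc.prems r by simp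
    from Suc.IH[OF this] obtain p q s t :: bit where 
      tab: "(p, q, s, t) \<in> {(1, 0, 0, 0), (0, 1, 1, 0), (0, 1, 0, 1), (0, 0, 1, 1)}" and
      IH: "\<And>f. vanish_below n r' f \<Longrightarrow>
        coord n (Suc r') (\<lambda>\<sigma>. f (grig_a \<sigma>)) = coord n (Suc r') f + p * coord n r' f \<and>
        coord n (Suc r') (\<lambda>\<sigma>. f (grig_b \<sigma>)) = coord n (Suc r') f + q * coord n r' f \<and>
        coord n (Suc r') (\<lambda>\<sigma>. f (grig_c \<sigma>)) = coord n (Suc r') f + s * coord n r' f \<and>
        coord n (Suc r') (\<lambda>\<sigma>. f (grig_d \<sigma>)) = coord n (Suc r') f + t * coord n r' f" by blast
    show ?thesis
    proof (rule exI[of _ 0], rule exI[of _ "p + s"], rule exI[of _ "p + t"], rule exI[of _ q], intro conjI allI impI)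
      fix f assume f: "vanish_below (Suc n) r f"
      have v: "vanish_below n r' (\<lambda>\<sigma>. f (x # \<sigma>))" for x
        using vanish_below_halves(1)[OF f, of x] r by simp
      have e: "coord n r' (\<lambda>\<sigma>. f (False # \<sigma>)) = coord n r' (\<lambda>\<sigma>. f (True # \<sigma>))"
        using vanish_below_halves(2)[OF f] r by simp
      note I = IH[OF v[of False]] IH[OF v[of True]]
      show "coord (Suc n) (Suc r) (\<lambda>\<sigma>. f (grig_a \<sigma>)) = coord (Suc n) (Suc r) f + 0 * coord (Suc n) r f"
        "coord (Suc n) (Suc r) (\<lambda>\<sigma>. f (grig_b \<sigma>)) = coord (Suc n) (Suc r) f + (p + s) * coord (Suc n) r f"
        "coord (Suc n) (Suc r) (\<lambda>\<sigma>. f (grig_c \<sigma>)) = coord (Suc n) (Suc r) f + (p + t) * coord (Suc n) r f"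
        "coord (Suc n) (Suc r) (\<lambda>\<sigma>. f (grig_d \<sigma>)) = coord (Suc n) (Suc r) f + q * coord (Suc n) r f"
        unfolding * using I e by (simp_all add: gens_Cons algebra_simps)
    qed (use tab in auto)
  qed
qed simp

lemma uniserial:
  assumes "Suc r < 2 ^ n"
  obtains s where "s \<in> {grig_a, grig_b, grig_c, grig_d}"
    "\<And>f. vanish_below n r f \<Longrightarrow> coord n (Suc r) (\<lambda>\<sigma>. f \<sigma> + f (s \<sigma>)) = coord n r f"
proof -
  obtain p q s t :: bit where 
      tab: "(p, q, s, t) \<in> {(1, 0, 0, 0), (0, 1, 1, 0), (0, 1, 0, 1), (0, 0, 1, 1)}" and
      eqs: "\<And>f. vanish_below n r f \<Longrightarrow>
        coord n (Suc r) (\<lambda>\<sigma>. f (grig_a \<sigma>)) = coord n (Suc r) f + p * coord n r f \<and>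
        coord n (Suc r) (\<lambda>\<sigma>. f (grig_b \<sigma>)) = coord n (Suc r) f + q * coord n r f \<and>
        coord n (Suc r) (\<lambda>\<sigma>. f (grig_c \<sigma>)) = coord n (Suc r) f + s * coord n r f \<and>
        coord n (Suc r) (\<lambda>\<sigma>. f (grig_d \<sigma>)) = coord n (Suc r) f + t * coord n r f"
    using uniserial_table[OF assms] by blast
  from tab consider "p = 1" | "q = 1" | "s = 1" by auto
  then show ?thesis
  proof cases
    case 1 then show ?thesis using eqs by (intro that[of grig_a]) (simp_all add: coord_add)
  next
    case 2 then show ?thesis using eqs by (intro that[of grig_b]) (simp_all add: coord_add)
  next
    case 3 then show ?thesis using eqs by (intro that[of grig_c]) (simp_all add: coord_add)
  qed
qed

text \<open>The coefficients of \<open>v\<^sub>n\<^sup>r\<close>: expanding \<open>(1 - X\<^sub>1)\<^bsup>r\<^sub>1\<^esup>\<cdots>(1 - X\<^sub>n)\<^bsup>r\<^sub>n\<^esup>\<close> yields the monomials whose exponents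
  are bounded by the binary digits of \<open>r\<close>.\<close>

definition v_fun :: "nat \<Rightarrow> word \<Rightarrow> bit" where
  "v_fun r \<sigma> = of_bool (\<forall>i<length \<sigma>. \<sigma> ! i \<longrightarrow> odd (r div 2 ^ i))"

lemma v_fun_Cons: "v_fun r (x # \<sigma>) = (if x \<longrightarrow> odd r then v_fun (r div 2) \<sigma> else 0)"
proof -
  have "(\<forall>i<Suc (length \<sigma>). (x # \<sigma>) ! i \<longrightarrow> odd (r div 2 ^ i)) \<longleftrightarrow>
      (x \<longrightarrow> odd r) \<and> (\<forall>i<length \<sigma>. \<sigma> ! i \<longrightarrow> odd (r div 2 div 2 ^ i))"
    by (simp add: All_less_Suc2 div_mult2_eq)
  then show ?thesis by (simp add: v_fun_def)
qed

lemma coord_v_fun: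
  assumes "r < 2 ^ n" "s < 2 ^ n"
  shows "coord n s (v_fun r) = of_bool (s = r)"
  using assms
proof (induction n arbitrary: r s)
  case 0
  then show ?case by (simp add: v_fun_def)
next
  case (Suc n)
  have IH: "coord n (s div 2) (v_fun (r div 2)) = of_bool (s div 2 = r div 2)"
    using Suc.prems by (intro Suc.IH) auto
  have c: "s = r \<longleftrightarrow> s div 2 = r div 2 \<and> (even s \<longleftrightarrow> even r)"
    by (metis bit_eq_rec)
  have "v_fun (r div 2) = (\<lambda>\<sigma>. v_fun (r div 2) \<sigma>)" ..
  then show ?case unfolding coord.simps v_fun_Cons c using IH by (cases "even r"; cases "even s") (simp_all add: coord_zero)
qed

lemma sum_even_odd:
  fixes g :: "nat \<Rightarrow> 'a :: comm_monoid_add"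
  shows "(\<Sum>s<2 * k. g s) = (\<Sum>s<k. g (2 * s) + g (Suc (2 * s)))"
  by (induction k) (simp_all add: algebra_simps)

lemma coord_expand:
  assumes "length \<sigma> = n"
  shows "f \<sigma> = (\<Sum>s<2 ^ n. coord n s f * v_fun s \<sigma>)"
  using assms
proof (induction n arbitrary: f \<sigma>)
  case 0
  then show ?case by (simp add: v_fun_def)
next
  case (Suc n)
  then obtain x \<sigma>' where \<sigma>: "\<sigma> = x # \<sigma>'" "length \<sigma>' = n" by (auto simp: length_Suc_conv)
  note IH = Suc.IH[OF \<sigma>(2), of "\<lambda>\<sigma>. f (True # \<sigma>)"] Suc.IH[OF \<sigma>(2), of "\<lambda>\<sigma>. f (False # \<sigma>)"]
  show ?case
    unfolding power_Suc sum_even_odd \<sigma>(1) using IH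
    by (cases x) (simp_all add: v_fun_Cons algebra_simps)
qed

section \<open>Functions on a level as polynomials\<close>

definition word_exponent :: "word \<Rightarrow> nat \<Rightarrow>\<^sub>0 bit" where
  "word_exponent \<sigma> = (\<Sum>i = 1..length \<sigma>. Poly_Mapping.single i (of_bool (\<sigma> ! (i - 1))))"

lemma word_monomial_eq: "word_monomial \<sigma> = Poly_Mapping.single (word_exponent \<sigma>) 1"
proof -
  have q: "qvar i ^ of_bool b = Poly_Mapping.single (Poly_Mapping.single i (of_bool b)) 1" for i b
    by (simp add: qvar_def)
  have "(\<Prod>i\<in>A. Poly_Mapping.single (h i) (1 :: bit)) = Poly_Mapping.single (\<Sum>i\<in>A. h i) 1"
    if "finite A" for A and h :: "nat \<Rightarrow> (nat \<Rightarrow>\<^sub>0 bit)"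
    using that by (induction A rule: finite_induct) (simp_all add: mult_single)
  then show ?thesis by (simp add: word_monomial_def q word_exponent_def)
qed

lemma lookup_word_exponent: 
  "Poly_Mapping.lookup (word_exponent \<sigma>) i = of_bool (1 \<le> i \<and> i \<le> length \<sigma> \<and> \<sigma> ! (i - 1))"
proof -
  have "Poly_Mapping.lookup (word_exponent \<sigma>) i = (\<Sum>j = 1..length \<sigma>. if j = i then of_bool (\<sigma> ! (j - 1)) else 0)"
    unfolding word_exponent_def lookup_sum lookup_single by (simp add: when_def)
  also have "\<dots> = of_bool (1 \<le> i \<and> i \<le> length \<sigma> \<and> \<sigma> ! (i - 1))"
    by (auto simp: sum.delta')
  finally show ?thesis .
qed

lemma word_exponent_inject: "length \<sigma> = length \<tau> \<Longrightarrow> word_exponent \<sigma> = word_exponent \<tau> \<longleftrightarrow> \<sigma> = \<tau>"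
proof
  assume len: "length \<sigma> = length \<tau>" and eq: "word_exponent \<sigma> = word_exponent \<tau>"
  show "\<sigma> = \<tau>"
  proof (rule nth_equalityI[OF len])
    fix i assume "i < length \<sigma>"
    then show "\<sigma> ! i = \<tau> ! i"
      using arg_cong[OF eq, of "\<lambda>e. Poly_Mapping.lookup e (Suc i)"] len
      by (cases "\<sigma> ! i"; cases "\<tau> ! i") (simp_all add: lookup_word_exponent)
  qed
qed simp

lemma keys_word_exponent: "Poly_Mapping.keys (word_exponent \<sigma>) \<subseteq> {1..length \<sigma>}"
  by (auto simp: in_keys_iff lookup_word_exponent)

lemma word_exponent_surj:
  assumes "Poly_Mapping.keys e \<subseteq> {1..n}"
  obtains \<sigma> where "length \<sigma> = n" "e = word_exponent \<sigma>"
proof (rule that)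
  let ?s = "map (\<lambda>i. Poly_Mapping.lookup e (Suc i) = 1) [0..<n]"
  show "length ?s = n" by simp
  show "e = word_exponent ?s"
  proof (rule poly_mapping_eqI)
    fix i
    have "Poly_Mapping.lookup e i = 0" if "\<not> (1 \<le> i \<and> i \<le> n)"
      using assms that by (metis atLeastAtMost_iff in_keys_iff subsetD)
    then show "Poly_Mapping.lookup e i = Poly_Mapping.lookup (word_exponent ?s) i"
      by (cases "1 \<le> i \<and> i \<le> n"; cases "Poly_Mapping.lookup e i") (auto simp: lookup_word_exponent)
  qed
qed

definition to_poly :: "nat \<Rightarrow> (word \<Rightarrow> bit) \<Rightarrow> qpoly" where
  "to_poly n f = (\<Sum>\<sigma> | length \<sigma> = n. qscale (f \<sigma>) (word_monomial \<sigma>))"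

lemma lookup_to_poly:
  "Poly_Mapping.lookup (to_poly n f) e = (\<Sum>\<sigma> | length \<sigma> = n. if word_exponent \<sigma> = e then f \<sigma> else 0)"
  unfolding to_poly_def lookup_sum qscale_def word_monomial_eq
  by (simp add: mult_single lookup_single when_def)

lemma lookup_toP_wexp:
  assumes "length \<sigma> = n" shows "Poly_Mapping.lookup (to_poly n f) (word_exponent \<sigma>) = f \<sigma>"
proof -
  have "(\<Sum>\<tau> | length \<tau> = n. if word_exponent \<tau> = word_exponent \<sigma> then f \<tau> else 0) = (\<Sum>\<tau> | length \<tau> = n. if \<tau> = \<sigma> then f \<tau> else 0)"
    by (intro sum.cong) (use assms in \<open>auto simp: word_exponent_inject\<close>)
  then show ?thesis unfolding lookup_to_poly using assms by (simp add: finite_words)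
qed

lemma to_poly_cong: "(\<And>\<sigma>. length \<sigma> = n \<Longrightarrow> f \<sigma> = g \<sigma>) \<Longrightarrow> to_poly n f = to_poly n g"
  unfolding to_poly_def by (intro sum.cong) auto

lemma to_poly_inject: "to_poly n f = to_poly n g \<longleftrightarrow> (\<forall>\<sigma>. length \<sigma> = n \<longrightarrow> f \<sigma> = g \<sigma>)"
  by (metis lookup_toP_wexp to_poly_cong)

lemma to_poly_add: "to_poly n (\<lambda>\<sigma>. f \<sigma> + g \<sigma>) = to_poly n f + to_poly n g"
  by (rule poly_mapping_eqI) (simp add: lookup_to_poly lookup_add if_distrib sum.distrib[symmetric], intro sum.cong, auto)

lemma to_poly_zero: "to_poly n (\<lambda>\<sigma>. 0) = 0"
  by (rule poly_mapping_eqI) (simp add: lookup_to_poly)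

lemma to_poly_scale: "to_poly n (\<lambda>\<sigma>. c * f \<sigma>) = qscale c (to_poly n f)"
  by (cases c) (simp_all add: qscale_def to_poly_zero)

lemma to_poly_delta: "length \<rho> = n \<Longrightarrow> to_poly n (\<lambda>\<sigma>. of_bool (\<rho> = \<sigma>)) = word_monomial \<rho>"
proof (rule poly_mapping_eqI)
  fix e assume "length \<rho> = n"
  then show "Poly_Mapping.lookup (to_poly n (\<lambda>\<sigma>. of_bool (\<rho> = \<sigma>))) e = Poly_Mapping.lookup (word_monomial \<rho>) e"
    unfolding lookup_to_poly word_monomial_eq lookup_single when_def
    by (subst sum.cong[OF refl, of _ _ "\<lambda>\<sigma>. if \<sigma> = \<rho> then (if word_exponent \<rho> = e then 1 else 0) else 0"])
       (auto simp: finite_words)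
qed

lemma to_poly_V_mod: "to_poly n f \<in> V_mod n"
proof -
  have "Poly_Mapping.keys e \<subseteq> {1..n}" if "e \<in> Poly_Mapping.keys (to_poly n f)" for e
  proof -
    have "(\<Sum>\<sigma> | length \<sigma> = n. if word_exponent \<sigma> = e then f \<sigma> else 0) \<noteq> 0"
      using that by (simp add: in_keys_iff lookup_to_poly)
    then obtain \<sigma> where "length \<sigma> = n" "word_exponent \<sigma> = e"
      by (elim sum.not_neutral_contains_not_neutral) (auto split: if_splits)
    then show ?thesis using keys_word_exponent by blast
  qed
  then show ?thesis by (auto simp: V_mod_def)
qed

lemma V_mod_to_poly: 
  assumes "p \<in> V_mod n" obtains f where "p = to_poly n f"
proof (rule that, rule poly_mapping_eqI)
  fix e
  let ?f = "\<lambda>\<sigma>. Poly_Mapping.lookup p (word_exponent \<sigma>)"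
  show "Poly_Mapping.lookup p e = Poly_Mapping.lookup (to_poly n ?f) e"
  proof (cases "Poly_Mapping.keys e \<subseteq> {1..n}")
    case True
    then obtain \<sigma> where "length \<sigma> = n" "e = word_exponent \<sigma>" by (rule word_exponent_surj)
    then show ?thesis by (simp add: lookup_toP_wexp)
  next
    case False
    have "Poly_Mapping.lookup p e = 0"
      using assms False by (auto simp: V_mod_def in_keys_iff)
    moreover have "e \<notin> Poly_Mapping.keys (to_poly n ?f)"
      using to_poly_V_mod[of n ?f] False unfolding V_mod_def by blast
    ultimately show ?thesis by (simp add: in_keys_iff)
  qed
qed

lemma word_monomial_snoc: "word_monomial (\<sigma> @ [x]) = word_monomial \<sigma> * qvar (Suc (length \<sigma>)) ^ of_bool x"
proof -
  have "(\<Prod>i = 1..length \<sigma>. qvar i ^ of_bool ((\<sigma> @ [x]) ! (i - 1))) = word_monomial \<sigma>"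
    unfolding word_monomial_def by (intro prod.cong) (auto simp: nth_append)
  then show ?thesis by (simp add: word_monomial_def[of "\<sigma> @ [x]"])
qed

lemma to_poly_Suc: "to_poly (Suc n) f = to_poly n (\<lambda>\<sigma>. f (\<sigma> @ [False])) + to_poly n (\<lambda>\<sigma>. f (\<sigma> @ [True])) * qvar (Suc n)"
proof -
  have words: "{\<sigma> :: word. length \<sigma> = Suc n} = (\<lambda>\<sigma>. \<sigma> @ [False]) ` {\<sigma>. length \<sigma> = n} \<union> (\<lambda>\<sigma>. \<sigma> @ [True]) ` {\<sigma>. length \<sigma> = n}"
  proof (intro equalityI subsetI)
    fix \<sigma> :: word assume "\<sigma> \<in> {\<sigma>. length \<sigma> = Suc n}"
    then obtain \<tau> x where "\<sigma> = \<tau> @ [x]" "length \<tau> = n" by (cases \<sigma> rule: rev_cases) auto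
    then show "\<sigma> \<in> (\<lambda>\<sigma>. \<sigma> @ [False]) ` {\<sigma>. length \<sigma> = n} \<union> (\<lambda>\<sigma>. \<sigma> @ [True]) ` {\<sigma>. length \<sigma> = n}"
      by (cases x) auto
  qed auto
  have inj: "inj_on (\<lambda>\<sigma>. \<sigma> @ [x]) A" for x and A :: "word set" by (auto simp: inj_on_def)
  have "to_poly (Suc n) f = (\<Sum>\<sigma> | length \<sigma> = n. qscale (f (\<sigma> @ [False])) (word_monomial (\<sigma> @ [False])))
      + (\<Sum>\<sigma> | length \<sigma> = n. qscale (f (\<sigma> @ [True])) (word_monomial (\<sigma> @ [True])))"
    unfolding to_poly_def words
    by (subst sum.union_disjoint) (auto simp: finite_words sum.reindex[OF inj] o_def)
  also have "\<dots> = to_poly n (\<lambda>\<sigma>. f (\<sigma> @ [False])) + to_poly n (\<lambda>\<sigma>. f (\<sigma> @ [True])) * qvar (Suc n)"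
    unfolding to_poly_def sum_distrib_right
    by (intro arg_cong2[of _ _ _ _ "(+)"] sum.cong) (auto simp: word_monomial_snoc qscale_def algebra_simps)
  finally show ?thesis .
qed

lemma v_fun_snoc: "v_fun r (\<sigma> @ [x]) = (if x \<longrightarrow> odd (r div 2 ^ length \<sigma>) then v_fun r \<sigma> else 0)"
  by (auto simp: v_fun_def nth_append less_Suc_eq)

text \<open>Induction on the number of variables, splitting off the last one: it corresponds to the last letter of a word
  and to the highest binary digit of \<open>r\<close>.\<close>

lemma v_elt_to_poly: "v_elt n r = to_poly n (v_fun r)"
proof (induction n)
  case 0
  show ?case by (simp add: v_elt_def to_poly_def v_fun_def word_monomial_def qscale_def)
next
  case (Suc n)
  have v: "v_elt (Suc n) r = v_elt n r * (1 - qvar (Suc n)) ^ (r div 2 ^ n mod 2)"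
    by (simp add: v_elt_def)
  have minus: "p - q = p + (q :: qpoly)" for p q
    by (rule poly_mapping_eqI) (simp add: lookup_minus lookup_add)
  have F: "to_poly n (\<lambda>\<sigma>. v_fun r (\<sigma> @ [False])) = to_poly n (v_fun r)" by (simp add: v_fun_snoc)
  have T: "to_poly n (\<lambda>\<sigma>. v_fun r (\<sigma> @ [True])) = (if odd (r div 2 ^ n) then to_poly n (v_fun r) else 0)"
    using to_poly_cong[of n "\<lambda>\<sigma>. v_fun r (\<sigma> @ [True])" "\<lambda>\<sigma>. if odd (r div 2 ^ n) then v_fun r \<sigma> else 0"]
    by (auto simp: v_fun_snoc to_poly_zero)
  show ?case
    unfolding v to_poly_Suc F T Suc.IH
    by (cases "odd (r div 2 ^ n)") (auto simp: minus odd_iff_mod_2_eq_one even_iff_mod_2_eq_zero algebra_simps)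
qed

interpretation qs: vector_space qscale by (rule vector_space_qscale)

lemma V_sub_iff: "to_poly n f \<in> V_sub n r \<longleftrightarrow> vanish_below n r f"
proof
  assume v: "vanish_below n r f"
  have "to_poly n f = to_poly n (\<lambda>\<sigma>. \<Sum>s<2 ^ n. coord n s f * v_fun s \<sigma>)"
    by (intro to_poly_cong coord_expand)
  also have "\<dots> = (\<Sum>s<2 ^ n. qscale (coord n s f) (v_elt n s))"
  proof -
    have "to_poly n (\<lambda>\<sigma>. \<Sum>s\<in>A. coord n s f * v_fun s \<sigma>) = (\<Sum>s\<in>A. qscale (coord n s f) (v_elt n s))" if "finite A" for A
      using that by (induction A rule: finite_induct) (simp_all add: to_poly_zero to_poly_add to_poly_scale v_elt_to_poly)
    then show ?thesis by simp
  qed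
  also have "\<dots> \<in> V_sub n r"
    unfolding V_sub_def
  proof (intro qs.span_sum)
    fix s :: nat assume s: "s \<in> {..<2 ^ n}"
    show "qscale (coord n s f) (v_elt n s) \<in> qs.span (v_elt n ` {r..<2 ^ n})"
    proof (cases "s < r")
      case True
      then show ?thesis using v by (simp add: vanish_below_def qs.span_zero)
    next
      case False
      then show ?thesis using s by (intro qs.span_scale qs.span_base) auto
    qed
  qed
  finally show "to_poly n f \<in> V_sub n r" .
next
  assume "to_poly n f \<in> V_sub n r"
  moreover have "V_sub n r \<subseteq> {to_poly n f | f. vanish_below n r f}"
    unfolding V_sub_def
  proof (rule qs.span_minimal)
    show "v_elt n ` {r..<2 ^ n} \<subseteq> {to_poly n f | f. vanish_below n r f}"
      by (fastforce simp: v_elt_to_poly vanish_below_def coord_v_fun)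
    show "qs.subspace {to_poly n f | f. vanish_below n r f}"
    proof (rule qs.subspaceI)
      show "0 \<in> {to_poly n f | f. vanish_below n r f}"
        by (metis (mono_tags, lifting) CollectI coord_zero to_poly_zero vanish_below_def)
      show "p + q \<in> {to_poly n f | f. vanish_below n r f}" 
        if p: "p \<in> {to_poly n f | f. vanish_below n r f}" and q: "q \<in> {to_poly n f | f. vanish_below n r f}" for p q
      proof -
        obtain f g where "p = to_poly n f" "q = to_poly n g" "vanish_below n r f" "vanish_below n r g"
          using p q by blast
        then show ?thesis
          by (intro CollectI exI[of _ "\<lambda>\<sigma>. f \<sigma> + g \<sigma>"]) (simp add: to_poly_add vanish_below_add)
      qed
      show "qscale c p \<in> {to_poly n f | f. vanish_below n r f}" if p: "p \<in> {to_poly n f | f. vanish_below n r f}" for c p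
      proof (cases c)
        case zero
        then have "qscale c p = to_poly n (\<lambda>\<sigma>. 0)" by (simp add: qscale_def to_poly_zero)
        then show ?thesis by (metis (mono_tags, lifting) CollectI coord_zero vanish_below_def)
      next
        case one
        then show ?thesis using p by (simp add: qscale_def)
      qed
    qed
  qed
  ultimately obtain g where "to_poly n f = to_poly n g" "vanish_below n r g" by blast
  then show "vanish_below n r f" unfolding to_poly_inject vanish_below_def by (metis coord_cong)
qed

section \<open>Commutators with the whole group\<close>

declare coord.simps [simp del]

text \<open>The group \<open>N\<^sub>m\<^sub>+\<^sub>2 \<alpha>\<^sup>-\<^sup>1(V\<^sub>m\<^sub>+\<^sub>1\<^sup>r) \<beta>\<^sup>-\<^sup>1(V\<^sub>m\<^sup>r)\<close>. The index is shifted by one,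
  because the groups \<open>N\<^sub>m\<close> start at \<open>m = 1\<close>.\<close>

definition filtration :: "nat \<Rightarrow> nat \<Rightarrow> (word \<Rightarrow> word) set" where
  "filtration m r = {g \<in> N_grp (Suc m). vanish_below (Suc m) r (alpha g) \<and> vanish_below m r (beta g)}"

lemma coord_alpha_comp:
  assumes "g \<in> N_grp (Suc m)" "h \<in> N_grp (Suc m)"
  shows "coord (Suc m) s (alpha (g \<circ> h)) = coord (Suc m) s (alpha g) + coord (Suc m) s (alpha h)"
    and "coord m s (beta (g \<circ> h)) = coord m s (beta g) + coord m s (beta h)"
  unfolding coord_add[symmetric] by (rule coord_cong, rule alpha_comp[OF assms], assumption)+

lemma coord_alpha_iv:
  assumes "g \<in> N_grp (Suc m)"
  shows "coord (Suc m) s (alpha (iv g)) = coord (Suc m) s (alpha g)"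
    and "coord m s (beta (iv g)) = coord m s (beta g)"
  by (rule coord_cong, rule alpha_iv[OF assms], assumption)+

lemma coord_alpha_conj:
  assumes "g \<in> N_grp (Suc m)" "h \<in> GG"
  shows "coord (Suc m) s (alpha (h \<circ> g \<circ> iv h)) = coord (Suc m) s (\<lambda>\<sigma>. alpha g (iv h \<sigma>))"
    and "coord m s (beta (h \<circ> g \<circ> iv h)) = coord m s (\<lambda>\<sigma>. beta g (iv h \<sigma>))"
  by (rule coord_cong, rule alpha_conj[OF assms], assumption)+

lemma coord_alpha_commutator:
  assumes g: "g \<in> N_grp (Suc m)" and h: "h \<in> GG"
  shows "coord (Suc m) s (alpha (comm g h)) = coord (Suc m) s (\<lambda>\<sigma>. alpha g \<sigma> + alpha g (iv h \<sigma>))"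
    and "coord m s (beta (comm g h)) = coord m s (\<lambda>\<sigma>. beta g \<sigma> + beta g (iv h \<sigma>))"
    and "comm g h \<in> N_grp (Suc m)"
proof -
  note ND = Grig_normalD[OF N_normal[of "Suc m"], simplified]
  have ig: "iv g \<in> N_grp (Suc m)" and c: "h \<circ> iv g \<circ> iv h \<in> N_grp (Suc m)"
    using ND(5)[OF g] ND(6)[OF h] by auto
  have eq: "comm g h = g \<circ> (h \<circ> iv g \<circ> iv h)" by (simp add: comp_assoc)
  show "comm g h \<in> N_grp (Suc m)" unfolding eq by (rule ND(4)[OF g c])
  have "alpha (h \<circ> iv g \<circ> iv h) \<sigma> = alpha g (iv h \<sigma>)" if "length \<sigma> = Suc m" for \<sigma>
    using alpha_conj(1)[OF ig h that] alpha_iv(1)[OF g, of "iv h \<sigma>"] that h by simp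
  then have "coord (Suc m) s (alpha (h \<circ> iv g \<circ> iv h)) = coord (Suc m) s (\<lambda>\<sigma>. alpha g (iv h \<sigma>))"
    by (rule coord_cong)
  then show "coord (Suc m) s (alpha (comm g h)) = coord (Suc m) s (\<lambda>\<sigma>. alpha g \<sigma> + alpha g (iv h \<sigma>))"
    unfolding eq coord_alpha_comp[OF g c] coord_add by simp
  have "beta (h \<circ> iv g \<circ> iv h) \<sigma> = beta g (iv h \<sigma>)" if "length \<sigma> = m" for \<sigma>
    using alpha_conj(2)[OF ig h that] alpha_iv(2)[OF g, of "iv h \<sigma>"] that h by simp
  then have "coord m s (beta (h \<circ> iv g \<circ> iv h)) = coord m s (\<lambda>\<sigma>. beta g (iv h \<sigma>))"
    by (rule coord_cong)
  then show "coord m s (beta (comm g h)) = coord m s (\<lambda>\<sigma>. beta g \<sigma> + beta g (iv h \<sigma>))"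
    unfolding eq coord_alpha_comp[OF g c] coord_add by simp
qed

lemma filtration_normal: "filtration m r \<lhd> Grig"
proof -
  note ND = Grig_normalD[OF N_normal[of "Suc m"], simplified]
  have "subgroup (filtration m r) Grig"
  proof (rule Grig_subgroupI)
    show "filtration m r \<subseteq> GG" using ND(2) by (auto simp: filtration_def)
    have "alpha id = (\<lambda>_. 0)" "beta id = (\<lambda>_. 0)" by (simp_all add: fun_eq_iff alpha_def beta_def)
    then have "vanish_below n r (alpha id)" "vanish_below n r (beta id)" for n
      by (simp_all add: vanish_below_def coord_zero)
    then show "id \<in> filtration m r" using ND(3) by (simp add: filtration_def)
    show "g \<circ> h \<in> filtration m r" if "g \<in> filtration m r" "h \<in> filtration m r" for g h
      using that ND(4) by (simp add: filtration_def vanish_below_def coord_alpha_comp)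
    show "iv g \<in> filtration m r" if "g \<in> filtration m r" for g
      using that ND(5) by (simp add: filtration_def vanish_below_def coord_alpha_iv)
  qed
  then show ?thesis
  proof (rule Grig_normalI)
    fix h g assume h: "h \<in> GG" and g: "g \<in> filtration m r"
    have "coord (Suc m) s (alpha (h \<circ> g \<circ> iv h)) = 0 \<and> coord m s (beta (h \<circ> g \<circ> iv h)) = 0" if "s < r" for s
    proof -
      have gN: "g \<in> N_grp (Suc m)" using g by (simp add: filtration_def)
      have "vanish_below (Suc m) s (alpha g)" "vanish_below m s (beta g)"
        using g that unfolding filtration_def by (auto intro: vanish_below_mono)
      then show ?thesis
        using vanish_below_act[of "iv h"] h g that unfolding coord_alpha_conj[OF gN h]
        by (simp add: filtration_def vanish_below_def)
    qed
    then show "h \<circ> g \<circ> iv h \<in> filtration m r"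
      using g ND(6)[OF h] by (simp add: filtration_def vanish_below_def)
  qed
qed

lemma filtration_antimono: "r \<le> s \<Longrightarrow> filtration m s \<subseteq> filtration m r"
  unfolding filtration_def using vanish_below_mono by blast

lemma filtration_0: "filtration m 0 = N_grp (Suc m)"
  by (simp add: filtration_def vanish_below_def)

lemma vanish_below_all: 
  assumes "vanish_below n (2 ^ n) f" "length \<sigma> = n" shows "f \<sigma> = 0"
  using coord_expand[OF assms(2), of f] assms(1) by (simp add: vanish_below_def)

lemma filtration_top: "filtration m (2 ^ Suc m) = N_grp (Suc (Suc m))"
proof (intro equalityI subsetI)
  fix g assume g: "g \<in> filtration m (2 ^ Suc m)"
  then have "vanish_below (Suc m) (2 ^ Suc m) (alpha g)" "vanish_below m (2 ^ m) (beta g)"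
    unfolding filtration_def by (auto intro: vanish_below_mono)
  then show "g \<in> N_grp (Suc (Suc m))"
    using g vanish_below_all[of "Suc m" "alpha g"] vanish_below_all[of m "beta g"]
    by (intro alpha_beta_zero_imp_N) (auto simp: filtration_def)
next
  fix g assume g: "g \<in> N_grp (Suc (Suc m))"
  have "coord (Suc m) s (alpha g) = coord (Suc m) s (\<lambda>_. 0)" "coord m s (beta g) = coord m s (\<lambda>_. 0)" for s
    using N_imp_alpha_beta_zero[OF g] by (intro coord_cong; simp)+
  then show "g \<in> filtration m (2 ^ Suc m)"
    using g N_Suc_subset[of "Suc m"] by (auto simp: filtration_def vanish_below_def coord_zero)
qed

text \<open>In coordinates, \<open>[g, h] = g \<cdot> hg\<^sup>-\<^sup>1h\<^sup>-\<^sup>1\<close> becomes \<open>(1 - h) g\<close>, and \<open>1 - h\<close> maps \<open>V\<^sup>r\<close> into \<open>V\<^sup>r\<^sup>+\<^sup>1\<close>.\<close>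

lemma filtration_commutator:
  assumes g: "g \<in> filtration m r" and h: "h \<in> GG"
  shows "comm g h \<in> filtration m (Suc r)"
proof -
  have gN: "g \<in> N_grp (Suc m)" using g by (simp add: filtration_def)
  have "vanish_below (Suc m) (Suc r) (\<lambda>\<sigma>. alpha g \<sigma> + alpha g (iv h \<sigma>))"
    "vanish_below m (Suc r) (\<lambda>\<sigma>. beta g \<sigma> + beta g (iv h \<sigma>))"
    using g h by (auto simp: filtration_def intro: vanish_below_diff)
  then show ?thesis
    using coord_alpha_commutator[OF gN h] by (simp add: filtration_def vanish_below_def)
qed

fun diag_x :: "nat \<Rightarrow> word \<Rightarrow> word" where
  "diag_x 0 = x_elt"
| "diag_x (Suc m) = pair (diag_x m) (diag_x m)"

declare diag_x.simps(2) [simp del]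

lemma diag_x_in_N: "diag_x (Suc m) \<in> N_grp (Suc m)"
proof (induction m)
  case 0
  then show ?case using N1_incl(1) x_in_K by (auto simp: subset_iff diag_x.simps)
next
  case (Suc m)
  then show ?case by (simp add: N_grp_Suc diag_x.simps(2)[of "Suc m"])
qed

lemma diag_x_Grig: "diag_x m \<in> GG"
  using diag_x_in_N N_subset_Grig by (cases m) auto

lemma alpha_diag_x: "length \<sigma> = m \<Longrightarrow> alpha (diag_x m) \<sigma> = 1"
proof (induction m arbitrary: \<sigma>)
  case 0
  then show ?case by (simp add: alpha_def x_pair parity_comp)
next
  case (Suc m)
  then show ?case by (cases \<sigma>) (simp_all add: diag_x.simps)
qed

lemma beta_diag_x: "length \<tau> = m \<Longrightarrow> beta (diag_x (Suc m)) \<tau> = 0"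
proof (induction m arbitrary: \<tau>)
  case 0
  then show ?case by (simp add: beta_def x_pair parity_comp numeral_2_eq_2 diag_x.simps)
next
  case (Suc m)
  then show ?case by (cases \<tau>) (simp_all add: diag_x.simps(2)[of "Suc m"])
qed

lemma vanish_below_one: "vanish_below n (2 ^ n - 1) (\<lambda>_. 1)"
proof -
  have "coord n s (\<lambda>_. 1) = 0" if "Suc s < 2 ^ n" for s
    using that
  proof (induction n arbitrary: s)
    case (Suc n)
    show ?case
    proof (cases "even s")
      case False
      then have "Suc (s div 2) < 2 ^ n" using Suc.prems by (auto elim!: oddE)
      then show ?thesis using Suc.IH False by (simp add: coord.simps)
    qed (simp add: coord.simps)
  qed simp
  then show ?thesis by (simp add: vanish_below_def)
qed

text \<open>The coordinates \<open>\<alpha>\<close> of the diagonal element are all 1, which is the vector \<open>v\<^sup>r\<close> for the last index \<open>r\<close>.\<close>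

lemma diag_x_filtration: "diag_x (Suc m) \<in> filtration m (2 ^ Suc m - 1)"
proof -
  have "coord (Suc m) s (alpha (diag_x (Suc m))) = coord (Suc m) s (\<lambda>_. 1)" for s
    by (intro coord_cong) (rule alpha_diag_x)
  moreover have "coord m s (beta (diag_x (Suc m))) = coord m s (\<lambda>_. 0)" for s
    by (intro coord_cong) (rule beta_diag_x)
  ultimately show ?thesis
    using diag_x_in_N vanish_below_one[of "Suc m"] by (simp add: filtration_def vanish_below_def coord_zero)
qed

lemma pair_commutator:
  "p \<in> GG \<Longrightarrow> q \<in> GG \<Longrightarrow> u \<in> GG \<Longrightarrow> v \<in> GG \<Longrightarrow>
   pair u v \<circ> pair p q \<circ> iv (pair u v) \<circ> iv (pair p q) = pair (comm u p) (comm v q)"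
  by (simp add: iv_pair pair_comp)

text \<open>On the first level, \<open>[(x, x), d] = (1, x\<^sup>2)\<close> and \<open>[(x, x), c] = (x\<^sup>2, (1, x))\<close>. Any of \<open>b, c, d\<close> is the second
  component of one of \<open>b, c, d\<close>, and the first component, \<open>1\<close> or \<open>a\<close>, commutes with a diagonal element of positive
  level; so both commutators are passed on to the next level, placed below the rightmost vertex.\<close>

lemma diag_x_commutators:
  "\<exists>g\<in>{grig_b, grig_c, grig_d}. diag_x (Suc m) \<circ> g \<circ> iv (diag_x (Suc m)) \<circ> iv g = 
     at_vertex (replicate m True) (pair id x2_elt)"
  "\<exists>g\<in>{grig_b, grig_c, grig_d}. diag_x (Suc m) \<circ> g \<circ> iv (diag_x (Suc m)) \<circ> iv g = 
     at_vertex (replicate m True) (pair x2_elt (pair id x_elt))"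
proof -
  let ?comm = "\<lambda>u g. comm u g"
  have gens: "grig_b = pair grig_a grig_c" "grig_c = pair grig_a grig_d" "grig_d = pair id grig_b"
    by (fact gens_pair)+
  have ia: "?comm (diag_x (Suc m)) grig_a = id" for m
    using a_pair_a[of "iv (diag_x m)" "iv (diag_x m)"]
    by (simp add: iv_gens comp_assoc diag_x.simps) (simp add: iv_pair diag_x_Grig pair_comp pair_id flip: comp_assoc)
  \<comment> \<open>passing from level \<open>m + 1\<close> to level \<open>m + 2\<close>\<close>
  have step: "\<exists>g'\<in>{grig_b, grig_c, grig_d}. ?comm (diag_x (Suc (Suc m))) g' = pair id E"
    if "g \<in> {grig_b, grig_c, grig_d}" "?comm (diag_x (Suc m)) g = E" for m g E
  proof -
    have gG: "g \<in> GG" using that by auto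
    have "\<exists>p\<in>{id, grig_a}. pair p g \<in> {grig_b, grig_c, grig_d}"
      using that(1) by (auto simp: gens[symmetric])
    then obtain g' p where g': "g' \<in> {grig_b, grig_c, grig_d}" "g' = pair p g" "p \<in> {id, grig_a}"
      by blast
    have pG: "p \<in> GG" using g' by auto
    have "?comm (diag_x (Suc m)) p = id"
      using g'(3) ia by (auto simp: iv_eqI diag_x_Grig)
    then have "?comm (diag_x (Suc (Suc m))) g' = pair id E"
      unfolding g'(2) diag_x.simps(2)[of "Suc m"] using pair_commutator[OF pG gG diag_x_Grig diag_x_Grig] that(2)
      by metis
    then show ?thesis using g'(1) by blast
  qed
  have base: "?comm (diag_x (Suc 0)) grig_d = pair id x2_elt" "?comm (diag_x (Suc 0)) grig_c = pair x2_elt (pair id x_elt)"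
  proof -
    have "?comm (diag_x (Suc 0)) (pair id grig_b) = pair id x2_elt"
      using pair_commutator[of id grig_b x_elt x_elt] x_comm_gens by (simp add: iv_eqI iv_gens diag_x.simps)
    then show "?comm (diag_x (Suc 0)) grig_d = pair id x2_elt" by (simp only: gens_pair[symmetric])
    have "?comm (diag_x (Suc 0)) (pair grig_a grig_d) = pair x2_elt (pair id x_elt)"
      using pair_commutator[of grig_a grig_d x_elt x_elt] x_comm_gens by (simp add: iv_gens diag_x.simps)
    then show "?comm (diag_x (Suc 0)) grig_c = pair x2_elt (pair id x_elt)" by (simp only: gens_pair[symmetric])
  qed
  have "(\<exists>g\<in>{grig_b, grig_c, grig_d}. ?comm (diag_x (Suc m)) g = at_vertex (replicate m True) E)"
    if "\<exists>g\<in>{grig_b, grig_c, grig_d}. ?comm (diag_x (Suc 0)) g = E" for E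
  proof (induction m)
    case 0
    show ?case using that by (simp del: o_apply)
  next
    case (Suc m)
    then obtain g where "g \<in> {grig_b, grig_c, grig_d}" "?comm (diag_x (Suc m)) g = at_vertex (replicate m True) E" by blast
    from step[OF this] show ?case by (simp add: at_vertex_Cons del: o_apply id_apply)
  qed
  then show "\<exists>g\<in>{grig_b, grig_c, grig_d}. ?comm (diag_x (Suc m)) g = at_vertex (replicate m True) (pair id x2_elt)"
    "\<exists>g\<in>{grig_b, grig_c, grig_d}. ?comm (diag_x (Suc m)) g = at_vertex (replicate m True) (pair x2_elt (pair id x_elt))"
    using base by blast+
qed

text \<open>The first of the two commutators is \<open>x\<^sup>2\<close> at a single vertex, so all its translates are available, and they
  cancel the factor \<open>x\<^sup>2\<close> of the second one. The remaining factor is \<open>x\<close> at a single vertex.\<close>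

lemma N_subset_diag_commutators:
  assumes C: "C \<lhd> Grig" and comm: "\<And>g. g \<in> GG \<Longrightarrow> diag_x (Suc m) \<circ> g \<circ> iv (diag_x (Suc m)) \<circ> iv g \<in> C"
  shows "N_grp (Suc (Suc m)) \<subseteq> C"
proof -
  note CD = Grig_normalD[OF C]
  let ?t = "replicate m True"
  have E: "at_vertex ?t (pair id x2_elt) \<in> C" "at_vertex ?t (pair x2_elt (pair id x_elt)) \<in> C"
    using diag_x_commutators(1)[of m] diag_x_commutators(2)[of m] comm gens_Grig
    by (metis empty_iff insert_iff)+
  have 1: "at_vertex (?t @ [True]) x2_elt \<in> C"
    using E(1) by (simp add: at_vertex_append at_vertex_Cons)
  \<comment> \<open>an element moving the vertex of \<open>x\<^sup>2\<close> to its sibling, with trivial section\<close>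
  obtain g where g: "g \<in> GG" "g (?t @ [True]) = ?t @ [False]" "sec g (?t @ [True]) = id"
    using level_transitive[of "?t @ [True]" "?t @ [False]" id] by auto
  have "g \<circ> at_vertex (?t @ [True]) x2_elt \<circ> iv g \<in> C"
    by (rule CD(6)[OF g(1) 1])
  then have 2: "at_vertex (?t @ [False]) x2_elt \<in> C"
    using g by (simp add: at_vertex_conj iv_eqI)
  have "at_vertex (?t @ [False]) x2_elt \<circ> at_vertex (?t @ [True, True]) x_elt = at_vertex ?t (pair x2_elt (pair id x_elt))"
    by (simp add: at_vertex_append at_vertex_Cons at_vertex_comp pair_comp)
  then have eq: "at_vertex (?t @ [True, True]) x_elt = 
      iv (at_vertex (?t @ [False]) x2_elt) \<circ> at_vertex ?t (pair x2_elt (pair id x_elt))"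
    using 2 CD(2) by (metis iv_left2 subsetD)
  have "at_vertex (?t @ [True, True]) x_elt \<in> C"
    unfolding eq by (rule CD(4)[OF CD(5)[OF 2] E(2)])
  then show ?thesis using 1 by (intro N_subset_normal[OF C]) auto
qed

text \<open>Commutators reach any prescribed leading coordinates \<open>(i, j)\<close> of the next layer independently:
  elements with only \<open>\<alpha>\<close>-coordinates and elements with only \<open>\<beta>\<close>-coordinates are treated separately, each with its own
  generator from \<open>uniserial\<close>. The \<open>\<beta>\<close>-part of the layer is zero once \<open>s \<ge> 2\<^sup>m\<close>.\<close>

lemma filtration_step_element:
  assumes s: "s < 2 ^ Suc m" and C: "C \<lhd> Grig" 
    and comm: "\<And>u g. u \<in> filtration m (s - 1) \<Longrightarrow> g \<in> GG \<Longrightarrow> comm u g \<in> C" and "s \<ge> 1"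
    and j: "s \<ge> 2 ^ m \<Longrightarrow> j = 0"
  shows "\<exists>A\<in>C. A \<in> filtration m s \<and> coord (Suc m) s (alpha A) = i \<and> coord m s (beta A) = j"
proof -
  note CD = Grig_normalD[OF C]
  have comm_elt: "\<exists>A\<in>C. A \<in> filtration m s \<and> coord (Suc m) s (alpha A) = coord (Suc m) s (\<lambda>\<sigma>. f \<sigma> + f (g \<sigma>)) \<and>
      coord m s (beta A) = coord m s (\<lambda>\<sigma>. f' \<sigma> + f' (g \<sigma>))" 
    if "vanish_below (Suc m) (s - 1) f" "vanish_below m (s - 1) f'" "g \<in> {grig_a, grig_b, grig_c, grig_d}" for f f' g
  proof -
    obtain u where "u \<in> basis_grp (Suc m)" "\<And>\<sigma>. length \<sigma> = Suc m \<Longrightarrow> alpha u \<sigma> = f \<sigma>" 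
      "\<And>\<tau>. length \<tau> = m \<Longrightarrow> beta u \<tau> = f' \<tau>" using basis_surjective[of m f f'] by blast
    then have u: "u \<in> N_grp (Suc m)" "\<And>\<sigma>. length \<sigma> = Suc m \<Longrightarrow> alpha u \<sigma> = f \<sigma>" 
      "\<And>\<tau>. length \<tau> = m \<Longrightarrow> beta u \<tau> = f' \<tau>" using basis_subset_N by auto
    have gG: "g \<in> GG" and ig: "iv g = g" using that iv_gens by auto
    have "coord (Suc m) t (alpha u) = coord (Suc m) t f" "coord m t (beta u) = coord m t f'" for t
      using u by (auto intro!: coord_cong)
    then have uf: "u \<in> filtration m (s - 1)"
      using u(1) that by (simp add: filtration_def vanish_below_def)
    let ?A = "comm u g"
    have "?A \<in> C" using comm[OF uf gG] .
    moreover have "?A \<in> filtration m s" using filtration_commutator[OF uf gG] \<open>s \<ge> 1\<close> by simp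
    moreover have "coord (Suc m) s (alpha ?A) = coord (Suc m) s (\<lambda>\<sigma>. f \<sigma> + f (g \<sigma>))"
      unfolding coord_alpha_commutator(1)[OF u(1) gG] using u gG by (intro coord_cong) (simp add: ig)
    moreover have "coord m s (beta ?A) = coord m s (\<lambda>\<sigma>. f' \<sigma> + f' (g \<sigma>))"
      unfolding coord_alpha_commutator(2)[OF u(1) gG] using u gG by (intro coord_cong) (simp add: ig)
    ultimately show ?thesis by blast
  qed
  have van0: "vanish_below n r (\<lambda>_. 0)" for n r by (simp add: vanish_below_def coord_zero)
  have v_fun_van: "vanish_below n (s - 1) (v_fun (s - 1))" "coord n (s - 1) (v_fun (s - 1)) = 1" if "s - 1 < 2 ^ n" for n
    using that by (auto simp: vanish_below_def coord_v_fun)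
  have A: "\<exists>A\<in>C. A \<in> filtration m s \<and> coord (Suc m) s (alpha A) = i \<and> coord m s (beta A) = 0" for i
  proof (cases "i = 0")
    case True
    show ?thesis using comm_elt[OF van0 van0, of grig_a] True by (simp add: coord_zero)
  next
    case False
    obtain g where g: "g \<in> {grig_a, grig_b, grig_c, grig_d}" 
      "\<And>f. vanish_below (Suc m) (s - 1) f \<Longrightarrow> coord (Suc m) (Suc (s - 1)) (\<lambda>\<sigma>. f \<sigma> + f (g \<sigma>)) = coord (Suc m) (s - 1) f"
      using uniserial[of "s - 1" "Suc m"] s \<open>s \<ge> 1\<close> by auto
    have "s - 1 < 2 ^ Suc m" using s by simp
    note cv = v_fun_van[OF this]
    have "coord (Suc m) s (\<lambda>\<sigma>. v_fun (s - 1) \<sigma> + v_fun (s - 1) (g \<sigma>)) = 1"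
      using g(2)[OF cv(1)] cv(2) \<open>s \<ge> 1\<close> by (simp)
    then show ?thesis using comm_elt[OF cv(1) van0 g(1)] False by (simp add: coord_zero)
  qed
  show ?thesis
  proof (cases "j = 0")
    case True
    then show ?thesis using A by simp
  next
    case False
    then have sm: "s < 2 ^ m" using j by force
    obtain g where g: "g \<in> {grig_a, grig_b, grig_c, grig_d}" 
      "\<And>f. vanish_below m (s - 1) f \<Longrightarrow> coord m (Suc (s - 1)) (\<lambda>\<sigma>. f \<sigma> + f (g \<sigma>)) = coord m (s - 1) f"
      using uniserial[of "s - 1" m] sm \<open>s \<ge> 1\<close> by auto
    have "s - 1 < 2 ^ m" using sm by simp
    note cv = v_fun_van[OF this]
    have "coord m s (\<lambda>\<sigma>. v_fun (s - 1) \<sigma> + v_fun (s - 1) (g \<sigma>)) = 1"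
      using g(2)[OF cv(1)] cv(2) \<open>s \<ge> 1\<close> by simp
    then obtain B where B: "B \<in> C" "B \<in> filtration m s" "coord (Suc m) s (alpha B) = 0" "coord m s (beta B) = 1"
      using comm_elt[OF van0 cv(1) g(1)] by (auto simp: coord_zero)
    obtain A where A: "A \<in> C" "A \<in> filtration m s" "coord (Suc m) s (alpha A) = i" "coord m s (beta A) = 0"
      using A by blast
    have N: "A \<in> N_grp (Suc m)" "B \<in> N_grp (Suc m)" using A B by (auto simp: filtration_def)
    have "A \<circ> B \<in> C" "A \<circ> B \<in> filtration m s" using CD(4) Grig_normalD(4)[OF filtration_normal] A B by auto
    then show ?thesis using coord_alpha_comp[OF N, of s] A B False
      by (intro bexI[of _ "A \<circ> B"]) (simp_all del: o_apply)
  qed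
qed

text \<open>The last term of the filtration is reached by the diagonal element; from there the inclusion climbs layer by
  layer, an element being corrected by a commutator with the same leading coordinates.\<close>

lemma commutator_filtration:
  assumes r: "r < 2 ^ Suc m"
  shows "commutator_subgroup Grig (filtration m r) GG = filtration m (Suc r)"
proof
  note FD = Grig_normalD[OF filtration_normal]
  show "commutator_subgroup Grig (filtration m r) GG \<subseteq> filtration m (Suc r)"
    using filtration_commutator by (intro commutator_subgroup_least FD(1,2))
  let ?C = "commutator_subgroup Grig (filtration m r) GG"
  have C: "?C \<lhd> Grig" by (rule commutator_subgroup_normal[OF filtration_normal])
  note CD = Grig_normalD[OF C]
  have inC: "comm u g \<in> ?C" if "u \<in> filtration m r" "g \<in> GG" for u g
    using that FD(2) by (intro commutator_subgroup_incl)
  have "diag_x (Suc m) \<in> filtration m r"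
    using diag_x_filtration filtration_antimono[of r "2 ^ Suc m - 1" m] r by (metis Suc_leI diff_Suc_1 diff_le_mono subsetD)
  \<comment> \<open>the bottom of the filtration, where the downward induction starts\<close>
  then have top: "filtration m (2 ^ Suc m) \<subseteq> ?C"
    unfolding filtration_top using inC by (intro N_subset_diag_commutators C)
  have "Suc r \<le> 2 ^ Suc m" using r by simp
  then show "filtration m (Suc r) \<subseteq> ?C"
  proof (induction rule: inc_induct)
    case base
    show ?case by (rule top)
  next
    case (step s)
    show ?case
    proof
      fix h assume h: "h \<in> filtration m s"
      have "coord m s (beta h) = 0" if "s \<ge> 2 ^ m" using that by (rule coord_ge)
      moreover have "filtration m (s - 1) \<subseteq> filtration m r" using step by (intro filtration_antimono) auto
      ultimately obtain A where A: "A \<in> ?C" "A \<in> filtration m s" "coord (Suc m) s (alpha A) = coord (Suc m) s (alpha h)"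
        "coord m s (beta A) = coord m s (beta h)"
        using filtration_step_element[of s m ?C "coord m s (beta h)" "coord (Suc m) s (alpha h)"] C inC step by auto
      have N: "A \<in> N_grp (Suc m)" "h \<in> N_grp (Suc m)" using A h by (auto simp: filtration_def)
      have "A \<circ> h \<in> filtration m s" using Grig_normalD(4)[OF filtration_normal] A h by auto
      then have "A \<circ> h \<in> filtration m (Suc s)"
        using coord_alpha_comp[OF N, of s] A by (simp add: filtration_def vanish_below_Suc)
      then have "A \<circ> h \<in> ?C" using step.IH by blast
      then have "iv A \<circ> (A \<circ> h) \<in> ?C"
        using CD(4)[OF CD(5)[OF A(1)]] by blast
      moreover have "A \<in> GG" using A(1) CD(2) by blast
      ultimately show "h \<in> ?C" by simp
    qed
  qed
qed

section \<open>The lower central series\<close>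

text \<open>The commutator \<open>[a, d]\<close>, which together with \<open>K\<close> generates \<open>\<gamma>\<^sub>2\<close>.\<close>

definition z_elt :: "word \<Rightarrow> word" where "z_elt = pair grig_b grig_b"

lemma z_eq: "z_elt = grig_a \<circ> grig_d \<circ> grig_a \<circ> grig_d"
proof -
  have "grig_a \<circ> pair id grig_b \<circ> grig_a \<circ> pair id grig_b = z_elt"
    by (simp add: a_pair_a pair_comp z_elt_def)
  then show ?thesis by (simp only: gens_pair[symmetric])
qed

lemma z_Grig [simp]: "z_elt \<in> GG" by (simp add: z_eq)

lemma z_square: "z_elt \<circ> z_elt = id" by (simp add: z_elt_def pair_comp gens_square pair_id)

lemma iv_z: "iv z_elt = z_elt" by (rule iv_eqI) (rule z_square)+

lemma z_central: "z_elt \<in> central_mod (N_grp (Suc 0))"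
proof (rule central_modI[OF N1_normal z_Grig])
  note ND = Grig_normalD[OF N1_normal]
  fix s assume "s \<in> {grig_a, grig_b, grig_d}"
  moreover have "z_elt \<circ> grig_a \<circ> iv z_elt \<circ> grig_a = id"
  proof -
    have "z_elt \<circ> (grig_a \<circ> z_elt \<circ> grig_a) = id"
      unfolding z_elt_def a_pair_a using z_square by (simp add: z_elt_def)
    then show ?thesis by (simp add: iv_z comp_assoc)
  qed
  moreover have "z_elt \<circ> grig_d \<circ> iv z_elt \<circ> grig_d = id"
  proof -
    have "z_elt \<circ> pair id grig_b \<circ> z_elt \<circ> pair id grig_b = id"
      by (simp add: z_elt_def pair_comp word_simps pair_id)
    then show ?thesis by (simp only: gens_pair[symmetric] iv_z)
  qed
  moreover have "z_elt \<circ> grig_b \<circ> iv z_elt \<circ> grig_b \<in> N_grp (Suc 0)"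
  proof -
    have "z_elt \<circ> pair grig_a grig_c \<circ> z_elt \<circ> pair grig_a grig_c = pair (iv x_elt) id"
      by (simp add: z_elt_def pair_comp word_simps iv_x)
    moreover have "pair (iv x_elt) id \<in> N_grp (Suc 0)"
      using N1_incl(1) KD(3,5) x_in_K by (auto simp: subset_iff)
    ultimately show ?thesis by (simp only: gens_pair[symmetric] iv_z)
  qed
  ultimately show "z_elt \<circ> s \<circ> iv z_elt \<circ> s \<in> N_grp (Suc 0)" using ND(3) by auto
qed

text \<open>The group is commutative modulo \<open>K \<union> zK\<close> because the commutators of \<open>a, b, d\<close> are \<open>x\<close>, \<open>z\<close>, their inverses and 1.
  Both \<open>x\<close> and \<open>z\<close> are central modulo \<open>N\<^sub>1\<close>, so \<open>\<gamma>\<^sub>3 \<le> N\<^sub>1\<close>; and \<open>\<gamma>\<^sub>3\<close> contains the normal generators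
  \<open>[x, d] = (1, x)\<close> and \<open>[x, a] = x\<^sup>2\<close> of \<open>N\<^sub>1\<close>.\<close>

lemma lower_central_2: "lower_central Grig 2 = {g \<in> GG. g \<in> K_grp \<or> z_elt \<circ> g \<in> K_grp}" (is "_ = ?M")
  and lower_central_3: "lower_central Grig 3 = N_grp (Suc 0)"
proof -
  let ?D = "commutator_subgroup Grig GG GG"
  have D: "?D \<lhd> Grig" by (rule commutator_subgroup_normal[OF Grig.normal_self])
  note DD = Grig_normalD[OF D]
  have inD: "comm g h \<in> ?D" if "g \<in> GG" "h \<in> GG" for g h
    using that by (intro commutator_subgroup_incl) auto
  have xD: "x_elt \<in> ?D" using inD[of grig_a grig_b] by (simp add: x_eq iv_gens)
  have zD: "z_elt \<in> ?D" using inD[of grig_a grig_d] by (simp add: z_eq iv_gens)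
  have M: "?M \<lhd> Grig"
  proof (rule adjoin_normal[OF K_normal])
    show "z_elt \<in> central_mod K_grp" using z_central N1_incl(3) by (auto simp: central_mod_def)
    show "z_elt \<circ> z_elt \<in> K_grp" using KD(3) by (simp add: z_square)
  qed
  note MD = Grig_normalD[OF M]
  have xM: "x_elt \<in> ?M" using x_in_K by simp
  have zM: "z_elt \<in> ?M" using KD(3) by (simp add: z_square)
  have ivM: "iv x_elt \<in> ?M" using xM by (rule MD(5))
  note cD = Grig_normalD[OF central_mod_normal(1)[OF M]]
  have abd: "grig_a \<in> central_mod ?M" "grig_b \<in> central_mod ?M" "grig_d \<in> central_mod ?M"
  proof -
    show "grig_a \<in> central_mod ?M"
    proof (rule central_modI[OF M])
      show "grig_a \<circ> s \<circ> iv grig_a \<circ> s \<in> ?M" if s: "s \<in> {grig_a, grig_b, grig_d}" for s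
      proof -
        have "grig_a \<circ> s \<circ> iv grig_a \<circ> s \<in> {id, x_elt, z_elt}"
          using s by (auto simp: iv_gens x_eq z_eq word_simps)
        moreover have "{id, x_elt, z_elt} \<subseteq> ?M" using xM zM MD(3) by (simp only: insert_subset empty_subsetI)
        ultimately show ?thesis by (rule subsetD[rotated])
      qed
    qed simp_all
    show "grig_b \<in> central_mod ?M"
    proof (rule central_modI[OF M])
      show "grig_b \<circ> s \<circ> iv grig_b \<circ> s \<in> ?M" if s: "s \<in> {grig_a, grig_b, grig_d}" for s
      proof -
        have "grig_b \<circ> s \<circ> iv grig_b \<circ> s \<in> {id, iv x_elt}"
          using s by (auto simp: iv_gens iv_x word_simps)
        moreover have "{id, iv x_elt} \<subseteq> ?M" using ivM MD(3) by (simp only: insert_subset empty_subsetI)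
        ultimately show ?thesis by (rule subsetD[rotated])
      qed
    qed simp_all
    show "grig_d \<in> central_mod ?M"
    proof (rule central_modI[OF M])
      have zz: "grig_d \<circ> grig_a \<circ> grig_d \<circ> grig_a = z_elt"
        using iv_z unfolding z_eq by (simp add: iv_comp iv_gens comp_assoc)
      show "grig_d \<circ> s \<circ> iv grig_d \<circ> s \<in> ?M" if s: "s \<in> {grig_a, grig_b, grig_d}" for s
      proof -
        have "grig_d \<circ> s \<circ> iv grig_d \<circ> s \<in> {id, z_elt}"
          using s zz by (auto simp: iv_gens word_simps)
        moreover have "{id, z_elt} \<subseteq> ?M" using zM MD(3) by (simp only: insert_subset empty_subsetI)
        ultimately show ?thesis by (rule subsetD[rotated])
      qed
    qed simp_all
  qed
  then have "grig_b \<circ> grig_d \<in> central_mod ?M" by (intro cD(4))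
  then have "GG \<subseteq> central_mod ?M"
    using abd by (intro Grig_gens_subset_subgroup[OF cD(1)]) (simp add: klein_relations)
  then have "?D \<subseteq> ?M"
    by (intro commutator_subgroup_least MD(1)) (auto simp: central_mod_def)
  moreover have "?M \<subseteq> ?D"
  proof
    fix g assume g: "g \<in> ?M"
    have KDsub: "K_grp \<subseteq> ?D" by (rule K_least[OF D xD])
    show "g \<in> ?D"
    proof (cases "g \<in> K_grp")
      case False
      then have "z_elt \<circ> g \<in> ?D" using g KDsub by blast
      then have "iv z_elt \<circ> (z_elt \<circ> g) \<in> ?D" by (intro DD(4)[OF DD(5)[OF zD]])
      then show ?thesis by simp
    qed (use KDsub in auto)
  qed
  ultimately have eq: "?D = ?M" by blast
  then show "lower_central Grig 2 = ?M" by (simp add: numeral_2_eq_2)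
  have "lower_central Grig 3 = commutator_subgroup Grig ?M GG"
    using eq by (simp add: numeral_3_eq_3)
  also have "\<dots> = N_grp (Suc 0)"
  proof
    have "?M \<subseteq> central_mod (N_grp (Suc 0))"
    proof
      fix g assume g: "g \<in> ?M"
      note ZD = Grig_normalD[OF central_mod_normal(1)[OF N1_normal]]
      have KZ: "K_grp \<subseteq> central_mod (N_grp (Suc 0))"
        by (rule K_least[OF central_mod_normal(1)[OF N1_normal] x_central])
      show "g \<in> central_mod (N_grp (Suc 0))"
      proof (cases "g \<in> K_grp")
        case False
        then have "z_elt \<circ> g \<in> central_mod (N_grp (Suc 0))" using g KZ by blast
        then have "iv z_elt \<circ> (z_elt \<circ> g) \<in> central_mod (N_grp (Suc 0))"
          by (intro ZD(4)[OF ZD(5)[OF z_central]])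
        then show ?thesis by simp
      qed (use KZ in auto)
    qed
    then show "commutator_subgroup Grig ?M GG \<subseteq> N_grp (Suc 0)"
      by (intro commutator_subgroup_least MD(2) Grig_normalD(1)[OF N1_normal]) (auto simp: central_mod_def)
    let ?C = "commutator_subgroup Grig ?M GG"
    have inC: "comm x_elt g \<in> ?C" if "g \<in> GG" for g
      using that xM MD(2) by (intro commutator_subgroup_incl)
    show "N_grp (Suc 0) \<subseteq> ?C"
      using inC[of grig_d] inC[of grig_a] x_comm_gens
      by (intro N1_subset_normal commutator_subgroup_normal[OF M]) (simp_all add: iv_gens)
  qed
  finally show "lower_central Grig 3 = N_grp (Suc 0)" .
qed

lemma lower_central_filtration:
  assumes "lower_central Grig (2 ^ Suc m + 1) = N_grp (Suc m)" "r \<le> 2 ^ Suc m"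
  shows "lower_central Grig (2 ^ Suc m + 1 + r) = filtration m r"
  using assms(2)
proof (induction r)
  case 0
  then show ?case using assms(1) by (simp add: filtration_0)
next
  case (Suc r)
  have "lower_central Grig (2 ^ Suc m + 1 + Suc r) = commutator_subgroup Grig (lower_central Grig (2 ^ Suc m + 1 + r)) GG"
    by simp
  then show ?case using Suc commutator_filtration[of r m] by simp
qed

lemma lower_central_N: "lower_central Grig (2 ^ Suc m + 1) = N_grp (Suc m)"
proof (induction m)
  case 0
  then show ?case using lower_central_3 by (simp add: numeral_3_eq_3 numeral_2_eq_2)
next
  case (Suc m)
  have "lower_central Grig (2 ^ Suc m + 1 + 2 ^ Suc m) = filtration m (2 ^ Suc m)"
    by (rule lower_central_filtration[OF Suc.IH order_refl])
  moreover have "2 ^ Suc m + 1 + 2 ^ Suc m = 2 ^ Suc (Suc m) + (1 :: nat)" by simp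
  ultimately show ?case using filtration_top by metis
qed

section \<open>Ranks\<close>

declare parity.simps(1) [simp del]

lemma additive_group_simps [simp]:
  "carrier (additive_group A) = A" "x \<otimes>\<^bsub>additive_group A\<^esub> y = x + y" "\<one>\<^bsub>additive_group A\<^esub> = 0"
  by (simp_all add: additive_group_def)

lemma comm_group_additive_group:
  fixes A :: "'a :: comm_monoid_add set"
  assumes "0 \<in> A" "\<And>x y. x \<in> A \<Longrightarrow> y \<in> A \<Longrightarrow> x + y \<in> A" "\<And>x. x \<in> A \<Longrightarrow> x + x = 0"
  shows "comm_group (additive_group A)"
  by (rule comm_groupI) (use assms in \<open>auto simp: algebra_simps\<close>)

abbreviation F2 :: "bit monoid" where "F2 \<equiv> additive_group (UNIV :: bit set)"

abbreviation F2pow :: "nat \<Rightarrow> (nat \<Rightarrow> bit) monoid" where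
  "F2pow k \<equiv> product_group {..<k} (\<lambda>_. F2)"

lemma comm_group_F2pow: "comm_group (F2pow k)"
proof (rule group.group_comm_groupI)
  show "group (F2pow k)"
    by (intro product_group comm_group.axioms(2) comm_group_additive_group) auto
qed (auto simp: algebra_simps restrict_def fun_eq_iff)

lemma F2pow_square: "x \<in> carrier (F2pow k) \<Longrightarrow> x \<otimes>\<^bsub>F2pow k\<^esub> x = \<one>\<^bsub>F2pow k\<^esub>"
  by simp

text \<open>Tensoring with \<open>\<bbbF>\<^sub>2\<close> does not change an elementary abelian 2-group. The bilinear map \<open>(x, 1) \<mapsto> h x\<close>,
  \<open>(x, 0) \<mapsto> 1\<close> extends to the free abelian group on the pairs; modulo the relations every element is
  a single generator \<open>(x, 1)\<close>, so the kernel consists of relations only.\<close>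

lemma tensor_F2_elementary:
  assumes B: "comm_group B" and sq: "\<And>b. b \<in> carrier B \<Longrightarrow> b \<otimes>\<^bsub>B\<^esub> b = \<one>\<^bsub>B\<^esub>"
    and M: "group M" and h: "h \<in> iso M B"
  shows "tensor_group M F2 \<cong> B"
proof -
  interpret B: comm_group B by (rule B)
  interpret M: group M by (rule M)
  define S where "S = carrier M \<times> (UNIV :: bit set)"
  define F where "F = free_Abelian_group S"
  define R where "R = generate F (tensor_relations M F2)"
  interpret F: comm_group F unfolding F_def by (rule abelian_free_Abelian_group)
  have Fsimps [simp]: "u \<otimes>\<^bsub>F\<^esub> v = u + v" "\<one>\<^bsub>F\<^esub> = 0" "frag_of s \<in> carrier F \<longleftrightarrow> s \<in> S" for u v s
    by (simp_all add: F_def)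
  have inv [simp]: "inv\<^bsub>F\<^esub> u = - u" if "u \<in> carrier F" for u
    using that by (simp add: F_def)
  have diff [simp]: "u - v \<in> carrier F" if "u \<in> carrier F" "v \<in> carrier F" for u v
    using F.m_closed[of u "inv\<^bsub>F\<^esub> v"] that F.inv_closed[of v] by simp
  have hM: "h x \<in> carrier B" if "x \<in> carrier M" for x
    using h that by (auto simp: iso_def hom_def)
  have hmult: "h (x \<otimes>\<^bsub>M\<^esub> y) = h x \<otimes>\<^bsub>B\<^esub> h y" if "x \<in> carrier M" "y \<in> carrier M" for x y
    using h that by (auto simp: iso_def hom_def)
  define f where "f = (\<lambda>(x, c :: bit). if c = 1 then h x else \<one>\<^bsub>B\<^esub>)"
  have "f ` S \<subseteq> carrier B" using hM by (auto simp: S_def f_def)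
  from B.free_Abelian_group_universal[OF this]
  obtain \<psi> where \<psi>: "\<psi> \<in> hom F B" "\<And>s. s \<in> S \<Longrightarrow> \<psi> (frag_of s) = f s"
    unfolding F_def by blast
  interpret \<psi>: group_hom F B \<psi> by unfold_locales (rule \<psi>(1))
  have \<psi>_diff: "\<psi> (u - v) = \<psi> u \<otimes>\<^bsub>B\<^esub> inv\<^bsub>B\<^esub> \<psi> v" if "u \<in> carrier F" "v \<in> carrier F" for u v
    using \<psi>.hom_mult[of u "inv\<^bsub>F\<^esub> v"] \<psi>.hom_inv[of v] that F.inv_closed[of v] by simp
  have rel_carrier: "tensor_relations M F2 \<subseteq> carrier F"
    unfolding tensor_relations_def by (auto simp: S_def)
  have R_sub: "subgroup R F" unfolding R_def by (rule F.generate_is_subgroup[OF rel_carrier])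
  have R_add: "u + v \<in> R" if "u \<in> R" "v \<in> R" for u v
    using subgroup.m_closed[OF R_sub that] by simp
  have R_F: "u \<in> carrier F" if "u \<in> R" for u using subgroup.mem_carrier[OF R_sub that] .
  have R_minus: "- u \<in> R" if "u \<in> R" for u
    using subgroup.m_inv_closed[OF R_sub that] R_F[OF that] by simp
  have R_diff: "u - v \<in> R" if "u \<in> R" "v \<in> R" for u v
    using R_add[OF that(1) R_minus[OF that(2)]] by simp
  have R1: "frag_of (x \<otimes>\<^bsub>M\<^esub> y, c) - frag_of (x, c) - frag_of (y, c) \<in> R" if "x \<in> carrier M" "y \<in> carrier M" for x y c
    unfolding R_def by (rule generate.incl) (use that in \<open>auto simp: tensor_relations_def\<close>)
  have R2: "frag_of (x, c + d) - frag_of (x, c) - frag_of (x, d) \<in> R" if "x \<in> carrier M" for x c d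
    unfolding R_def by (rule generate.incl, unfold tensor_relations_def, rule UnI2, rule CollectI)
       (use that in \<open>auto intro!: exI\<close>)
  have kernel_R: "R \<subseteq> kernel F B \<psi>"
    unfolding R_def
  proof (rule F.generate_subgroup_incl[OF _ \<psi>.subgroup_kernel], rule subsetI)
    fix u assume u: "u \<in> tensor_relations M F2"
    then have uF: "u \<in> carrier F" using rel_carrier by auto
    have cancel: "p \<otimes>\<^bsub>B\<^esub> q \<otimes>\<^bsub>B\<^esub> inv\<^bsub>B\<^esub> p \<otimes>\<^bsub>B\<^esub> inv\<^bsub>B\<^esub> q = \<one>\<^bsub>B\<^esub>" if "p \<in> carrier B" "q \<in> carrier B" for p q
      using that by (metis B.inv_closed B.inv_mult B.m_assoc B.m_closed B.r_inv)
    have "\<psi> u = \<one>\<^bsub>B\<^esub>"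
      using u unfolding tensor_relations_def
    proof (elim UnE CollectE exE conjE)
      fix x y c
      assume u: "u = frag_of (x \<otimes>\<^bsub>M\<^esub> y, c) - frag_of (x, c) - frag_of (y, c)" and xy: "x \<in> carrier M" "y \<in> carrier M"
      have "\<psi> u = f (x \<otimes>\<^bsub>M\<^esub> y, c) \<otimes>\<^bsub>B\<^esub> inv\<^bsub>B\<^esub> f (x, c) \<otimes>\<^bsub>B\<^esub> inv\<^bsub>B\<^esub> f (y, c)"
        unfolding u using xy by (simp add: \<psi>_diff \<psi>(2) S_def)
      then show ?thesis using xy hM cancel by (simp add: f_def hmult)
    next
      fix x c d
      assume u: "u = frag_of (x, c \<otimes>\<^bsub>F2\<^esub> d) - frag_of (x, c) - frag_of (x, d)" and x: "x \<in> carrier M"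
      have "\<psi> u = f (x, c + d) \<otimes>\<^bsub>B\<^esub> inv\<^bsub>B\<^esub> f (x, c) \<otimes>\<^bsub>B\<^esub> inv\<^bsub>B\<^esub> f (x, d)"
        unfolding u using x by (simp add: \<psi>_diff \<psi>(2) S_def)
      moreover have "inv\<^bsub>B\<^esub> h x \<otimes>\<^bsub>B\<^esub> inv\<^bsub>B\<^esub> h x = \<one>\<^bsub>B\<^esub>" using hM[OF x] sq by simp
      ultimately show ?thesis using x hM by (cases c; cases d) (simp_all add: f_def)
    qed
    then show "u \<in> kernel F B \<psi>" using uF by (simp add: kernel_def)
  qed
  have zero_in: "0 \<in> R" using subgroup.one_closed[OF R_sub] by simp
  \<comment> \<open>the relation for \<open>0 + 0\<close> reads \<open>- (x, 0)\<close>, the one for \<open>1 + 1\<close> reads \<open>(x, 0) - 2 (x, 1)\<close>\<close>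
  have frag0: "frag_of (x, 0) \<in> R" if "x \<in> carrier M" for x
    using R_minus[OF R2[OF that, of 0 0]] by simp
  have frag2: "frag_of (x, 1) + frag_of (x, 1) \<in> R" if "x \<in> carrier M" for x
    using R_diff[OF frag0[OF that] R2[OF that, of 1 1]] by simp
  have frag1: "frag_of (\<one>\<^bsub>M\<^esub>, 1) \<in> R"
    using R_minus[OF R1[of "\<one>\<^bsub>M\<^esub>" "\<one>\<^bsub>M\<^esub>" 1]] by simp
  have repr: "\<exists>x\<in>carrier M. u - frag_of (x, 1) \<in> R" if "u \<in> carrier F" for u
  proof -
    have "Poly_Mapping.keys u \<subseteq> S" using that by (simp add: F_def)
    then show ?thesis
    proof (induction u rule: free_Abelian_group_induct[consumes 1])
      case 1
      show ?case using R_diff[OF zero_in frag1] by auto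
    next
      case (2 u v)
      then obtain x y where xy: "x \<in> carrier M" "y \<in> carrier M" "u - frag_of (x, 1) \<in> R" "v - frag_of (y, 1) \<in> R"
        by blast
      have "(u - frag_of (x, 1)) - (v - frag_of (y, 1)) - (frag_of (x \<otimes>\<^bsub>M\<^esub> y, 1) - frag_of (x, 1) - frag_of (y, 1))
          - (frag_of (y, 1) + frag_of (y, 1)) \<in> R"
        by (rule R_diff[OF R_diff[OF R_diff[OF xy(3,4)] R1[OF xy(1,2)]] frag2[OF xy(2)]])
      then have "(u - v) - frag_of (x \<otimes>\<^bsub>M\<^esub> y, 1) \<in> R" by (simp add: algebra_simps)
      then show ?case using xy by auto
    next
      case (3 s)
      then obtain x c where s: "s = (x, c)" "x \<in> carrier M" by (auto simp: S_def)
      show ?case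
      proof (cases c)
        case zero
        then show ?thesis using s R_diff[OF frag0[OF s(2)] frag1] by auto
      next
        case one
        then show ?thesis using s zero_in by (intro bexI[of _ x]) auto
      qed
    qed
  qed
  have "kernel F B \<psi> \<subseteq> R"
  proof
    fix u assume u: "u \<in> kernel F B \<psi>"
    then have uF: "u \<in> carrier F" "\<psi> u = \<one>\<^bsub>B\<^esub>" by (auto simp: kernel_def)
    obtain x where x: "x \<in> carrier M" "u - frag_of (x, 1) \<in> R" using repr uF by blast
    have "\<psi> (u - frag_of (x, 1)) = \<one>\<^bsub>B\<^esub>" using x kernel_R by (auto simp: kernel_def)
    then have "inv\<^bsub>B\<^esub> h x = \<one>\<^bsub>B\<^esub>"
      using x uF hM by (simp add: \<psi>_diff \<psi>(2) S_def f_def)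
    then have "h x = h \<one>\<^bsub>M\<^esub>"
      using hM[OF x(1)] h M.is_group by (metis B.inv_inv B.inv_one B.is_group hom_one iso_imp_homomorphism)
    then have "x = \<one>\<^bsub>M\<^esub>"
      using h x by (auto simp: iso_def bij_betw_def inj_on_def)
    then show "u \<in> R" using R_add[OF x(2)] frag1 by fastforce
  qed
  then have ker: "kernel F B \<psi> = R" using kernel_R by blast
  have "\<psi> ` carrier F = carrier B"
  proof
    show "\<psi> ` carrier F \<subseteq> carrier B" using \<psi>.hom_closed by auto
    show "carrier B \<subseteq> \<psi> ` carrier F"
    proof
      fix b assume "b \<in> carrier B"
      then obtain x where x: "x \<in> carrier M" "b = h x" using h by (auto simp: iso_def bij_betw_def)
      then have "b = \<psi> (frag_of (x, 1))" by (simp add: \<psi>(2) S_def f_def)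
      then show "b \<in> \<psi> ` carrier F" using x by (auto simp: S_def)
    qed
  qed
  then have "F Mod (kernel F B \<psi>) \<cong> B" by (rule \<psi>.FactGroup_iso)
  then have "F Mod R \<cong> B" by (simp only: ker)
  then show ?thesis
    unfolding tensor_group_def Let_def R_def F_def S_def by simp
qed

text \<open>The isomorphisms \<open>\<alpha> \<oplus> \<beta>\<close> are specified by their values on cosets; hence the second conclusion.\<close>

lemma quotient_iso:
  assumes S: "subgroup S Grig" and B: "group B" and cl: "\<And>g. g \<in> S \<Longrightarrow> f g \<in> carrier B"
    and hom: "\<And>g h. g \<in> S \<Longrightarrow> h \<in> S \<Longrightarrow> f (g \<circ> h) = f g \<otimes>\<^bsub>B\<^esub> f h"
    and ker: "\<And>g. g \<in> S \<Longrightarrow> f g = \<one>\<^bsub>B\<^esub> \<longleftrightarrow> g \<in> S'" and S': "S' \<subseteq> S"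
    and surj: "\<And>b. b \<in> carrier B \<Longrightarrow> \<exists>g\<in>S. f g = b"
  shows "(\<lambda>X. the_elem (f ` X)) \<in> iso (Grig\<lparr>carrier := S\<rparr> Mod S') B"
    and "g \<in> S \<Longrightarrow> the_elem (f ` (S' #>\<^bsub>Grig\<^esub> g)) = f g"
    and "group (Grig\<lparr>carrier := S\<rparr> Mod S')"
proof -
  let ?H = "Grig\<lparr>carrier := S\<rparr>"
  have SG: "S \<subseteq> GG" using Grig_subgroupD(1)[OF S] .
  interpret H: group ?H by (rule Grig.subgroup_imp_group[OF S])
  interpret B: group B by (rule B)
  interpret f: group_hom ?H B f
    by unfold_locales (use cl hom SG in \<open>auto simp: hom_def subset_iff\<close>)
  have k: "kernel ?H B f = S'" using ker S' by (auto simp: kernel_def)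
  have "f ` carrier ?H = carrier B" using cl surj by force
  then show "(\<lambda>X. the_elem (f ` X)) \<in> iso (?H Mod S') B"
    using f.FactGroup_iso_set by (simp add: k)
  show "group (?H Mod S')" using normal.factorgroup_is_group[OF f.normal_kernel] by (simp add: k)
  show "the_elem (f ` (S' #>\<^bsub>Grig\<^esub> g)) = f g" if g: "g \<in> S"
  proof -
    have "f ` (S' #>\<^bsub>Grig\<^esub> g) = {f g}"
    proof (intro equalityI subsetI)
      fix b assume "b \<in> f ` (S' #>\<^bsub>Grig\<^esub> g)"
      then obtain s where s: "s \<in> S'" "b = f (s \<otimes>\<^bsub>Grig\<^esub> g)" by (auto simp: r_coset_def)
      then have "s \<in> S" using S' by auto
      then have "b = f s \<otimes>\<^bsub>B\<^esub> f g" using s hom g SG by (auto simp: subset_iff)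
      then show "b \<in> {f g}" using s ker \<open>s \<in> S\<close> cl[OF g] by simp
    next
      fix b assume "b \<in> {f g}"
      have "id \<in> S'" using f.hom_one ker Grig_subgroupD(2)[OF S] by auto
      then have "g \<in> S' #>\<^bsub>Grig\<^esub> g" using g SG by (force simp: r_coset_def)
      then show "b \<in> f ` (S' #>\<^bsub>Grig\<^esub> g)" using \<open>b \<in> {f g}\<close> by auto
    qed
    then show ?thesis by simp
  qed
qed

text \<open>The coordinates identify the quotient with \<open>\<bbbF>\<^sub>2\<^sup>k\<close>, which tensoring with \<open>\<bbbF>\<^sub>2\<close> leaves unchanged.\<close>

lemma has_rank_quotient:
  fixes f :: "nat \<Rightarrow> (word \<Rightarrow> word) \<Rightarrow> bit"
  assumes S: "subgroup S Grig"
    and hom: "\<And>i g h. i < k \<Longrightarrow> g \<in> S \<Longrightarrow> h \<in> S \<Longrightarrow> f i (g \<circ> h) = f i g + f i h"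
    and ker: "\<And>g. g \<in> S \<Longrightarrow> (\<forall>i<k. f i g = 0) \<longleftrightarrow> g \<in> S'" and S': "S' \<subseteq> S"
    and surj: "\<And>t. \<exists>g\<in>S. \<forall>i<k. f i g = t i"
  shows "has_rank (Grig\<lparr>carrier := S\<rparr> Mod S') k"
proof -
  let ?f = "\<lambda>g. \<lambda>i\<in>{..<k}. f i g"
  have gr: "group (F2pow k)" using comm_group_F2pow by (rule comm_group.axioms(2))
  have hyps: "\<And>g. g \<in> S \<Longrightarrow> ?f g \<in> carrier (F2pow k)"
    "\<And>g h. g \<in> S \<Longrightarrow> h \<in> S \<Longrightarrow> ?f (g \<circ> h) = ?f g \<otimes>\<^bsub>F2pow k\<^esub> ?f h"
    "\<And>g. g \<in> S \<Longrightarrow> ?f g = \<one>\<^bsub>F2pow k\<^esub> \<longleftrightarrow> g \<in> S'"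
    using hom ker by (simp add: PiE_def extensional_def, auto simp: fun_eq_iff restrict_def)
  have onto: "\<exists>g\<in>S. ?f g = b" if "b \<in> carrier (F2pow k)" for b
  proof -
    obtain g where g: "g \<in> S" "\<forall>i<k. f i g = b i" using surj by blast
    have "?f g = b" using g(2) that by (auto simp: fun_eq_iff restrict_def PiE_def extensional_def)
    then show ?thesis using g by blast
  qed
  note q = quotient_iso[OF S gr, of ?f, OF hyps S' onto]
  show ?thesis
    unfolding has_rank_def
    by (rule tensor_F2_elementary[OF comm_group_F2pow F2pow_square q(3) q(1)])
qed

lemma lower_central_2_alt: "lower_central Grig 2 = commutator_subgroup Grig GG GG"
  by (simp add: numeral_2_eq_2)

text \<open>The commutator quotient is generated by \<open>a\<close>, \<open>b\<close>, \<open>d\<close>, on which the parities of the levels 0, 1, 2 take the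
  independent values \<open>(1, 0, 0)\<close>, \<open>(0, 1, 1)\<close> and \<open>(0, 0, 1)\<close>.\<close>

lemma abelianization_kernel:
  assumes g: "g \<in> GG" shows "(\<forall>i<3. parity i g = 0) \<longleftrightarrow> g \<in> lower_central Grig 2"
proof
  let ?D = "commutator_subgroup Grig GG GG"
  have D: "?D \<lhd> Grig" by (rule commutator_subgroup_normal[OF Grig.normal_self])
  note DD = Grig_normalD[OF D]
  have par0: "parity n u = 0" if "u \<in> ?D" for u n
  proof -
    have "subgroup {g \<in> GG. parity n g = 0} Grig"
      by (rule Grig_subgroupI) (auto simp: parity_comp parity_iv)
    then have "?D \<subseteq> {g \<in> GG. parity n g = 0}"
      by (rule commutator_subgroup_least) (auto simp: parity_commutator)
    then show ?thesis using that by blast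
  qed
  show "\<forall>i<3. parity i g = 0" if "g \<in> lower_central Grig 2"
    using par0 that by (simp add: lower_central_2_alt)
  assume p: "\<forall>i<3. parity i g = 0"
  have cen: "u \<in> central_mod M" if "u \<in> GG" "?D \<subseteq> M" for u M
    unfolding central_mod_def using that commutator_subgroup_incl[of GG u] by auto
  have D1: "{g \<in> GG. g \<in> ?D \<or> grig_a \<circ> g \<in> ?D} \<lhd> Grig" (is "?D1 \<lhd> _")
    using DD(3) by (intro adjoin_normal D cen) (auto simp: gens_square)
  have D2: "{g \<in> GG. g \<in> ?D1 \<or> grig_b \<circ> g \<in> ?D1} \<lhd> Grig" (is "?D2 \<lhd> _")
    using Grig_normalD(3)[OF D1] DD(2) by (intro adjoin_normal D1 cen) (auto simp: gens_square)
  have D3: "{g \<in> GG. g \<in> ?D2 \<or> grig_d \<circ> g \<in> ?D2} \<lhd> Grig" (is "?D3 \<lhd> _")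
    using Grig_normalD(3)[OF D2] DD(2) by (intro adjoin_normal D2 cen) (auto simp: gens_square)
  have id: "id \<in> ?D" by (rule DD(3))
  have "grig_a \<in> ?D3" "grig_b \<in> ?D3" "grig_d \<in> ?D3"
    using id by (simp_all add: gens_square)
  moreover from this have "grig_b \<circ> grig_d \<in> ?D3" using Grig_normalD(4)[OF D3] by blast
  ultimately have "GG \<subseteq> ?D3"
    by (intro Grig_gens_subset_subgroup Grig_normalD(1)[OF D3]) (simp add: klein_relations)
  then have gD3: "g \<in> ?D3" using g by blast
  have 1: "parity 1 u = 0" "parity 2 u = 0" if u: "u \<in> ?D1" for u
    using u par0[of u 1] par0[of u 2] par0[of "grig_a \<circ> u" 1] par0[of "grig_a \<circ> u" 2]
    by (auto simp: parity_comp numeral_2_eq_2 simp del: o_apply)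
  have 2: "parity 2 u = parity 1 u" if u: "u \<in> ?D2" for u
  proof (cases "u \<in> ?D1")
    case False
    then have "grig_b \<circ> u \<in> ?D1" "u \<in> GG" using u by blast+
    then have "1 + parity 1 u = 0" "1 + parity 2 u = 0"
      using 1[of "grig_b \<circ> u"] by (simp_all add: parity_comp numeral_2_eq_2)
    then show ?thesis by (metis add_left_cancel)
  next
    case True
    from 1[OF True] show ?thesis by simp
  qed
  have p3: "parity 0 g = 0" "parity 1 g = 0" "parity 2 g = 0" using p by simp_all
  have "grig_d \<circ> g \<notin> ?D2"
  proof
    assume "grig_d \<circ> g \<in> ?D2"
    from 2[OF this] show False using g p3 by (simp add: parity_comp numeral_2_eq_2)
  qed
  then have gD2: "g \<in> ?D2" using gD3 by blast
  have "grig_b \<circ> g \<notin> ?D1"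
  proof
    assume "grig_b \<circ> g \<in> ?D1"
    from 1(1)[OF this] show False using g p3 by (simp add: parity_comp)
  qed
  then have gD1: "g \<in> ?D1" using gD2 by blast
  have "grig_a \<circ> g \<notin> ?D"
  proof
    assume "grig_a \<circ> g \<in> ?D"
    from par0[OF this, of 0] show False using g p3 by (simp add: parity_comp)
  qed
  then show "g \<in> lower_central Grig 2" using gD1 by (simp add: lower_central_2_alt)
qed

lemma rank_1: "has_rank (gamma_quot 1) 3"
proof -
  have "has_rank (Grig\<lparr>carrier := GG\<rparr> Mod lower_central Grig 2) 3"
  proof (rule has_rank_quotient[where f = parity])
    show "subgroup GG Grig" by (rule Grig.subgroup_self)
    show "lower_central Grig 2 \<subseteq> GG" by (auto simp: lower_central_2)
    fix t :: "nat \<Rightarrow> bit"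
    define u where "u = (if t 0 = 1 then grig_a else id)"
    define v where "v = (if t 1 = 1 then grig_b else id)"
    \<comment> \<open>\<open>b\<close> has parity 1 on both levels 1 and 2, so \<open>d\<close> has to account for their difference\<close>
    define w where "w = (if t 1 = t 2 then id else grig_d)"
    have uvw: "u \<in> GG" "v \<in> GG" "w \<in> GG" by (auto simp: u_def v_def w_def)
    have "parity i (u \<circ> v \<circ> w) = t i" if "i < 3" for i
    proof -
      have "i = 0 \<or> i = Suc 0 \<or> i = Suc (Suc 0)" using that by auto
      then show ?thesis using uvw
        by (cases "t 0"; cases "t 1"; cases "t 2") (auto simp: parity_comp u_def v_def w_def numeral_2_eq_2)
    qed
    then show "\<exists>g\<in>GG. \<forall>i<3. parity i g = t i" using uvw by blast
  qed (use abelianization_kernel parity_comp in auto)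
  then show ?thesis by (simp add: gamma_quot_def numeral_2_eq_2)
qed

text \<open>The quotient \<open>\<gamma>\<^sub>2 / N\<^sub>1\<close> has representatives \<open>1, x, z, xz\<close>. The first components \<open>ca\<close> of \<open>x\<close> and \<open>b\<close> of \<open>z\<close>
  are separated by the parities of the levels 0 and 2.\<close>

lemma rank_2: "has_rank (gamma_quot 2) 2"
proof -
  let ?S = "lower_central Grig 2"
  let ?f = "\<lambda>i g. if i = (0::nat) then parity 0 (sec g [False]) else parity 2 (sec g [False])"
  have N: "?S \<lhd> Grig" unfolding lower_central_2_alt by (rule commutator_subgroup_normal[OF Grig.normal_self])
  note SD = Grig_normalD[OF N]
  have stab: "g [False] = [False]" if "g \<in> ?S" for g
  proof -
    have gG: "g \<in> GG" and p: "\<forall>i<3. parity i g = 0" using that SD(2) abelianization_kernel by auto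
    have "\<not> hd (g [False])" using p[rule_format, of 0] by (simp add: parity.simps(1))
    then show ?thesis using act_first(5)[OF gG, of False] by (cases "g [False]") auto
  qed
  have hom: "?f i (g \<circ> h) = ?f i g + ?f i h" if "g \<in> ?S" "h \<in> ?S" for i g h
    using parity_sec_comp[of g h "[False]"] stab[OF that(2)] that SD(2) by auto
  have xS: "x_elt \<in> ?S" and zS: "z_elt \<in> ?S"
    using x_in_K KD(3) by (auto simp: lower_central_2 z_square)
  have fx: "?f 0 x_elt = 1" "?f 1 x_elt = 0" by (simp_all add: x_pair parity_comp numeral_2_eq_2)
  have fz: "?f 0 z_elt = 0" "?f 1 z_elt = 1" by (simp_all add: z_elt_def numeral_2_eq_2)
  have N0: "?f i g = 0" if "g \<in> N_grp (Suc 0)" for i g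
    using that N1_even by (auto simp: level_one_even_def)
  have NS: "N_grp (Suc 0) \<subseteq> ?S" using N1_incl(3) KD(2) by (auto simp: lower_central_2)
  have "has_rank (Grig\<lparr>carrier := ?S\<rparr> Mod N_grp (Suc 0)) 2"
  proof (rule has_rank_quotient[where f = ?f])
    show "subgroup ?S Grig" by (rule SD(1))
    show "N_grp (Suc 0) \<subseteq> ?S" by (rule NS)
    show "?f i (g \<circ> h) = ?f i g + ?f i h" if "g \<in> ?S" "h \<in> ?S" for i g h by (rule hom[OF that])
    show "\<exists>g\<in>?S. \<forall>i<2. ?f i g = t i" for t :: "nat \<Rightarrow> bit"
    proof -
      define u where "u = (if t 0 = 1 then x_elt else id)"
      define v where "v = (if t 1 = 1 then z_elt else id)"
      have uv: "u \<in> ?S" "v \<in> ?S" using xS zS SD(3) by (auto simp: u_def v_def)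
      have fu: "?f 0 u = t 0" "?f 1 u = 0" using fx by (auto simp: u_def)
      have fv: "?f 0 v = 0" "?f 1 v = t 1" using fz by (auto simp: v_def)
      have "?f i (u \<circ> v) = t i" if "i < 2" for i
      proof -
        have "i = 0 \<or> i = 1" using that by auto
        then show ?thesis using hom[OF uv, of i] fu fv by auto
      qed
      then show ?thesis using SD(4)[OF uv] by blast
    qed
    show "(\<forall>i<2. ?f i g = 0) \<longleftrightarrow> g \<in> N_grp (Suc 0)" if g: "g \<in> ?S" for g
    proof
      show "\<forall>i<2. ?f i g = 0" if "g \<in> N_grp (Suc 0)" using N0[OF that] by blast
      assume f0: "\<forall>i<2. ?f i g = 0"
      have f: "?f 0 g = 0" "?f 1 g = 0" using f0[rule_format, of 0] f0[rule_format, of 1] by auto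
      have "z_elt \<circ> g \<in> ?S" by (rule SD(4)[OF zS g])
      note h = hom[OF xS g] hom[OF zS g] hom[OF xS \<open>z_elt \<circ> g \<in> ?S\<close>]
      have "x_elt \<circ> g \<notin> N_grp (Suc 0)" using N0[of "x_elt \<circ> g" 0] h(1)[of 0] fx f by auto
      moreover have "z_elt \<circ> g \<notin> N_grp (Suc 0)" using N0[of "z_elt \<circ> g" 1] h(2)[of 1] fz f by auto
      moreover have "x_elt \<circ> (z_elt \<circ> g) \<notin> N_grp (Suc 0)"
        using N0[of "x_elt \<circ> (z_elt \<circ> g)" 0] h(3)[of 0] h(2)[of 0] fx fz f by auto
      ultimately show "g \<in> N_grp (Suc 0)"
        using g K_cases[of g] K_cases[of "z_elt \<circ> g"] unfolding lower_central_2 by blast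
    qed
  qed
  then show ?thesis
    using lower_central_3 by (simp add: gamma_quot_def numeral_2_eq_2 numeral_3_eq_3)
qed

lemma rank_filtration:
  assumes r: "r < 2 ^ Suc m" 
  shows "has_rank (gamma_quot (2 ^ Suc m + 1 + r)) (if r < 2 ^ m then 2 else 1)"
proof -
  let ?k = "if r < 2 ^ m then 2 else 1 :: nat"
  let ?f = "\<lambda>i g. if i = (0::nat) then coord (Suc m) r (alpha g) else coord m r (beta g)"
  have "has_rank (Grig\<lparr>carrier := filtration m r\<rparr> Mod filtration m (Suc r)) ?k"
  proof (rule has_rank_quotient[where f = ?f])
    show "subgroup (filtration m r) Grig" by (rule Grig_normalD(1)[OF filtration_normal])
    show "filtration m (Suc r) \<subseteq> filtration m r" by (rule filtration_antimono) simp
    show "?f i (g \<circ> h) = ?f i g + ?f i h" if "g \<in> filtration m r" "h \<in> filtration m r" for i g h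
      using that coord_alpha_comp by (simp add: filtration_def)
    show "(\<forall>i<?k. ?f i g = 0) \<longleftrightarrow> g \<in> filtration m (Suc r)" if "g \<in> filtration m r" for g
      using that coord_ge[of m r "beta g"] by (auto simp: filtration_def vanish_below_Suc less_Suc_eq numeral_2_eq_2)
    show "\<exists>g\<in>filtration m r. \<forall>i<?k. ?f i g = t i" for t :: "nat \<Rightarrow> bit"
    proof -
      define p where "p = (if t 0 = 1 then v_fun r else (\<lambda>_. 0))"
      define q where "q = (if t 1 = 1 \<and> r < 2 ^ m then v_fun r else (\<lambda>_. 0))"
      obtain u where "u \<in> basis_grp (Suc m)" and a: "\<And>\<sigma>. length \<sigma> = Suc m \<Longrightarrow> alpha u \<sigma> = p \<sigma>" 
        and b: "\<And>\<tau>. length \<tau> = m \<Longrightarrow> beta u \<tau> = q \<tau>" using basis_surjective[of m p q] by blast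
      then have uN: "u \<in> N_grp (Suc m)" using basis_subset_N by auto
      have ea: "coord (Suc m) s (alpha u) = coord (Suc m) s p" for s by (rule coord_cong) (rule a)
      have eb: "coord m s (beta u) = coord m s q" for s by (rule coord_cong) (rule b)
      have 1: "coord (Suc m) s p = (if s = r then t 0 else 0)" if "s \<le> r" for s
        using coord_v_fun[OF r, of s] that r by (auto simp: p_def coord_zero)
      have 2: "coord m s q = (if s = r \<and> r < 2 ^ m then t 1 else 0)" if "s \<le> r" for s
        using coord_v_fun[of r m s] that by (auto simp: q_def coord_zero)
      have "u \<in> filtration m r" using uN 1 2 by (simp add: filtration_def vanish_below_def ea eb)
      moreover have "\<forall>i<?k. ?f i u = t i"
        using 1[of r] 2[of r] by (auto simp: ea eb less_Suc_eq numeral_2_eq_2)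
      ultimately show ?thesis by blast
    qed
  qed
  moreover have "lower_central Grig (2 ^ Suc m + 1 + r) = filtration m r"
    using lower_central_filtration[OF lower_central_N, of r m] r by simp
  moreover have "lower_central Grig (Suc (2 ^ Suc m + 1 + r)) = filtration m (Suc r)"
    using lower_central_filtration[OF lower_central_N, of "Suc r" m] r by simp
  ultimately show ?thesis unfolding gamma_quot_def by metis
qed

section \<open>The isomorphism onto the modules\<close>

definition alpha_beta :: "nat \<Rightarrow> (word \<Rightarrow> word) \<Rightarrow> qpoly \<times> qpoly" where
  "alpha_beta m g = (to_poly (Suc m) (alpha g), to_poly m (beta g))"

lemma qpoly_add_self: "p + p = (0 :: qpoly)"
  by (rule poly_mapping_eqI) (unfold lookup_add lookup_zero, rule bit_add_self)

lemma comm_group_V_mod: "comm_group (additive_group (V_mod n))"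
proof (rule comm_group_additive_group)
  show "0 \<in> V_mod n" using to_poly_V_mod[of n "\<lambda>_. 0"] by (simp add: to_poly_zero)
  show "p + q \<in> V_mod n" if "p \<in> V_mod n" "q \<in> V_mod n" for p q
    using that by (metis V_mod_to_poly to_poly_V_mod to_poly_add)
qed (rule qpoly_add_self)

lemma alpha_beta_comp:
  assumes "g \<in> N_grp (Suc m)" "h \<in> N_grp (Suc m)"
  shows "alpha_beta m (g \<circ> h) = alpha_beta m g + alpha_beta m h"
  unfolding alpha_beta_def plus_prod_def fst_conv snd_conv to_poly_add[symmetric] prod.inject to_poly_inject
  using alpha_comp[OF assms] by blast

lemma alpha_beta_kernel:
  assumes "g \<in> N_grp (Suc m)"
  shows "alpha_beta m g = 0 \<longleftrightarrow> g \<in> N_grp (Suc (Suc m))"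
proof -
  have "alpha_beta m g = (to_poly (Suc m) (\<lambda>_. 0), to_poly m (\<lambda>_. 0)) \<longleftrightarrow> g \<in> N_grp (Suc (Suc m))"
    unfolding alpha_beta_def prod.inject to_poly_inject using alpha_beta_zero_imp_N[OF assms] N_imp_alpha_beta_zero[of g m] by blast
  then show ?thesis by (simp add: to_poly_zero zero_prod_def)
qed

lemma alpha_beta_at_vertex_x:
  assumes "length \<sigma> = Suc m"
  shows "alpha_beta m (at_vertex \<sigma> x_elt) = (word_monomial \<sigma>, 0)"
proof -
  have "to_poly (Suc m) (alpha (at_vertex \<sigma> x_elt)) = to_poly (Suc m) (\<lambda>\<sigma>'. of_bool (\<sigma> = \<sigma>'))"
    "to_poly m (beta (at_vertex \<sigma> x_elt)) = to_poly m (\<lambda>_. 0)"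
    using alpha_beta_at_vertex(1)[of \<sigma>] alpha_beta_at_vertex(2)[of \<sigma>] assms by (intro to_poly_cong; simp)+
  then show ?thesis by (simp add: alpha_beta_def to_poly_delta[OF assms] to_poly_zero)
qed

lemma alpha_beta_at_vertex_x2:
  assumes "length \<tau> = m"
  shows "alpha_beta m (at_vertex \<tau> x2_elt) = (0, word_monomial \<tau>)"
proof -
  have "to_poly m (beta (at_vertex \<tau> x2_elt)) = to_poly m (\<lambda>\<sigma>'. of_bool (\<tau> = \<sigma>'))"
    "to_poly (Suc m) (alpha (at_vertex \<tau> x2_elt)) = to_poly (Suc m) (\<lambda>_. 0)"
    using alpha_beta_at_vertex(4)[of \<tau>] alpha_beta_at_vertex(3)[of _ \<tau>] assms by (intro to_poly_cong; simp)+
  then show ?thesis by (simp add: alpha_beta_def to_poly_delta[OF assms] to_poly_zero)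
qed

abbreviation V_sum :: "nat \<Rightarrow> (qpoly \<times> qpoly) monoid" where
  "V_sum m \<equiv> additive_group (V_mod (Suc m)) \<times>\<times> additive_group (V_mod m)"

lemma alpha_beta_iso_exists: "\<exists>\<phi>. alpha_beta_iso (Suc m) \<phi>"
proof -
  let ?N = "N_grp (Suc m)"
  have sub: "subgroup ?N Grig" using N_normal Grig_normalD(1) by simp
  have V_sum: "group (V_sum m)" 
    using comm_group_V_mod by (intro DirProd_group comm_group.axioms(2))
  have hyp: "\<And>g. g \<in> ?N \<Longrightarrow> alpha_beta m g \<in> carrier (V_sum m)"
    "\<And>g h. g \<in> ?N \<Longrightarrow> h \<in> ?N \<Longrightarrow> alpha_beta m (g \<circ> h) = alpha_beta m g \<otimes>\<^bsub>V_sum m\<^esub> alpha_beta m h"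
    "\<And>g. g \<in> ?N \<Longrightarrow> alpha_beta m g = \<one>\<^bsub>V_sum m\<^esub> \<longleftrightarrow> g \<in> N_grp (Suc (Suc m))"
    "N_grp (Suc (Suc m)) \<subseteq> ?N"
    "\<And>b. b \<in> carrier (V_sum m) \<Longrightarrow> \<exists>g\<in>?N. alpha_beta m g = b"
  proof -
    show "alpha_beta m g \<in> carrier (V_sum m)" for g by (simp add: alpha_beta_def to_poly_V_mod)
    show "alpha_beta m (g \<circ> h) = alpha_beta m g \<otimes>\<^bsub>V_sum m\<^esub> alpha_beta m h" if "g \<in> ?N" "h \<in> ?N" for g h
      unfolding alpha_beta_comp[OF that] by (simp add: alpha_beta_def)
    show "alpha_beta m g = \<one>\<^bsub>V_sum m\<^esub> \<longleftrightarrow> g \<in> N_grp (Suc (Suc m))" if "g \<in> ?N" for g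
      unfolding alpha_beta_kernel[OF that, symmetric] by (simp add: zero_prod_def)
    show "N_grp (Suc (Suc m)) \<subseteq> ?N" using N_Suc_subset[of "Suc m"] by simp
    fix b assume "b \<in> carrier (V_sum m)"
    then obtain p q where "b = (p, q)" "p \<in> V_mod (Suc m)" "q \<in> V_mod m" by auto
    then obtain f f' where b: "b = (to_poly (Suc m) f, to_poly m f')" by (metis V_mod_to_poly)
    obtain g where "g \<in> basis_grp (Suc m)" "\<forall>\<sigma>. length \<sigma> = Suc m \<longrightarrow> alpha g \<sigma> = f \<sigma>"
      "\<forall>\<tau>. length \<tau> = m \<longrightarrow> beta g \<tau> = f' \<tau>" using basis_surjective by blast
    then have "alpha_beta m g = b" "g \<in> ?N"
      unfolding alpha_beta_def b prod.inject to_poly_inject using basis_subset_N by auto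
    then show "\<exists>g\<in>?N. alpha_beta m g = b" by blast
  qed
  let ?\<phi> = "\<lambda>X. the_elem (alpha_beta m ` X)"
  have "?\<phi> \<in> iso (Grig\<lparr>carrier := ?N\<rparr> Mod N_grp (Suc (Suc m))) (V_sum m)"
    and val: "\<And>g. g \<in> ?N \<Longrightarrow> ?\<phi> (N_grp (Suc (Suc m)) #>\<^bsub>Grig\<^esub> g) = alpha_beta m g"
    by (rule quotient_iso[OF sub V_sum hyp]; assumption)+
  then have "alpha_beta_iso (Suc m) ?\<phi>"
    using at_vertex_in_N[of _ m] unfolding alpha_beta_iso_def N_quot_def
    by (simp add: val alpha_beta_at_vertex_x alpha_beta_at_vertex_x2)
  then show ?thesis by blast
qed

text \<open>An isomorphism with the prescribed values agrees with \<open>\<alpha> \<oplus> \<beta>\<close> on the basis elements and on \<open>N\<^sub>m\<^sub>+\<^sub>2\<close>, and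
  these generate \<open>N\<^sub>m\<^sub>+\<^sub>1\<close>.\<close>

lemma alpha_beta_iso_unique:
  assumes \<phi>: "alpha_beta_iso (Suc m) \<phi>" and g: "g \<in> N_grp (Suc m)"
  shows "\<phi> (N_grp (Suc (Suc m)) #>\<^bsub>Grig\<^esub> g) = alpha_beta m g"
proof -
  let ?N = "N_grp (Suc m)" and ?N' = "N_grp (Suc (Suc m))"
  have N: "?N \<lhd> Grig" and N': "?N' \<lhd> Grig" using N_normal by auto
  note ND = Grig_normalD[OF N] and ND' = Grig_normalD[OF N']
  have sub: "?N' \<subseteq> ?N" using N_Suc_subset[of "Suc m"] by simp
  let ?c = "\<lambda>g. ?N' #>\<^bsub>Grig\<^esub> g"
  have hom: "\<phi> \<in> hom (N_quot (Suc m)) (V_sum m)" 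
    using \<phi> by (simp add: alpha_beta_iso_def iso_def)
  have mult: "\<phi> (?c (g \<circ> h)) = \<phi> (?c g) + \<phi> (?c h)" if "g \<in> ?N" "h \<in> ?N" for g h
  proof -
    have gh: "g \<in> GG" "h \<in> GG" using that ND(2) by auto
    have "?c g \<in> carrier (N_quot (Suc m))" "?c h \<in> carrier (N_quot (Suc m))"
      using that by (auto simp: N_quot_def carrier_FactGroup r_coset_def)
    then have "\<phi> (?c g \<otimes>\<^bsub>N_quot (Suc m)\<^esub> ?c h) = \<phi> (?c g) \<otimes>\<^bsub>V_sum m\<^esub> \<phi> (?c h)"
      using hom by (rule hom_mult[rotated])
    moreover have "?c g \<otimes>\<^bsub>N_quot (Suc m)\<^esub> ?c h = ?c (g \<circ> h)"
      using normal.rcos_sum[OF N', of g h] gh by (simp add: N_quot_def set_mult_def)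
    ultimately show ?thesis by (simp add: mult_DirProd' plus_prod_def)
  qed
  have cancel: "p = 0" if "p = p + (p :: qpoly \<times> qpoly)" for p
    using that by (metis add_cancel_right_right)
  have zero: "\<phi> (?c n) = 0" if "n \<in> ?N'" for n
  proof -
    have "?c n = ?N'" using ND'(1) that ND'(2) by (intro Grig.coset_join2) auto
    moreover have "?c (n \<circ> n) = ?N'" using ND'(1) ND'(4)[OF that that] ND'(2) by (intro Grig.coset_join2) auto
    ultimately show ?thesis using mult[of n n] that sub cancel by (metis subsetD)
  qed
  have self: "p + p = 0" for p :: "qpoly \<times> qpoly"
    by (simp add: plus_prod_def zero_prod_def qpoly_add_self)
  let ?E = "{g \<in> ?N. \<phi> (?c g) = alpha_beta m g}"
  have E: "subgroup ?E Grig"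
  proof (rule Grig_subgroupI)
    show "?E \<subseteq> GG" using ND(2) by auto
    show "id \<in> ?E" using zero[OF ND'(3)] ND(3) alpha_beta_kernel[OF ND(3)] ND'(3) by simp
    show "g \<circ> h \<in> ?E" if "g \<in> ?E" "h \<in> ?E" for g h
      using that ND(4) mult alpha_beta_comp by simp
    show "iv g \<in> ?E" if gE: "g \<in> ?E" for g
    proof -
      have g: "g \<in> ?N" "iv g \<in> ?N" "g \<in> GG" using gE ND(2,5) by auto
      have "\<phi> (?c g) + \<phi> (?c (iv g)) = 0" "alpha_beta m g + alpha_beta m (iv g) = 0"
        using mult[OF g(1,2)] alpha_beta_comp[OF g(1,2)] zero[OF ND'(3)] alpha_beta_kernel[OF ND(3)] ND'(3) g(3)
        by simp_all
      then have "\<phi> (?c (iv g)) = alpha_beta m (iv g)"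
        using gE by (metis (mono_tags, lifting) add_left_cancel mem_Collect_eq)
      then show ?thesis using g by simp
    qed
  qed
  have "basis_grp (Suc m) \<subseteq> ?E"
    unfolding basis_grp_def
  proof (rule Grig.generate_subgroup_incl[OF _ E])
    show "{at_vertex \<sigma> x_elt | \<sigma>. length \<sigma> = Suc m} \<union> {at_vertex \<tau> x2_elt | \<tau>. length \<tau> = Suc m - 1} \<subseteq> ?E"
      using \<phi> at_vertex_in_N by (auto simp: alpha_beta_iso_def alpha_beta_at_vertex_x alpha_beta_at_vertex_x2)
  qed
  moreover obtain u where u: "u \<in> basis_grp (Suc m)" "\<And>\<sigma>. length \<sigma> = Suc m \<Longrightarrow> alpha u \<sigma> = alpha g \<sigma>"
    "\<And>\<tau>. length \<tau> = m \<Longrightarrow> beta u \<tau> = beta g \<tau>" using basis_surjective[of m "alpha g" "beta g"] by blast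
  ultimately have uE: "u \<in> ?E" by blast
  then have uN: "u \<in> ?N" "iv u \<in> ?N" "u \<in> GG" using ND(2,5) by auto
  have gu: "g \<circ> iv u \<in> ?N" using ND(4) g uN by blast
  have "alpha_beta m (g \<circ> iv u) = alpha_beta m g + alpha_beta m (iv u)" by (rule alpha_beta_comp[OF g uN(2)])
  moreover have "alpha_beta m u + alpha_beta m (iv u) = 0"
    using alpha_beta_comp[OF uN(1,2)] alpha_beta_kernel[OF ND(3)] ND'(3) uN(3) by simp
  moreover have "alpha_beta m g = alpha_beta m u"
    unfolding alpha_beta_def prod.inject to_poly_inject using u by simp
  ultimately have guN: "g \<circ> iv u \<in> ?N'" using alpha_beta_kernel[OF gu] by simp
  have "\<phi> (?c ((g \<circ> iv u) \<circ> u)) = \<phi> (?c (g \<circ> iv u)) + \<phi> (?c u)" by (rule mult[OF gu uN(1)])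
  then have "\<phi> (?c g) = \<phi> (?c u)" using zero[OF guN] uN(3) by (simp add: comp_assoc)
  then show ?thesis using uE \<open>alpha_beta m g = alpha_beta m u\<close> by simp
qed

lemma full_preimage_filtration:
  assumes "alpha_beta_iso (Suc m) \<phi>"
  shows "full_preimage (Suc m) \<phi> (V_sub (Suc m) r) (V_sub m r) = filtration m r"
  unfolding full_preimage_def filtration_def
  using alpha_beta_iso_unique[OF assms] by (auto simp: alpha_beta_def V_sub_iff)

theorem theorem6p4:
  fixes m :: nat
  assumes "m \<ge> 1"
  shows "lower_central Grig (2 ^ m + 1) = N_grp m \<and>
    ((\<exists>\<phi>. alpha_beta_iso m \<phi>) \<and>
     (\<forall>\<phi>. alpha_beta_iso m \<phi> \<longrightarrow>
       (\<forall>r \<le> 2 ^ m. lower_central Grig (2 ^ m + 1 + r) =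
          full_preimage m \<phi> (V_sub m r) (V_sub (m - 1) r)))) \<and>
    (has_rank (gamma_quot 1) 3 \<and>
     has_rank (gamma_quot 2) 2 \<and>
     (\<forall>r. r < 2 ^ (m - 1) \<longrightarrow> has_rank (gamma_quot (2 ^ m + 1 + r)) 2) \<and>
     (\<forall>r. 2 ^ (m - 1) \<le> r \<and> r < 2 ^ m \<longrightarrow> has_rank (gamma_quot (2 ^ m + 1 + r)) 1))"
proof -
  obtain k where m: "m = Suc k" using assms by (cases m) auto
  have "lower_central Grig (2 ^ m + 1 + r) = full_preimage m \<phi> (V_sub m r) (V_sub (m - 1) r)"
    if "alpha_beta_iso m \<phi>" "r \<le> 2 ^ m" for \<phi> r
    using lower_central_filtration[OF lower_central_N, of r k] full_preimage_filtration[of k \<phi> r] that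
    unfolding m by (simp del: power_Suc)
  moreover have "has_rank (gamma_quot (2 ^ m + 1 + r)) 2" if "r < 2 ^ (m - 1)" for r
    using rank_filtration[of r k] that unfolding m by simp
  moreover have "has_rank (gamma_quot (2 ^ m + 1 + r)) 1" if "2 ^ (m - 1) \<le> r" "r < 2 ^ m" for r
    using rank_filtration[of r k] that unfolding m by simp
  ultimately show ?thesis
    using lower_central_N[of k] alpha_beta_iso_exists[of k] rank_1 rank_2 unfolding m by blast
qed

end
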